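(* Let $X$ be the almost sure uniform limit of $X_n(t)=\mathrm{LI}(u_1T_nu_2)(\bar\alpha^nt)$ for a consistent sequence $(T_n)$ of uniform spanning trees, where $\bar\alpha=\frac43+\frac1{15}\sqrt{205}$. Then almost surely the Hausdorff dimension of the path $X([0,\infty])$ is \[\dim_H X([0,\infty])=\frac{\log\bar\alpha}{\log2}\approx1.193995.\]
   Context: Let $u_1=(0,0)$, $u_2=(1,0)$, $u_3=(\tfrac12,\tfrac{\sqrt3}2)$ in $\mathbb R^2$ and $\psi_i(x)=\tfrac12(x-u_i)+u_i$ for $i\in\{1,2,3\}$. The Sierpiński gasket $K$ is the unique nonempty compact set with $K=\psi_1(K)\cup\psi_2(K)\cup\psi_3(K)$. The Sierpiński graphs $G_n$ (embedded in the plane, all edges as straight segments lie in $K$) are defined recursively: $G_0$ has vertex set $VG_0=\{u_1,u_2,u_3\}$ and edge set $\{\{u_1,u_2\},\{u_2,u_3\},\{u_3,u_1\}\}$; $G_{n+1}$ has vertex set $\psi_1(VG_n)\cup\psi_2(VG_n)\cup\psi_3(VG_n)$ and edge set $\psi_1(EG_n)\cup\psi_2(EG_n)\cup\psi_3(EG_n)$ (edges mapped vertexwise). For a word $w=w_1\cdots w_k\in\{1,2,3\}^k$ put $\psi_w=\psi_{w_1}\circ\cdots\circ\psi_{w_k}$; then $G_n=\bigcup_{w\in\{1,2,3\}^k}\psi_w(G_{n-k})$. For a spanning subgraph $H\subseteq G_n$ and $w\in\{1,2,3\}^k$, $\pi_w(H)=\psi_w^{-1}(H\cap\psi_w(G_{n-k}))$.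 $\mathcal T_n$ denotes the set of spanning trees of $G_n$; $\mathcal S_n^i$ the set of spanning forests of $G_n$ with two components, one containing $u_i$ and the other containing $\{u_1,u_2,u_3\}\setminus\{u_i\}$; $\mathcal R_n$ the set of spanning forests with three components each containing exactly one of $u_1,u_2,u_3$; $\mathcal Q_n=\mathcal T_n\cup\mathcal S_n^1\cup\mathcal S_n^2\cup\mathcal S_n^3\cup\mathcal R_n$. For $g\in\mathcal Q_1$, $\mathrm{Tr}\,g$ is the spanning subgraph of $G_0$ equal to: the two edges at $u_i$ if $g$ is a spanning tree of $G_1$ in which for both $j\neq i$ the path from $u_i$ to $u_j$ lies in $\psi_i(G_0)\cup\psi_j(G_0)$ (every spanning tree of $G_1$ satisfies this for exactly one $i$); the single edge not containing $u_i$ if $g\in\mathcal S_1^i$; the edgeless graph if $g\in\mathcal R_1$. For $f\in\mathcal Q_{n+1}$, $\mathrm{Tr}\,f=\bigcup_{w\in\{1,2,3\}^n}\psi_w(\mathrm{Tr}\,\pi_w(f))$; Tr maps spanning trees of $G_{n+1}$ to spanning trees of $G_n$. A consistent sequence of uniform spanning trees is a sequence $(T_n)_{n\ge0}$ of random spanning trees defined on a common probability space such that $T_n$ is uniformly distributed on $\mathcal T_n$ and $\mathrm{Tr}\,T_{n+1}=T_n$ for all $n$. For a tree $t$ and vertices $x,y$, $xty$ denotes the unique self-avoiding walk in $t$ from $x$ to $y$. For a walk $x=(x_0,\dots,x_r)$, $\mathrm{LI}(x):[0,\infty]\to K$ is the linear interpolation $\mathrm{LI}(x)(t)=(k+1-t)x_k+(t-k)x_{k+1}$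 for $k\le t<k+1$, $k<r$, and $\mathrm{LI}(x)(t)=x_r$ for $t\ge r$. It is known that $X_n$ converges almost surely uniformly to a continuous curve $X$. *)

theory Defs
  imports "HOL-Probability.Probability"
begin

type_synonym pt = "real \<times> real"
type_synonym edge = "pt set"
type_synonym graph_edges = "edge set"

definition u :: "nat \<Rightarrow> pt" where
  "u i = (if i = 1 then (0, 0) else if i = 2 then (1, 0) else (1/2, sqrt 3 / 2))"

definition idx :: "nat set" where "idx = {1, 2, 3}"

definition psi :: "nat \<Rightarrow> pt \<Rightarrow> pt" where
  "psi i x = (1/2) *\<^sub>R (x - u i) + u i"

primrec psiw :: "nat list \<Rightarrow> pt \<Rightarrow> pt" where
  "psiw [] = id"
| "psiw (i # w) = psi i \<circ> psiw w"

definition words :: "nat \<Rightarrow> nat list set" where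
  "words k = {w. length w = k \<and> set w \<subseteq> idx}"

primrec VG :: "nat \<Rightarrow> pt set" where
  "VG 0 = {u 1, u 2, u 3}"
| "VG (Suc n) = (\<Union>i\<in>idx. psi i ` VG n)"

primrec EG :: "nat \<Rightarrow> graph_edges" where
  "EG 0 = {{u 1, u 2}, {u 2, u 3}, {u 3, u 1}}"
| "EG (Suc n) = (\<Union>i\<in>idx. (\<lambda>e. psi i ` e) ` EG n)"

text \<open>pi_w(H) for a spanning subgraph H of G_n (given by its edge set), w of length k:
  the edges of G_(n-k) whose image under psi_w lies in H.\<close>
definition piw :: "nat \<Rightarrow> nat list \<Rightarrow> graph_edges \<Rightarrow> graph_edges" where
  "piw n w H = {e \<in> EG (n - length w). psiw w ` e \<in> H}"

definition walk :: "graph_edges \<Rightarrow> pt list \<Rightarrow> bool" where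
  "walk E xs \<longleftrightarrow> xs \<noteq> [] \<and> (\<forall>k. Suc k < length xs \<longrightarrow> {xs ! k, xs ! Suc k} \<in> E)"

definition walk_edges :: "pt list \<Rightarrow> graph_edges" where
  "walk_edges xs = {{xs ! k, xs ! Suc k} | k. Suc k < length xs}"

definition conn :: "graph_edges \<Rightarrow> pt \<Rightarrow> pt \<Rightarrow> bool" where
  "conn E x y \<longleftrightarrow> (\<exists>xs. walk E xs \<and> hd xs = x \<and> last xs = y)"

definition acyclic_graph :: "graph_edges \<Rightarrow> bool" where
  "acyclic_graph E \<longleftrightarrow> \<not> (\<exists>xs. walk E xs \<and> distinct xs \<and> length xs \<ge> 3 \<and> {last xs, hd xs} \<in> E)"

definition connected_graph :: "pt set \<Rightarrow> graph_edges \<Rightarrow> bool" where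
  "connected_graph V E \<longleftrightarrow> (\<forall>x\<in>V. \<forall>y\<in>V. conn E x y)"

definition num_components :: "pt set \<Rightarrow> graph_edges \<Rightarrow> nat" where
  "num_components V E = card (V // {(x, y). x \<in> V \<and> y \<in> V \<and> conn E x y})"

definition tpath :: "pt \<Rightarrow> graph_edges \<Rightarrow> pt \<Rightarrow> pt list" where
  "tpath x t y = (THE xs. walk t xs \<and> distinct xs \<and> hd xs = x \<and> last xs = y)"

definition Trees :: "nat \<Rightarrow> graph_edges set" where
  "Trees n = {E. E \<subseteq> EG n \<and> connected_graph (VG n) E \<and> acyclic_graph E}"

definition Sset :: "nat \<Rightarrow> nat \<Rightarrow> graph_edges set" where
  "Sset n i = {E. E \<subseteq> EG n \<and> acyclic_graph E \<and> num_components (VG n) E = 2 \<and>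
     (\<forall>j\<in>idx - {i}. \<not> conn E (u i) (u j)) \<and>
     (\<forall>j\<in>idx - {i}. \<forall>k\<in>idx - {i}. conn E (u j) (u k))}"

definition Rset :: "nat \<Rightarrow> graph_edges set" where
  "Rset n = {E. E \<subseteq> EG n \<and> acyclic_graph E \<and> num_components (VG n) E = 3 \<and>
     (\<forall>j\<in>idx. \<forall>k\<in>idx. j \<noteq> k \<longrightarrow> \<not> conn E (u j) (u k))}"

definition good_corner :: "graph_edges \<Rightarrow> nat \<Rightarrow> bool" where
  "good_corner g i \<longleftrightarrow> (\<forall>j\<in>idx - {i}.
     walk_edges (tpath (u i) g (u j)) \<subseteq> (\<lambda>e. psi i ` e) ` EG 0 \<union> (\<lambda>e. psi j ` e) ` EG 0)"

definition Tr1 :: "graph_edges \<Rightarrow> graph_edges" where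
  "Tr1 g = (if g \<in> Trees 1 then {e \<in> EG 0. \<exists>i\<in>idx. good_corner g i \<and> u i \<in> e}
            else if (\<exists>i\<in>idx. g \<in> Sset 1 i) then {e \<in> EG 0. \<exists>i\<in>idx. g \<in> Sset 1 i \<and> u i \<notin> e}
            else {})"

text \<open>Tr n f maps a spanning subgraph f of G_(n+1) to a spanning subgraph of G_n.\<close>
definition Tr :: "nat \<Rightarrow> graph_edges \<Rightarrow> graph_edges" where
  "Tr n f = (\<Union>w\<in>words n. (\<lambda>e. psiw w ` e) ` Tr1 (piw (Suc n) w f))"

definition LI :: "pt list \<Rightarrow> ereal \<Rightarrow> pt" where
  "LI xs t = (if t \<ge> ereal (real (length xs - 1)) then last xs
              else (let s = real_of_ereal t; k = nat \<lfloor>s\<rfloor> in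
                    (real k + 1 - s) *\<^sub>R (xs ! k) + (s - real k) *\<^sub>R (xs ! Suc k)))"

definition alpha_bar :: real where
  "alpha_bar = 4/3 + sqrt 205 / 15"

definition Xn :: "nat \<Rightarrow> graph_edges \<Rightarrow> ereal \<Rightarrow> pt" where
  "Xn n t s = LI (tpath (u 1) t (u 2)) (ereal (alpha_bar ^ n) * s)"

definition hausdorff_delta :: "real \<Rightarrow> real \<Rightarrow> 'a::metric_space set \<Rightarrow> ennreal" where
  "hausdorff_delta s \<delta> A = (INF U \<in> {U :: nat \<Rightarrow> 'a set. A \<subseteq> (\<Union>i. U i) \<and>
        (\<forall>i. bounded (U i) \<and> diameter (U i) \<le> \<delta>)}. (\<Sum>i. ennreal (diameter (U i) powr s)))"

definition hausdorff_measure :: "real \<Rightarrow> 'a::metric_space set \<Rightarrow> ennreal" where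
  "hausdorff_measure s A = (SUP \<delta> \<in> {0<..}. hausdorff_delta s \<delta> A)"

definition hausdorff_dim :: "'a::metric_space set \<Rightarrow> real" where
  "hausdorff_dim A = Inf {s. s \<ge> 0 \<and> hausdorff_measure s A = 0}"

end

theory Submission
  imports Defs
begin

text \<open>Split \<open>T n\<close> along the three subcells of the gasket. The restriction to a subcell is a spanning tree,
  a two-component or a three-component forest separating the corners, and given these types the three
  restrictions are independent and uniform. The path from \<open>u 1\<close> to \<open>u 2\<close> visits two or three subcells,
  each of them a tree or a two-component forest, so the visited cells of level at most \<open>n\<close> form a two-type
  branching process; its law does not depend on the level because the numbers \<open>t\<close>, \<open>s\<close>, \<open>r\<close> of forests of
  the three kinds satisfy \<open>t * r = 3 * s\<^sup>2\<close>. The mean matrix has the leading eigenvalue \<open>alpha_bar\<close>.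

  The first moment bounds the number of visited cells of level \<open>k\<close> and hence the dimension from above.
  For the lower bound, percolation with parameter \<open>2 powr - s\<close> on the tree of visited cells survives with
  positive probability if \<open>s < ln alpha_bar / ln 2\<close>. The survival probability given the tree is almost surely
  positive, because every cell has at least two descendants, and it bounds the sum of
  \<open>2 powr - (s * level)\<close> over any cutset from below, hence up to a constant the cost of any cover of the curve.
  Both bounds hold for infinitely many \<open>n\<close>, which is enough to pass to the uniform limit.\<close>

subsection \<open>Walks and connectedness\<close>

text \<open>The branching process is never built as a random object: a tree of fixed level enters
  only through averages over the finite set \<open>Trees n\<close>. \<open>avg_le\<close> bounds
  such an average by one number for each of the two types, and a branching step acts on this pair by
  the offspring generating functions (\<open>step_prod\<close>) or by the mean matrix
  (\<open>step_sum\<close>).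

  The obstacle below this is to know which triples of forests glue to which kind of forest.
  Acyclicity is expressed by bridges, hence by connectedness, and connectedness between corners and
  junctions depends only on nine truth values \<open>pconn\<close>; the classification thus becomes
  propositional.

  Two descendants per cell give almost sure positivity as follows. A small \<open>theta\<close> at a
  cell forces it below a threshold larger by the factor \<open>1 / l\<close> at all children, so the
  bound on the fraction of such trees is squared at each level and decays like
  \<open>r ^ (2 ^ k)\<close>. Events of probability at most \<open>c\<close> for every large
  \<open>n\<close> fail for infinitely many \<open>n\<close> outside a set of probability at most
  \<open>c\<close>, by Fatou's lemma.\<close>

definition adj :: "graph_edges \<Rightarrow> (pt \<times> pt) set" where
  "adj E = {(x, y). {x, y} \<in> E}"

lemma adj_mono: "E \<subseteq> E' \<Longrightarrow> adj E \<subseteq> adj E'"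
  by (auto simp: adj_def)

lemma walk_singleton [simp]: "walk E [x]"
  by (simp add: walk_def)

lemma walk_Cons_Cons: "walk E (x # y # ys) \<longleftrightarrow> {x, y} \<in> E \<and> walk E (y # ys)"
  unfolding walk_def
  apply (auto simp: nth_Cons split: nat.splits)
  done

lemma walk_append:
  assumes "walk E xs" "walk E ys" "last xs = hd ys"
  shows "walk E (xs @ tl ys)"
  using assms
proof (induction xs)
  case Nil
  then show ?case by (simp add: walk_def)
next
  case (Cons x xs)
  show ?case
  proof (cases xs)
    case Nil
    with Cons.prems have "x = hd ys" "ys \<noteq> []" by (auto simp: walk_def)
    then have "x # tl ys = ys" by simp
    with Nil Cons.prems show ?thesis by simp
  next
    case (Cons z zs)
    with Cons.prems Cons.IH show ?thesis by (auto simp: walk_Cons_Cons)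
  qed
qed

lemma conn_iff_rtrancl: "conn E x y \<longleftrightarrow> (x, y) \<in> (adj E)\<^sup>*"
proof
  assume "conn E x y"
  then obtain xs where "walk E xs" "hd xs = x" "last xs = y" by (auto simp: conn_def)
  then show "(x, y) \<in> (adj E)\<^sup>*"
  proof (induction xs arbitrary: x)
    case Nil
    then show ?case by (simp add: walk_def)
  next
    case (Cons z zs)
    show ?case
    proof (cases zs)
      case Nil
      with Cons.prems show ?thesis by simp
    next
      case (Cons v vs)
      with Cons.prems Cons.IH[of v] show ?thesis
        by (auto simp: walk_Cons_Cons adj_def intro: converse_rtrancl_into_rtrancl)
    qed
  qed
next
  assume "(x, y) \<in> (adj E)\<^sup>*"
  then show "conn E x y"
  proof (induction rule: converse_rtrancl_induct)
    case base
    have "walk E [y] \<and> hd [y] = y \<and> last [y] = y" by simp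
    then show ?case unfolding conn_def by blast
  next
    case (step x z)
    then obtain xs where xs: "walk E xs" "hd xs = z" "last xs = y" by (auto simp: conn_def)
    then obtain zs where "xs = z # zs" by (cases xs) (auto simp: walk_def)
    with xs step have "walk E (x # xs) \<and> hd (x # xs) = x \<and> last (x # xs) = y"
      by (auto simp: walk_Cons_Cons adj_def)
    then show ?case unfolding conn_def by blast
  qed
qed

lemma conn_refl [simp]: "conn E x x"
  by (simp add: conn_iff_rtrancl)

lemma conn_trans: "conn E x y \<Longrightarrow> conn E y z \<Longrightarrow> conn E x z"
  by (simp add: conn_iff_rtrancl)

lemma conn_sym: "conn E x y \<Longrightarrow> conn E y x"
proof -
  have "sym (adj E)" by (auto simp: sym_def adj_def insert_commute)
  then show "conn E x y \<Longrightarrow> conn E y x"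
    unfolding conn_iff_rtrancl by (meson sym_rtrancl symD)
qed

lemma conn_commute: "conn E x y \<longleftrightarrow> conn E y x"
  using conn_sym by blast

lemma conn_edge: "{x, y} \<in> E \<Longrightarrow> conn E x y"
  by (auto simp: conn_iff_rtrancl adj_def)

lemma conn_mono: "conn E x y \<Longrightarrow> E \<subseteq> E' \<Longrightarrow> conn E' x y"
  unfolding conn_iff_rtrancl using rtrancl_mono[OF adj_mono] by blast

text \<open>The way to bound connectedness from above: exhibit a set of vertices that contains
  \<open>x\<close> and that no edge of \<open>E\<close> leaves. Most negative connectivity results
  below choose such a set.\<close>

lemma conn_closed:
  assumes "conn E x y" "x \<in> S" "\<And>v w. v \<in> S \<Longrightarrow> {v, w} \<in> E \<Longrightarrow> w \<in> S"
  shows "y \<in> S"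
  using assms(1) unfolding conn_iff_rtrancl
  by (induction rule: rtrancl_induct) (use assms in \<open>auto simp: adj_def\<close>)

lemma conn_in_verts:
  assumes "conn E x y" "x \<in> V" "\<Union>E \<subseteq> V"
  shows "y \<in> V"
  using assms(1,2) by (rule conn_closed) (use assms(3) in auto)

lemma walk_conn: "walk E xs \<Longrightarrow> v \<in> set xs \<Longrightarrow> conn E (hd xs) v"
proof (induction xs)
  case (Cons x xs)
  then show ?case
    by (cases xs) (auto simp: walk_Cons_Cons intro: conn_trans[OF conn_edge])
qed simp

lemma walk_set_subset:
  assumes "walk E xs" "hd xs \<in> V" "\<Union>E \<subseteq> V"
  shows "set xs \<subseteq> V"
  using assms conn_in_verts walk_conn by blast

lemma conn_imp_distinct_walk:
  assumes "conn E x y"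
  obtains xs where "walk E xs" "distinct xs" "hd xs = x" "last xs = y"
proof -
  have "\<exists>xs. walk E xs \<and> distinct xs \<and> hd xs = x \<and> last xs = y"
    using assms unfolding conn_iff_rtrancl
  proof (induction rule: converse_rtrancl_induct)
    case base
    have "walk E [y] \<and> distinct [y] \<and> hd [y] = y \<and> last [y] = y" by simp
    then show ?case by blast
  next
    case (step x z)
    then obtain xs where xs: "walk E xs" "distinct xs" "hd xs = z" "last xs = y" by blast
    have ne: "xs \<noteq> []" using xs by (simp add: walk_def)
    show ?case
    proof (cases "x \<in> set xs")
      case False
      then have "walk E (x # xs) \<and> distinct (x # xs) \<and> hd (x # xs) = x \<and> last (x # xs) = y"
        using xs ne step(1) by (cases xs) (auto simp: walk_Cons_Cons adj_def)
      then show ?thesis by blast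
    next
      case True
      then obtain ps qs where split: "xs = ps @ x # qs" by (meson split_list)
      have "walk E (x # qs)"
        using xs(1) unfolding split
      proof (induction ps)
        case (Cons p ps)
        then show ?case by (cases ps) (auto simp: walk_Cons_Cons)
      qed simp
      then have "walk E (x # qs) \<and> distinct (x # qs) \<and> hd (x # qs) = x \<and> last (x # qs) = y"
        using xs split by auto
      then show ?thesis by blast
    qed
  qed
  then show thesis using that by blast
qed

lemma walk_minus_edge:
  assumes "walk E xs" "\<not> {x, y} \<subseteq> set xs"
  shows "walk (E - {{x, y}}) xs"
  using assms
proof (induction xs)
  case (Cons z zs)
  then show ?case
    by (cases zs) (auto simp: walk_Cons_Cons)
qed (simp add: walk_def)

text \<open>With \<open>acyclic_graphI\<close> this says that acyclic means every edge is a bridge.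
  Cycles as vertex lists are avoided from here on in favour of statements about
  \<open>conn\<close>.\<close>

lemma acyclic_graph_bridge:
  assumes ac: "acyclic_graph E" and e: "{x, y} \<in> E" "x \<noteq> y"
  shows "\<not> conn (E - {{x, y}}) x y"
proof
  assume c: "conn (E - {{x, y}}) x y"
  obtain xs where xs: "walk (E - {{x, y}}) xs" "distinct xs" "hd xs = x" "last xs = y"
    using conn_imp_distinct_walk[OF c] .
  have "walk E xs" using xs(1) by (auto simp: walk_def)
  \<comment> \<open>A walk of only two vertices from \<open>x\<close> to \<open>y\<close> would use
    the deleted edge.\<close>
  moreover have "length xs \<ge> 3"
  proof (rule ccontr)
    assume "\<not> 3 \<le> length xs"
    moreover have "xs \<noteq> []" using xs by (auto simp: walk_def)
    ultimately consider v where "xs = [v]" | v w where "xs = [v, w]"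
      by (cases xs; cases "tl xs"; cases "tl (tl xs)") auto
    then show False by cases (use xs e in \<open>auto simp: walk_Cons_Cons\<close>)
  qed
  ultimately show False
    using ac xs e by (auto simp: acyclic_graph_def insert_commute)
qed

lemma acyclic_graphI:
  assumes br: "\<And>x y. {x, y} \<in> E \<Longrightarrow> x \<noteq> y \<Longrightarrow> \<not> conn (E - {{x, y}}) x y"
  shows "acyclic_graph E"
  unfolding acyclic_graph_def
proof
  assume "\<exists>xs. walk E xs \<and> distinct xs \<and> length xs \<ge> 3 \<and> {last xs, hd xs} \<in> E"
  then obtain xs where xs: "walk E xs" "distinct xs" "length xs \<ge> 3" "{last xs, hd xs} \<in> E"
    by blast
  obtain x y z zs where d: "xs = x # y # z # zs"
    using xs(3) by (metis (no_types, lifting) Suc_le_length_iff numeral_3_eq_3)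
  define l where "l = last (z # zs)"
  have l: "l \<in> set (z # zs)" unfolding l_def by (rule last_in_set) simp
  have "walk (E - {{l, x}}) (y # z # zs)"
    by (rule walk_minus_edge) (use xs(1,2) d in \<open>simp_all add: walk_Cons_Cons\<close>)
  then have "conn (E - {{l, x}}) y l"
    using walk_conn[of _ "y # z # zs" l] l by auto
  moreover have "{x, y} \<in> E - {{l, x}}"
    using xs d l by (auto simp: walk_Cons_Cons doubleton_eq_iff)
  ultimately have c: "conn (E - {{l, x}}) x l" by (rule conn_trans[OF conn_edge, rotated])
  have "l \<noteq> x" "{l, x} \<in> E" using xs d l by (auto simp: l_def)
  then show False using br[of l x] conn_sym[OF c] by simp
qed

text \<open>Where the two walks first differ, one continues to \<open>p\<close> and the other to
  \<open>q\<close>. Neither tail returns to \<open>x\<close>, so going along the second tail to the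
  common end and back along the first joins \<open>x\<close> to \<open>p\<close> without the edge
  \<open>{x, p}\<close>, which must be a bridge.\<close>

lemma distinct_walk_unique:
  assumes "acyclic_graph E" "walk E xs" "walk E ys" "distinct xs" "distinct ys"
    and "hd xs = hd ys" "last xs = last ys"
  shows "xs = ys"
  using assms(2-7)
proof (induction xs arbitrary: ys)
  case Nil
  then show ?case by (simp add: walk_def)
next
  case (Cons x xs)
  then obtain ys' where ys: "ys = x # ys'" by (cases ys) (auto simp: walk_def)
  show ?case
  proof (cases "xs = [] \<or> ys' = []")
    case True
    then show ?thesis using Cons.prems ys
      by (auto split: if_splits dest: last_in_set)
  next
    case False
    then obtain p ps q qs where d: "xs = p # ps" "ys' = q # qs"
      by (meson neq_Nil_conv)
    show ?thesis
    proof (cases "p = q")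
      case True
      then have "xs = ys'"
        using Cons.prems ys d by (intro Cons.IH) (auto simp: walk_Cons_Cons)
      then show ?thesis using ys by simp
    next
      case False
      let ?E = "E - {{x, p}}"
      have "walk ?E xs" "walk ?E ys'"
        by (rule walk_minus_edge; use Cons.prems d ys in \<open>auto simp: walk_Cons_Cons\<close>)+
      then have p: "conn ?E p (last xs)" and q: "conn ?E q (last ys')"
        using walk_conn[of ?E xs] walk_conn[of ?E ys'] d by auto
      have l: "last xs = last ys'" using Cons.prems ys d by simp
      have "{x, q} \<in> ?E"
        using Cons.prems ys d False by (auto simp: walk_Cons_Cons doubleton_eq_iff)
      then have "conn ?E x (last xs)" unfolding l using q by (rule conn_trans[OF conn_edge])
      then have c: "conn ?E x p" by (rule conn_trans) (rule conn_sym[OF p])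
      have "{x, p} \<in> E" "x \<noteq> p" using Cons.prems d by (auto simp: walk_Cons_Cons)
      then show ?thesis using acyclic_graph_bridge[OF assms(1)] c by blast
    qed
  qed
qed

lemma tpath_eqI:
  assumes "acyclic_graph E" "walk E xs" "distinct xs" "hd xs = x" "last xs = y"
  shows "tpath x E y = xs"
  unfolding tpath_def
proof (rule the_equality)
  fix ys assume "walk E ys \<and> distinct ys \<and> hd ys = x \<and> last ys = y"
  then show "ys = xs" using distinct_walk_unique[of E ys xs] assms by simp
qed (use assms in simp)

lemma tpath_props:
  assumes "acyclic_graph E" "conn E x y"
  shows "walk E (tpath x E y)" "distinct (tpath x E y)" "hd (tpath x E y) = x"
    "last (tpath x E y) = y"
proof -
  obtain xs where xs: "walk E xs" "distinct xs" "hd xs = x" "last xs = y"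
    using conn_imp_distinct_walk[OF assms(2)] .
  then have "tpath x E y = xs" by (rule tpath_eqI[OF assms(1)])
  with xs show "walk E (tpath x E y)" "distinct (tpath x E y)" "hd (tpath x E y) = x"
    "last (tpath x E y) = y" by simp_all
qed

text \<open>Points are pairs of reals; quantifiers over points are kept from being split into
  coordinates.\<close>

declare split_paired_All [simp del] split_paired_Ex [simp del]

subsection \<open>The cells of the gasket\<close>

text \<open>Barycentric coordinates with respect to \<open>u 1\<close>, \<open>u 2\<close>,
  \<open>u 3\<close>. In these, \<open>psi j\<close> halves all coordinates and adds
  \<open>1/2\<close> to the \<open>j\<close>-th, so square roots disappear from arguments about
  cells.\<close>

definition bary :: "nat \<Rightarrow> pt \<Rightarrow> real" where
  "bary i x = (if i = 1 then 1 - fst x - snd x / sqrt 3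
     else if i = 2 then fst x - snd x / sqrt 3 else 2 * snd x / sqrt 3)"

text \<open>The solid triangle in place of the gasket: it is convex, so a linearly interpolated edge
  stays in every cell that contains its end points.\<close>

definition Tri :: "pt set" where
  "Tri = {x. \<forall>i\<in>idx. 0 \<le> bary i x}"

abbreviation tri :: "nat list \<Rightarrow> pt set" where
  "tri w \<equiv> psiw w ` Tri"

lemma idx_iff: "i \<in> idx \<longleftrightarrow> i = 1 \<or> i = 2 \<or> i = 3"
  by (auto simp: idx_def)

lemma finite_idx [simp]: "finite idx"
  by (simp add: idx_def)

lemma bary_u: "i \<in> idx \<Longrightarrow> j \<in> idx \<Longrightarrow> bary i (u j) = (if i = j then 1 else 0)"
  by (auto simp: idx_iff bary_def u_def)

lemma bary_psi:
  "i \<in> idx \<Longrightarrow> j \<in> idx \<Longrightarrow> bary i (psi j x) = (bary i x + (if i = j then 1 else 0)) / 2"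
  by (auto simp: idx_iff bary_def psi_def u_def field_simps)

lemma bary_sum: "bary 1 x + bary 2 x + bary 3 x = 1"
  by (simp add: bary_def field_simps)

lemma bary_eqI:
  assumes "\<And>i. i \<in> idx \<Longrightarrow> bary i x = bary i y"
  shows "x = y"
proof -
  have "bary 3 x = bary 3 y" "bary 2 x = bary 2 y" using assms by (auto simp: idx_iff)
  then show ?thesis by (simp add: bary_def prod_eq_iff)
qed

lemma psi_u_commute: "psi i (u j) = psi j (u i)"
  by (simp add: psi_def prod_eq_iff field_simps)

lemma psi_u_same [simp]: "psi i (u i) = u i"
  by (simp add: psi_def)

lemma psi_eq_iff [simp]: "psi i x = psi i y \<longleftrightarrow> x = y"
  by (simp add: psi_def)

lemma inj_psi: "inj (psi i)"
  by (rule injI) simp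

lemma psi_image_eq_iff: "psi i ` A = psi i ` B \<longleftrightarrow> A = B"
  by (rule inj_image_eq_iff[OF inj_psi])

lemma psi_image_doubleton:
  assumes "psi i ` e = {psi i v, psi i w}"
  shows "e = {v, w}"
proof -
  have "psi i ` e = psi i ` {v, w}" using assms by simp
  then show ?thesis by (simp only: psi_image_eq_iff)
qed

lemma u_eq_iff: "i \<in> idx \<Longrightarrow> j \<in> idx \<Longrightarrow> u i = u j \<longleftrightarrow> i = j"
  by (auto simp: idx_iff u_def)

text \<open>Two subcells meet in one point. Comparing the \<open>i\<close>-th coordinates gives
  \<open>bary i x + 1 = bary i y <= 1\<close>, which forces \<open>y = u i\<close>; exchanging the
  roles gives \<open>x = u j\<close>.\<close>

lemma psi_eq_psi:
  assumes "i \<in> idx" "j \<in> idx" "i \<noteq> j" "x \<in> Tri" "y \<in> Tri" "psi i x = psi j y"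
  shows "x = u j" "y = u i"
proof -
  have aux: "x = u j" if h: "i \<in> idx" "j \<in> idx" "i \<noteq> j" "x \<in> Tri" "y \<in> Tri" "psi i x = psi j y"
    for i j x y
  proof (rule bary_eqI)
    fix k assume k: "k \<in> idx"
    have "bary l x + (if l = i then 1 else 0) = bary l y + (if l = j then 1 else 0)" if "l \<in> idx" for l
      using arg_cong[OF h(6), of "bary l"] bary_psi[OF that h(1)] bary_psi[OF that h(2)]
      by (simp split: if_splits)
    note e = this[of 1] this[of 2] this[of 3]
    have "0 \<le> bary l x" "0 \<le> bary l y" if "l \<in> idx" for l using h that by (auto simp: Tri_def)
    note n = this[of 1] this[of 2] this[of 3]
    show "bary k x = bary k (u j)"
      unfolding bary_u[OF k h(2)]
      using h(1-3) k e n bary_sum[of x] bary_sum[of y]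
      by (auto simp: idx_iff)
  qed
  show "x = u j" "y = u i"
    using aux[OF assms] aux[of j i y x] assms by auto
qed

lemma psi_Tri: "i \<in> idx \<Longrightarrow> x \<in> Tri \<Longrightarrow> psi i x \<in> Tri"
  by (auto simp: Tri_def bary_psi)

lemma u_in_Tri: "i \<in> idx \<Longrightarrow> u i \<in> Tri"
  by (auto simp: Tri_def bary_u)

lemma VG_subset_Tri: "VG n \<subseteq> Tri"
  by (induction n) (auto simp: psi_Tri intro: u_in_Tri simp: idx_iff)

lemma u_in_VG: "i \<in> idx \<Longrightarrow> u i \<in> VG n"
proof (induction n)
  case (Suc n)
  then have "psi i (u i) \<in> psi i ` VG n" by blast
  with Suc show ?case by auto
qed (auto simp: idx_iff)

lemma finite_EG: "finite (EG n)"
  by (induction n) auto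

lemma EG_edge:
  assumes "e \<in> EG n"
  obtains x y where "e = {x, y}" "x \<noteq> y" "x \<in> VG n" "y \<in> VG n"
proof -
  have "\<exists>x y. e = {x, y} \<and> x \<noteq> y \<and> x \<in> VG n \<and> y \<in> VG n"
    using assms
  proof (induction n arbitrary: e)
    case 0
    have "u 1 \<noteq> u 2" "u 2 \<noteq> u 3" "u 3 \<noteq> u 1" by (auto simp: u_def)
    with 0 have "e = {u 1, u 2} \<and> u 1 \<noteq> u 2 \<or> e = {u 2, u 3} \<and> u 2 \<noteq> u 3 \<or> e = {u 3, u 1} \<and> u 3 \<noteq> u 1"
      by simp
    then show ?case unfolding VG.simps by blast
  next
    case (Suc n)
    then obtain i e' where i: "i \<in> idx" "e' \<in> EG n" "e = psi i ` e'" by auto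
    then obtain x y where "e' = {x, y}" "x \<noteq> y" "x \<in> VG n" "y \<in> VG n" using Suc.IH by blast
    with i have "e = {psi i x, psi i y} \<and> psi i x \<noteq> psi i y \<and> psi i x \<in> VG (Suc n) \<and> psi i y \<in> VG (Suc n)"
      by auto
    then show ?case by blast
  qed
  then show thesis using that by blast
qed

lemma Union_EG: "\<Union>(EG n) \<subseteq> VG n"
  by (auto elim!: EG_edge)

section \<open>Restriction to a subcell and connectedness through junctions\<close>

definition cell :: "nat \<Rightarrow> graph_edges \<Rightarrow> graph_edges" where
  "cell i g = (`) (psi i) ` g"

text \<open>The rescaled restriction to the \<open>i\<close>-th subcell. The condition
  \<open>e \<subseteq> Tri\<close> replaces membership in \<open>EG n\<close>, so the level is not a
  parameter; \<open>part_subset\<close> recovers the level.\<close>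

definition part :: "nat \<Rightarrow> graph_edges \<Rightarrow> graph_edges" where
  "part i f = {e. e \<subseteq> Tri \<and> psi i ` e \<in> f}"

lemma EG_Suc_cell: "EG (Suc n) = (\<Union>i\<in>idx. cell i (EG n))"
  by (simp add: cell_def)

lemma EG_subset_Tri: "e \<in> EG n \<Longrightarrow> e \<subseteq> Tri"
  using Union_EG VG_subset_Tri by blast

text \<open>Subcells share vertices but no edges: both end points of a common edge would be the
  single common point.\<close>

lemma cell_disjoint:
  assumes "i \<in> idx" "j \<in> idx" "e \<subseteq> Tri" "e' \<in> EG n" "psi i ` e = psi j ` e'"
  shows "i = j" "e = e'"
proof -
  show "i = j"
  proof (rule ccontr)
    assume ne: "i \<noteq> j"
    obtain x y where e': "e' = {x, y}" "x \<noteq> y" "x \<in> VG n" "y \<in> VG n" using assms(4) by (rule EG_edge)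
    have "v = u i" if v: "v \<in> e'" for v
    proof -
      obtain z where "z \<in> e" "psi i z = psi j v" using assms(5) v by (metis image_iff)
      then show ?thesis
        using psi_eq_psi(2)[OF assms(1,2) ne] assms(3) EG_subset_Tri[OF assms(4)] v by blast
    qed
    then have "x = u i" "y = u i" using e' by blast+
    then show False using e' by simp
  qed
  then show "e = e'" using assms(5) by (simp add: psi_image_eq_iff)
qed

lemma part_subset:
  assumes "f \<subseteq> EG (Suc n)" "i \<in> idx"
  shows "part i f \<subseteq> EG n"
proof
  fix e assume "e \<in> part i f"
  then have e: "psi i ` e \<in> EG (Suc n)" "e \<subseteq> Tri" using assms unfolding part_def by blast+
  then obtain j e' where j: "j \<in> idx" "e' \<in> EG n" "psi i ` e = psi j ` e'" by auto
  then show "e \<in> EG n" using cell_disjoint[OF assms(2) j(1) e(2) j(2)] by simp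
qed

lemma cell_part_subset: "cell i (part i f) \<subseteq> f"
  by (auto simp: cell_def part_def)

lemma cell_part_Un:
  assumes "f \<subseteq> EG (Suc n)"
  shows "f = (\<Union>i\<in>idx. cell i (part i f))"
proof
  show "f \<subseteq> (\<Union>i\<in>idx. cell i (part i f))"
  proof
    fix e assume e: "e \<in> f"
    then obtain i e' where e': "i \<in> idx" "e' \<in> EG n" "e = psi i ` e'" using assms by auto
    then have "e' \<in> part i f" using e EG_subset_Tri by (simp add: part_def)
    then show "e \<in> (\<Union>i\<in>idx. cell i (part i f))"
      using e' unfolding cell_def by blast
  qed
qed (use cell_part_subset in blast)

text \<open>Together with \<open>cell_part_Un\<close> this makes subgraphs of
  \<open>EG (Suc n)\<close> correspond to triples of subgraphs of \<open>EG n\<close>; the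
  independence of the restrictions rests on this bijection.\<close>

lemma part_cell_Un:
  assumes "\<And>i. i \<in> idx \<Longrightarrow> g i \<subseteq> EG n" "j \<in> idx"
  shows "part j (\<Union>i\<in>idx. cell i (g i)) = g j"
proof
  show "part j (\<Union>i\<in>idx. cell i (g i)) \<subseteq> g j"
  proof
    fix e assume "e \<in> part j (\<Union>i\<in>idx. cell i (g i))"
    then obtain i e' where e: "e \<subseteq> Tri" "i \<in> idx" "e' \<in> g i" "psi j ` e = psi i ` e'"
      by (auto simp: part_def cell_def)
    have "e' \<in> EG n" using assms(1) e by blast
    then show "e \<in> g j" using cell_disjoint[OF assms(2) e(2,1) _ e(4)] e(3) by simp
  qed
  show "g j \<subseteq> part j (\<Union>i\<in>idx. cell i (g i))"
  proof
    fix e assume "e \<in> g j"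
    then have "psi j ` e \<in> (\<Union>i\<in>idx. cell i (g i))" "e \<subseteq> Tri"
      using assms EG_subset_Tri unfolding cell_def by blast+
    then show "e \<in> part j (\<Union>i\<in>idx. cell i (g i))" by (simp add: part_def)
  qed
qed

lemma conn_cell: "conn (cell i g) (psi i x) (psi i y) \<longleftrightarrow> conn g x y"
proof
  assume c: "conn (cell i g) (psi i x) (psi i y)"
  have "psi i y \<in> psi i ` {v. conn g x v}"
  proof (rule conn_closed[OF c])
    fix v w assume v: "v \<in> psi i ` {v. conn g x v}" and e: "{v, w} \<in> cell i g"
    then obtain v' e' where v': "v = psi i v'" "conn g x v'" "e' \<in> g" "psi i ` e' = {v, w}"
      by (auto simp: cell_def)
    then obtain w' where w: "w = psi i w'" "w' \<in> e'" by (metis image_iff insertI1 insertI2)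
    have "e' = {v', w'}" by (rule psi_image_doubleton) (use v' w in simp)
    then have "conn g x w'" using v' conn_trans[OF v'(2)] conn_edge by simp
    then show "w \<in> psi i ` {v. conn g x v}" using w by blast
  qed simp
  then show "conn g x y" by auto
next
  assume c: "conn g x y"
  have "y \<in> {v. conn (cell i g) (psi i x) (psi i v)}"
  proof (rule conn_closed[OF c])
    fix v w assume v: "v \<in> {v. conn (cell i g) (psi i x) (psi i v)}" "{v, w} \<in> g"
    have "psi i ` {v, w} \<in> cell i g" unfolding cell_def using v(2) by (rule imageI)
    then have "{psi i v, psi i w} \<in> cell i g" by simp
    then show "w \<in> {v. conn (cell i g) (psi i x) (psi i v)}"
      using v(1) conn_trans[OF _ conn_edge] by simp
  qed simp
  then show "conn (cell i g) (psi i x) (psi i y)" by simp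
qed

lemma conn_part: "conn (part i f) x y \<Longrightarrow> conn f (psi i x) (psi i y)"
  using conn_cell conn_mono cell_part_subset by blast

lemma edge_of_part:
  assumes "f \<subseteq> EG (Suc n)" "{v, w} \<in> f"
  obtains i p q where "i \<in> idx" "{p, q} \<in> part i f" "v = psi i p" "w = psi i q"
    "p \<in> VG n" "q \<in> VG n"
proof -
  have "{v, w} \<in> (\<Union>i\<in>idx. cell i (part i f))"
    using assms(2) by (subst (asm) cell_part_Un[OF assms(1)])
  then obtain i where i: "i \<in> idx" "{v, w} \<in> cell i (part i f)" by (rule UN_E)
  from i(2) obtain e where e': "{v, w} = psi i ` e" "e \<in> part i f"
    unfolding cell_def by (rule imageE)
  note e = i(1) e'(2) e'(1)[symmetric]
  have "v \<in> psi i ` e" "w \<in> psi i ` e" unfolding e(3) by simp_all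
  then obtain p q where pq: "p \<in> e" "q \<in> e" "v = psi i p" "w = psi i q"
    by (elim imageE)
  have "e = {p, q}" by (rule psi_image_doubleton) (use e pq in simp)
  moreover have "e \<in> EG n" using e part_subset[OF assms(1)] by blast
  ultimately show thesis using that e pq Union_EG[of n] by blast
qed

text \<open>Paths between cells run through the points \<open>psi i (u j) = psi j (u i)\<close>, so connectedness
  between them is the closure of the connectedness within the cells. A set of such points is
  given as a symmetric relation on indices.\<close>
lemma conn_junction:
  assumes f: "f \<subseteq> EG (Suc n)"
    and sym: "\<And>i j. \<Phi> i j \<Longrightarrow> \<Phi> j i"
    and step: "\<And>i j k. \<lbrakk>i \<in> idx; j \<in> idx; k \<in> idx; \<Phi> i j; conn (part i f) (u j) (u k)\<rbrakk> \<Longrightarrow> \<Phi> i k"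
    and c: "conn f (psi i (u j)) (psi i' (u j'))"
    and \<Phi>: "\<Phi> i j" and idx: "i \<in> idx" "j \<in> idx" "i' \<in> idx" "j' \<in> idx"
  shows "\<Phi> i' j'"
proof -
  \<comment> \<open>All vertices reached within one cell from a junction in \<open>\<Phi>\<close>.
    An edge that continues in another cell starts at the common junction, which \<open>step\<close>
    and \<open>sym\<close> put into \<open>\<Phi>\<close> for the new cell.\<close>
  define S where "S = {v. \<exists>i\<in>idx. \<exists>j\<in>idx. \<exists>x\<in>VG n. v = psi i x \<and> conn (part i f) (u j) x \<and> \<Phi> i j}"
  have "psi i' (u j') \<in> S"
  proof (rule conn_closed[OF c])
    show "psi i (u j) \<in> S" unfolding S_def using \<Phi> idx u_in_VG by force
  next
    fix v w assume v: "v \<in> S" and e: "{v, w} \<in> f"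
    obtain i j x where i: "i \<in> idx" "j \<in> idx" "x \<in> VG n" "v = psi i x" "conn (part i f) (u j) x" "\<Phi> i j"
      using v by (auto simp: S_def)
    obtain m p q where m: "m \<in> idx" "{p, q} \<in> part m f" "v = psi m p" "w = psi m q" "p \<in> VG n" "q \<in> VG n"
      by (rule edge_of_part[OF f e])
    show "w \<in> S"
    proof (cases "m = i")
      case True
      then have "x = p" using i m by simp
      then have "conn (part i f) (u j) q" using i m True conn_trans[OF _ conn_edge] by simp
      then show ?thesis unfolding S_def using i m True by blast
    next
      case False
      then have xp: "x = u m" "p = u i"
        using psi_eq_psi[OF i(1) m(1), of x p] i m VG_subset_Tri[of n] by auto
      then have "\<Phi> m i" using step[OF i(1,2) m(1)] i sym by blast
      moreover have "conn (part m f) (u i) q" using m xp conn_edge by simp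
      ultimately show ?thesis unfolding S_def using i m by blast
    qed
  qed
  then obtain k l x where k: "k \<in> idx" "l \<in> idx" "x \<in> VG n" "psi i' (u j') = psi k x"
    "conn (part k f) (u l) x" "\<Phi> k l"
    by (auto simp: S_def)
  show ?thesis
  proof (cases "i' = k")
    case True
    then have "x = u j'" using k(4) by simp
    then show ?thesis using step[OF k(1,2) idx(4) k(6)] k(5) True by simp
  next
    case False
    have "x \<in> Tri" using k(3) VG_subset_Tri by blast
    then have "u j' = u k" and x: "x = u i'"
      using psi_eq_psi[OF idx(3) k(1) False, of "u j'" x] k(4) u_in_Tri[OF idx(4)] by blast+
    then have "j' = k" using u_eq_iff[OF idx(4) k(1)] by simp
    then show ?thesis using sym[OF step[OF k(1,2) idx(3) k(6)]] k(5) x by simp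
  qed
qed

subsection \<open>Gluing three subgraphs\<close>

text \<open>A labelling of the three corners. Statements are proved for an arbitrary labelling, so
  that the symmetries of the gasket are available by renaming \<open>a\<close>, \<open>b\<close>,
  \<open>c\<close>.\<close>

definition perm3 :: "nat \<Rightarrow> nat \<Rightarrow> nat \<Rightarrow> bool" where
  "perm3 a b c \<longleftrightarrow> idx = {a, b, c} \<and> a \<noteq> b \<and> a \<noteq> c \<and> b \<noteq> c"

lemma perm3_swap: "perm3 a b c \<Longrightarrow> perm3 b a c" "perm3 a b c \<Longrightarrow> perm3 a c b"
  by (auto simp: perm3_def)

lemma perm3_mem: "perm3 a b c \<Longrightarrow> a \<in> idx \<and> b \<in> idx \<and> c \<in> idx"
  by (auto simp: perm3_def)

abbreviation pconn :: "graph_edges \<Rightarrow> nat \<Rightarrow> nat \<Rightarrow> nat \<Rightarrow> bool" where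
  "pconn f i j k \<equiv> conn (part i f) (u j) (u k)"

lemma pconn_laws:
  "pconn f i a b \<and> pconn f i b c \<longrightarrow> pconn f i a c"
  "pconn f i a b \<and> pconn f i a c \<longrightarrow> pconn f i b c"
  "pconn f i a c \<and> pconn f i b c \<longrightarrow> pconn f i a b"
  using conn_trans conn_sym by blast+

text \<open>A simple route through the ring of three cells goes round it one way or the other, which
  gives the two alternatives on each right-hand side. Sufficiency is an explicit route; necessity is
  \<open>conn_junction\<close> applied to the set of junctions and corners that these formulas
  declare reachable.\<close>

lemma conn_from_corner:
  assumes f: "f \<subseteq> EG (Suc n)" and p: "perm3 a b c"
  shows "conn f (u a) (u b) \<longleftrightarrow>
      pconn f a a b \<and> pconn f b a b \<or> pconn f a a c \<and> pconn f c a b \<and> pconn f b b c" (is "?L1 \<longleftrightarrow> ?R1")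
    and "conn f (u a) (psi a (u b)) \<longleftrightarrow>
      pconn f a a b \<or> pconn f a a c \<and> pconn f c a b \<and> pconn f b a c" (is "?L2 \<longleftrightarrow> ?R2")
    and "conn f (u a) (psi b (u c)) \<longleftrightarrow>
      pconn f a a b \<and> pconn f b a c \<or> pconn f a a c \<and> pconn f c a b" (is "?L3 \<longleftrightarrow> ?R3")
proof -
  have ne: "a \<noteq> b" "b \<noteq> a" "a \<noteq> c" "c \<noteq> a" "b \<noteq> c" "c \<noteq> b" and mem: "a \<in> idx" "b \<in> idx" "c \<in> idx"
    using p by (auto simp: perm3_def)
  have mem_iff: "i \<in> idx \<longleftrightarrow> i = a \<or> i = b \<or> i = c" for i using p by (auto simp: perm3_def)
  have comm: "pconn f i b a = pconn f i a b" "pconn f i c a = pconn f i a c"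
    "pconn f i c b = pconn f i b c" for i by (simp_all add: conn_commute)
  note laws = pconn_laws[where i = a and f = f and a = a and b = b and c = c]
    pconn_laws[where i = b and f = f and a = a and b = b and c = c]
    pconn_laws[where i = c and f = f and a = a and b = b and c = c]
  \<comment> \<open>Proposed truth values for reaching, from \<open>u a\<close>, the three junctions
    and the corners \<open>u b\<close> and \<open>u c\<close>. \<open>\<Phi>\<close> arranges them
    as a symmetric relation on indices.\<close>
  define Rab where "Rab \<longleftrightarrow> pconn f a a b \<or> pconn f a a c \<and> pconn f c a b \<and> pconn f b a c"
  define Rac where "Rac \<longleftrightarrow> pconn f a a c \<or> pconn f a a b \<and> pconn f b a c \<and> pconn f c a b"
  define Rbc where "Rbc \<longleftrightarrow> pconn f a a b \<and> pconn f b a c \<or> pconn f a a c \<and> pconn f c a b"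
  define Rb where "Rb \<longleftrightarrow> pconn f a a b \<and> pconn f b a b \<or> pconn f a a c \<and> pconn f c a b \<and> pconn f b b c"
  define Rc where "Rc \<longleftrightarrow> pconn f a a c \<and> pconn f c a c \<or> pconn f a a b \<and> pconn f b a c \<and> pconn f c b c"
  note R_defs = Rab_def Rac_def Rbc_def Rb_def Rc_def
  define \<Phi> where "\<Phi> i j \<longleftrightarrow>
    (if i = a then if j = a then True else if j = b then Rab else Rac
     else if i = b then if j = a then Rab else if j = b then Rb else Rbc
     else if j = a then Rac else if j = b then Rbc else Rc)" for i j
  have sym: "\<Phi> i j \<Longrightarrow> \<Phi> j i" for i j
    by (simp add: \<Phi>_def split: if_splits)
  \<comment> \<open>The proposal is closed under connections inside a cell; only transitivity within
    each cell is needed for this.\<close>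
  have R_step:
    "pconn f a a b \<longrightarrow> Rab" "pconn f a a c \<longrightarrow> Rac"
    "Rab \<and> pconn f a a b \<longrightarrow> True" "Rab \<and> pconn f a b c \<longrightarrow> Rac" "Rac \<and> pconn f a b c \<longrightarrow> Rab"
    "Rab \<and> pconn f b a b \<longrightarrow> Rb" "Rb \<and> pconn f b a b \<longrightarrow> Rab"
    "Rab \<and> pconn f b a c \<longrightarrow> Rbc" "Rbc \<and> pconn f b a c \<longrightarrow> Rab"
    "Rb \<and> pconn f b b c \<longrightarrow> Rbc" "Rbc \<and> pconn f b b c \<longrightarrow> Rb"
    "Rac \<and> pconn f c a b \<longrightarrow> Rbc" "Rbc \<and> pconn f c a b \<longrightarrow> Rac"
    "Rac \<and> pconn f c a c \<longrightarrow> Rc" "Rc \<and> pconn f c a c \<longrightarrow> Rac"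
    "Rbc \<and> pconn f c b c \<longrightarrow> Rc" "Rc \<and> pconn f c b c \<longrightarrow> Rbc"
    unfolding R_defs using laws by argo+
  have step: "\<Phi> i k" if "i \<in> idx" "j \<in> idx" "k \<in> idx" "\<Phi> i j" "pconn f i j k" for i j k
  proof -
    have "i = a \<or> i = b \<or> i = c" "j = a \<or> j = b \<or> j = c" "k = a \<or> k = b \<or> k = c"
      using that mem_iff by auto
    then have "\<Phi> i j \<longrightarrow> pconn f i j k \<longrightarrow> \<Phi> i k"
      by (elim disjE; hypsubst; simp only: \<Phi>_def ne comm if_True if_False refl simp_thms;
          use R_step in argo)
    then show ?thesis using that(4,5) by blast
  qed
  have \<Phi>D: "\<Phi> i j" if "conn f (u a) (psi i (u j))" "i \<in> idx" "j \<in> idx" for i j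
    by (rule conn_junction[OF f sym step _ _ mem(1) mem(1) that(2,3)])
      (use that in \<open>simp_all add: \<Phi>_def\<close>)
  have l1: "?L1 \<longrightarrow> ?R1" and l2: "?L2 \<longrightarrow> ?R2" and l3: "?L3 \<longrightarrow> ?R3"
    using \<Phi>D[of b b] \<Phi>D[of a b] \<Phi>D[of b c] mem by (simp_all add: \<Phi>_def ne R_defs)
  have K: "conn f (psi i (u j)) (psi i (u k))" if "pconn f i j k" for i j k
    using that by (rule conn_part)
  define m1 m2 m3 where "m1 = psi a (u b)" and "m2 = psi a (u c)" and "m3 = psi b (u c)"
  have m: "psi a (u b) = m1" "psi b (u a) = m1" "psi a (u c) = m2" "psi c (u a) = m2"
    "psi b (u c) = m3" "psi c (u b) = m3"
    unfolding m1_def m2_def m3_def by (simp_all add: psi_u_commute)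
  have C: "pconn f a a b \<Longrightarrow> conn f (u a) m1" "pconn f a a c \<Longrightarrow> conn f (u a) m2"
     "pconn f b a b \<Longrightarrow> conn f m1 (u b)" "pconn f b b c \<Longrightarrow> conn f m3 (u b)"
     "pconn f b a c \<Longrightarrow> conn f m1 m3" "pconn f b a c \<Longrightarrow> conn f m3 m1" "pconn f c a b \<Longrightarrow> conn f m2 m3"
    using K[of a a b] K[of a a c] K[of b a b] K[of b c b] K[of b a c] K[of b c a] K[of c a b]
    by (simp_all add: m comm)
  have "?R1 \<longrightarrow> ?L1"
    using conn_trans[OF C(1) C(3)] conn_trans[OF C(2) conn_trans[OF C(7) C(4)]] by blast
  moreover have "?R2 \<longrightarrow> ?L2"
    unfolding m using C(1) conn_trans[OF C(2) conn_trans[OF C(7) C(6)]] by blast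
  moreover have "?R3 \<longrightarrow> ?L3"
    unfolding m using conn_trans[OF C(1) C(5)] conn_trans[OF C(2) C(7)] by blast
  ultimately
  show "?L1 \<longleftrightarrow> ?R1" "?L2 \<longleftrightarrow> ?R2" "?L3 \<longleftrightarrow> ?R3"
    using l1 l2 l3 by blast+
qed

lemma conn_empty [simp]: "conn {} x y \<longleftrightarrow> x = y"
  by (auto simp: conn_iff_rtrancl adj_def)

text \<open>Once cell \<open>a\<close> is emptied, its two junctions can only be joined around the
  other two cells. This is the detour that could close a cycle in
  \<open>acyclic_glueI\<close>.\<close>

lemma conn_mids_outside:
  assumes f: "f \<subseteq> EG (Suc n)" and p: "perm3 a b c" and emp: "part a f = {}"
    and con: "conn f (psi a (u b)) (psi a (u c))"
  shows "pconn f b a c \<and> pconn f c a b"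
proof -
  have ne: "a \<noteq> b" "b \<noteq> a" "a \<noteq> c" "c \<noteq> a" "b \<noteq> c" "c \<noteq> b" and mem: "a \<in> idx" "b \<in> idx" "c \<in> idx"
    using p by (auto simp: perm3_def)
  have mem_iff: "i \<in> idx \<longleftrightarrow> i = a \<or> i = b \<or> i = c" for i using p by (auto simp: perm3_def)
  have comm: "pconn f i b a = pconn f i a b" "pconn f i c a = pconn f i a c"
    "pconn f i c b = pconn f i b c" for i by (simp_all add: conn_commute)
  note laws = pconn_laws[where i = a and f = f and a = a and b = b and c = c]
    pconn_laws[where i = b and f = f and a = a and b = b and c = c]
    pconn_laws[where i = c and f = f and a = a and b = b and c = c]
  define Rac where "Rac \<longleftrightarrow> pconn f b a c \<and> pconn f c a b"
  define Rb where "Rb \<longleftrightarrow> pconn f b a b"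
  define Rc where "Rc \<longleftrightarrow> pconn f b a c \<and> pconn f c b c"
  note R_defs = Rac_def Rb_def Rc_def
  define \<Phi> where "\<Phi> i j \<longleftrightarrow>
    (if i = a then if j = a then False else if j = b then True else Rac
     else if i = b then if j = a then True else if j = b then Rb else pconn f b a c
     else if j = a then Rac else if j = b then pconn f b a c else Rc)" for i j
  have sym: "\<Phi> i j \<Longrightarrow> \<Phi> j i" for i j
    by (simp add: \<Phi>_def split: if_splits)
  have R_step:
    "pconn f b a b \<longrightarrow> Rb" "Rb \<and> pconn f b b c \<longrightarrow> pconn f b a c" "pconn f b a c \<and> pconn f b b c \<longrightarrow> Rb"
    "Rac \<and> pconn f c a b \<longrightarrow> pconn f b a c" "pconn f b a c \<and> pconn f c a b \<longrightarrow> Rac"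
    "Rac \<and> pconn f c a c \<longrightarrow> Rc" "Rc \<and> pconn f c a c \<longrightarrow> Rac"
    "pconn f b a c \<and> pconn f c b c \<longrightarrow> Rc" "Rc \<and> pconn f c b c \<longrightarrow> pconn f b a c"
    unfolding R_defs using laws by argo+
  have pa: "\<not> pconn f a a b" "\<not> pconn f a a c" "\<not> pconn f a b c"
    using ne mem by (simp_all add: emp u_eq_iff)
  have step: "\<Phi> i k" if "i \<in> idx" "j \<in> idx" "k \<in> idx" "\<Phi> i j" "pconn f i j k" for i j k
  proof -
    have "i = a \<or> i = b \<or> i = c" "j = a \<or> j = b \<or> j = c" "k = a \<or> k = b \<or> k = c"
      using that mem_iff by auto
    then have "\<Phi> i j \<longrightarrow> pconn f i j k \<longrightarrow> \<Phi> i k"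
      by (elim disjE; hypsubst; simp only: \<Phi>_def ne comm if_True if_False refl simp_thms;
          use R_step pa in argo)
    then show ?thesis using that(4,5) by blast
  qed
  have "\<Phi> a c"
    by (rule conn_junction[OF f sym step con _ mem(1) mem(2) mem(1) mem(3)])
      (simp_all add: \<Phi>_def ne)
  then show ?thesis by (simp add: \<Phi>_def ne R_defs)
qed

text \<open>The two graphs share at most the vertices \<open>p\<close> and \<open>q\<close>. An
  excursion into \<open>E2\<close> that does not return to its starting point enters at one of them
  and leaves at the other, and one such excursion suffices.\<close>

lemma conn_Un_two:
  assumes E1: "\<Union>E1 \<subseteq> V1" and E2: "\<Union>E2 \<subseteq> V2" and B: "V1 \<inter> V2 \<subseteq> {p, q}"
    and c: "conn (E1 \<union> E2) x y" and x: "x \<in> V1" and y: "y \<in> V1" and p: "p \<in> V1" and q: "q \<in> V1"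
  shows "conn E1 x y \<or> conn E2 p q \<and> (conn E1 x p \<and> conn E1 q y \<or> conn E1 x q \<and> conn E1 p y)"
proof -
  \<comment> \<open>\<open>A\<close> describes what is reachable on the side of \<open>E1\<close>,
    \<open>C\<close> on the side of \<open>E2\<close>; at \<open>p\<close> and \<open>q\<close> each
    implies the other, so their union is closed under edges.\<close>
  define A where "A v \<longleftrightarrow> conn E1 x v \<or> conn E2 p q \<and> (conn E1 x p \<and> conn E1 q v \<or> conn E1 x q \<and> conn E1 p v)" for v
  define C where "C v \<longleftrightarrow> conn E1 x p \<and> conn E2 p v \<or> conn E1 x q \<and> conn E2 q v" for v
  have A_step: "A w" if "A v" "{v, w} \<in> E1" for v w
    using that conn_trans[OF _ conn_edge[of v w E1]] unfolding A_def by blast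
  have C_step: "C w" if "C v" "{v, w} \<in> E2" for v w
    using that conn_trans[OF _ conn_edge[of v w E2]] unfolding C_def by blast
  have AC: "C p" if "A p" using that conn_sym[of E2 p q] conn_sym[of E1] conn_trans[of E1 x q p]
      conn_refl[of E2 p] unfolding A_def C_def by blast
  have AC': "C q" if "A q" using that conn_sym[of E2 p q] conn_sym[of E1] conn_trans[of E1 x p q]
      conn_refl[of E2 q] unfolding A_def C_def by blast
  have CA: "A p" if "C p" using that conn_sym[of E2 q p] conn_refl[of E1 p]
    unfolding A_def C_def by blast
  have CA': "A q" if "C q" using that conn_refl[of E1 q] unfolding A_def C_def by blast
  define S where "S = {v \<in> V1. A v} \<union> {v \<in> V2. C v}"
  have "y \<in> S"
  proof (rule conn_closed[OF c])
    show "x \<in> S" using x by (simp add: S_def A_def)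
  next
    fix v w assume v: "v \<in> S" and e: "{v, w} \<in> E1 \<union> E2"
    have "w \<in> V1 \<and> A w" if e1: "{v, w} \<in> E1"
    proof -
      have vw: "v \<in> V1" "w \<in> V1" using e1 E1 by blast+
      have "A v" using v vw B CA CA' unfolding S_def by blast
      then show ?thesis using A_step e1 vw by blast
    qed
    moreover have "w \<in> V2 \<and> C w" if e2: "{v, w} \<in> E2"
    proof -
      have vw: "v \<in> V2" "w \<in> V2" using e2 E2 by blast+
      have "C v" using v vw B AC AC' unfolding S_def by blast
      then show ?thesis using C_step e2 vw by blast
    qed
    ultimately show "w \<in> S" using e unfolding S_def by blast
  qed
  then have "A y" using B y CA CA' unfolding S_def by blast
  then show ?thesis by (simp add: A_def)
qed

lemma part_Diff:
  assumes "i \<in> idx" "j \<in> idx" "e \<in> EG n"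
  shows "part i (f - {psi j ` e}) = (if i = j then part i f - {e} else part i f)"
proof -
  have "e' \<subseteq> Tri \<Longrightarrow> psi i ` e' = psi j ` e \<longleftrightarrow> i = j \<and> e' = e" for e'
    using cell_disjoint[OF assms(1,2) _ assms(3), of e'] by blast
  then show ?thesis unfolding part_def by auto
qed

lemma part_Diff_cell:
  assumes "f \<subseteq> EG (Suc n)" "i \<in> idx" "j \<in> idx"
  shows "part i (f - cell j (part j f)) = (if i = j then {} else part i f)"
proof -
  have "psi i ` e' \<notin> cell j (part j f)" if "e' \<subseteq> Tri" "i \<noteq> j" for e'
    using cell_disjoint(1)[OF assms(2,3) that(1)] part_subset[OF assms(1,3)] that(2)
    unfolding cell_def by blast
  then have ne: "i \<noteq> j \<Longrightarrow> part i (f - cell j (part j f)) = part i f"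
    unfolding part_def[of i] by blast
  have "psi i ` e' \<in> cell i (part i f)" if "e' \<subseteq> Tri" "psi i ` e' \<in> f" for e'
    using that unfolding cell_def part_def by blast
  then have "part i (f - cell i (part i f)) = {}"
    unfolding part_def[of i "f - _"] by blast
  with ne show ?thesis by (cases "i = j") simp_all
qed

lemma acyclic_part:
  assumes "acyclic_graph f" shows "acyclic_graph (part i f)"
proof (rule acyclic_graphI)
  fix x y assume e: "{x, y} \<in> part i f" "x \<noteq> y"
  show "\<not> conn (part i f - {{x, y}}) x y"
  proof
    assume c: "conn (part i f - {{x, y}}) x y"
    have "part i f - {{x, y}} \<subseteq> part i (f - {psi i ` {x, y}})"
      unfolding part_def by (auto simp del: image_insert simp: psi_image_eq_iff)
    from conn_part[OF conn_mono[OF c this]]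
    have "conn (f - {{psi i x, psi i y}}) (psi i x) (psi i y)" by simp
    moreover have "{psi i x, psi i y} \<in> f" using e by (simp add: part_def)
    ultimately show False using acyclic_graph_bridge[OF assms] e by simp
  qed
qed

text \<open>Otherwise delete the first edge at \<open>u b\<close> of the path crossing cell
  \<open>a\<close>. Its other end still reaches \<open>u b\<close> by finishing that crossing and
  returning through the cells \<open>c\<close> and \<open>b\<close>, so the edge is no
  bridge.\<close>

lemma acyclic_no_cycle:
  assumes f: "f \<subseteq> EG (Suc n)" and p: "perm3 a b c" and ac: "acyclic_graph f"
  shows "\<not> (pconn f a b c \<and> pconn f b a c \<and> pconn f c a b)"
proof
  assume h: "pconn f a b c \<and> pconn f b a c \<and> pconn f c a b"
  have ne: "a \<noteq> b" "a \<noteq> c" "b \<noteq> c" and mem: "a \<in> idx" "b \<in> idx" "c \<in> idx"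
    using p by (auto simp: perm3_def)
  obtain xs where xs: "walk (part a f) xs" "distinct xs" "hd xs = u b" "last xs = u c"
    using h by (auto elim: conn_imp_distinct_walk)
  have "u b \<noteq> u c" using ne mem by (simp add: u_eq_iff)
  then obtain x ys where d: "xs = u b # x # ys"
    using xs by (cases xs; cases "tl xs") (auto simp: walk_def)
  define e where "e = {u b, x}"
  have e: "e \<in> part a f" "u b \<noteq> x" using xs d by (auto simp: walk_Cons_Cons e_def)
  have eE: "e \<in> EG n" using e part_subset[OF f mem(1)] by blast
  let ?f = "f - {psi a ` e}"
  have "walk (part a f - {{u b, x}}) (x # ys)"
    by (rule walk_minus_edge) (use xs d in \<open>simp_all add: walk_Cons_Cons\<close>)
  then have "conn (part a f - {e}) x (u c)"
    using walk_conn[of _ "x # ys" "u c"] xs(4) d last_in_set[of "x # ys"] unfolding e_def by simp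
  moreover have parts: "part a ?f = part a f - {e}" "part b ?f = part b f" "part c ?f = part c f"
    using part_Diff[OF mem(1) mem(1) eE] part_Diff[OF mem(2) mem(1) eE] part_Diff[OF mem(3) mem(1) eE] ne
    by simp_all
  ultimately have 1: "conn ?f (psi a x) (psi a (u c))" by (intro conn_part) simp
  have 2: "conn ?f (psi c (u a)) (psi c (u b))" by (intro conn_part) (simp add: h parts)
  have 3: "conn ?f (psi b (u c)) (psi b (u a))" by (intro conn_part) (simp add: h parts conn_commute)
  have "conn ?f (psi a x) (psi a (u b))"
    using conn_trans[OF 1 conn_trans[OF 2[unfolded psi_u_commute[of c]] 3[unfolded psi_u_commute[of b a]]]]
    by (simp add: psi_u_commute)
  moreover have "psi a ` e \<in> f" using e by (simp add: part_def)
  ultimately show False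
    using acyclic_graph_bridge[OF ac, of "psi a (u b)" "psi a x"] e conn_sym by (simp add: e_def)
qed

text \<open>A cycle stays in one cell or runs around all three. For an edge of cell
  \<open>a\<close>, \<open>conn_Un_two\<close> separates these cases: a detour inside the cell
  contradicts acyclicity of the part, and a detour through the other cells yields all three
  crossings that \<open>no\<close> excludes.\<close>

lemma acyclic_glueI:
  assumes f: "f \<subseteq> EG (Suc n)" and p: "perm3 a b c"
    and ac: "\<And>i. i \<in> idx \<Longrightarrow> acyclic_graph (part i f)"
    and no: "\<not> (pconn f a b c \<and> pconn f b a c \<and> pconn f c a b)"
  shows "acyclic_graph f"
proof (rule acyclic_graphI)
  have bridge: "\<not> conn (f - {{v, w}}) v w" if p: "perm3 a b c" and no: "\<not> (pconn f a b c \<and> pconn f b a c \<and> pconn f c a b)"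
    and e: "{x, y} \<in> part a f" "v = psi a x" "w = psi a y" "v \<noteq> w" for a b c v w x y
  proof
    assume con: "conn (f - {{v, w}}) v w"
    have ne: "a \<noteq> b" "a \<noteq> c" "b \<noteq> c" and mem: "a \<in> idx" "b \<in> idx" "c \<in> idx"
      using p by (auto simp: perm3_def)
    let ?E1 = "cell a (part a f - {{x, y}})" and ?E2 = "f - cell a (part a f)"
    let ?V1 = "psi a ` Tri" and ?V2 = "psi b ` Tri \<union> psi c ` Tri"
    have E2_sub: "?E2 \<subseteq> EG (Suc n)" using f by blast
    have parts: "part a ?E2 = {}" "part b ?E2 = part b f" "part c ?E2 = part c f"
      using part_Diff_cell[OF f _ mem(1)] mem ne by simp_all
    have xy: "{x, y} \<in> EG n" using e part_subset[OF f mem(1)] by blast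
    then have xyT: "x \<in> Tri" "y \<in> Tri" using EG_subset_Tri by blast+
    have "f - {{v, w}} \<subseteq> ?E1 \<union> ?E2"
    proof
      fix e' assume "e' \<in> f - {{v, w}}"
      then have "e' \<in> ?E1" if "e' \<in> cell a (part a f)"
        using that e(2,3) unfolding cell_def by auto
      then show "e' \<in> ?E1 \<union> ?E2" using \<open>e' \<in> f - {{v, w}}\<close> by blast
    qed
    then have con': "conn (?E1 \<union> ?E2) (psi a x) (psi a y)"
      using conn_mono[OF con] e by simp
    have 1: "\<Union>?E1 \<subseteq> ?V1" unfolding cell_def part_def by auto
    have "?E2 = (\<Union>i\<in>idx. cell i (part i ?E2))" by (rule cell_part_Un[OF E2_sub])
    also have "\<dots> = cell b (part b f) \<union> cell c (part c f)"
      unfolding conjunct1[OF p[unfolded perm3_def]] UN_insert parts by (simp add: cell_def)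
    finally have E2: "?E2 = cell b (part b f) \<union> cell c (part c f)" .
    have 2: "\<Union>?E2 \<subseteq> ?V2" unfolding E2 unfolding cell_def part_def by auto
    have "psi a s \<in> {psi a (u b), psi a (u c)}"
      if s: "s \<in> Tri" and s': "psi a s \<in> ?V2" for s
      using s'
    proof
      assume "psi a s \<in> psi b ` Tri"
      then obtain t where "t \<in> Tri" "psi a s = psi b t" by blast
      then show ?thesis using psi_eq_psi(1)[OF mem(1,2) ne(1) s] by simp
    next
      assume "psi a s \<in> psi c ` Tri"
      then obtain t where "t \<in> Tri" "psi a s = psi c t" by blast
      then show ?thesis using psi_eq_psi(1)[OF mem(1,3) ne(2) s] by simp
    qed
    then have 3: "?V1 \<inter> ?V2 \<subseteq> {psi a (u b), psi a (u c)}" by blast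
    let ?g = "part a f - {{x, y}}"
    have "conn ?g x y \<or> conn ?E2 (psi a (u b)) (psi a (u c)) \<and>
        (conn ?g x (u b) \<and> conn ?g (u c) y \<or> conn ?g x (u c) \<and> conn ?g (u b) y)"
      using conn_Un_two[OF 1 2 3 con'] xyT u_in_Tri mem by (simp add: conn_cell)
    moreover have "\<not> conn ?g x y"
      using acyclic_graph_bridge[OF ac[OF mem(1)] e(1)] e by auto
    ultimately have c2: "conn ?E2 (psi a (u b)) (psi a (u c))"
      and c1: "conn ?g x (u b) \<and> conn ?g (u c) y \<or> conn ?g x (u c) \<and> conn ?g (u b) y" by blast+
    have Q: "pconn f b a c \<and> pconn f c a b"
      using conn_mids_outside[OF E2_sub p parts(1) c2] parts by simp
    have up: "conn ?g s t \<Longrightarrow> conn (part a f) s t" for s t by (erule conn_mono) blast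
    have xy': "conn (part a f) x y" "conn (part a f) y x" using conn_edge[OF e(1)] conn_sym by blast+
    have "pconn f a b c"
      using c1
    proof
      assume "conn ?g x (u b) \<and> conn ?g (u c) y"
      then show ?thesis using up conn_sym conn_trans[OF _ conn_trans[OF xy'(1)]] by metis
    next
      assume "conn ?g x (u c) \<and> conn ?g (u b) y"
      then show ?thesis using up conn_sym conn_trans[OF _ conn_trans[OF xy'(2)]] by metis
    qed
    then show False using no Q by blast
  qed
  fix v w assume e: "{v, w} \<in> f" "v \<noteq> w"
  obtain i x y where i: "i \<in> idx" "{x, y} \<in> part i f" "v = psi i x" "w = psi i y"
    by (rule edge_of_part[OF f e(1)])
  have comm: "pconn f i b a = pconn f i a b" "pconn f i c a = pconn f i a c"
    "pconn f i c b = pconn f i b c" for i by (simp_all add: conn_commute)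
  consider "i = a" | "i = b" | "i = c" using i(1) p by (auto simp: perm3_def)
  then show "\<not> conn (f - {{v, w}}) v w"
  proof cases
    case 1
    show ?thesis by (rule bridge[OF p no]) (use i e 1 in auto)
  next
    case 2
    have "perm3 b a c" using p by (auto simp: perm3_def)
    then show ?thesis by (rule bridge) (use i e 2 no comm in auto)
  next
    case 3
    have "perm3 c a b" using p by (auto simp: perm3_def)
    then show ?thesis by (rule bridge) (use i e 3 no comm in auto)
  qed
qed

subsection \<open>Forests rooted at the corners\<close>

text \<open>Every component contains a corner. Trees and forests of two or three components are then
  told apart by which corners are connected, without counting components.\<close>

definition forests :: "nat \<Rightarrow> graph_edges set" where
  "forests n = {f. f \<subseteq> EG n \<and> acyclic_graph f \<and> (\<forall>x\<in>VG n. \<exists>i\<in>idx. conn f x (u i))}"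

definition two_forests :: "nat \<Rightarrow> nat \<Rightarrow> graph_edges set" where
  "two_forests n c = {f \<in> forests n. (\<forall>i\<in>idx - {c}. \<not> conn f (u i) (u c)) \<and>
     (\<forall>i\<in>idx - {c}. \<forall>j\<in>idx - {c}. conn f (u i) (u j))}"

definition three_forests :: "nat \<Rightarrow> graph_edges set" where
  "three_forests n = {f \<in> forests n. \<forall>i\<in>idx. \<forall>j\<in>idx. i \<noteq> j \<longrightarrow> \<not> conn f (u i) (u j)}"

context
  fixes a b c :: nat
  assumes p: "perm3 a b c"
begin

lemma corners_comm:
  "conn f (u b) (u a) = conn f (u a) (u b)" "conn f (u c) (u a) = conn f (u a) (u c)"
  "conn f (u c) (u b) = conn f (u b) (u c)"
  by (simp_all add: conn_commute)

lemma Ball_idx: "(\<forall>i\<in>idx. P i) \<longleftrightarrow> P a \<and> P b \<and> P c"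
  using p by (auto simp: perm3_def)

lemma Bex_idx: "(\<exists>i\<in>idx. P i) \<longleftrightarrow> P a \<or> P b \<or> P c"
  using p by (auto simp: perm3_def)

lemma idx_ne: "a \<noteq> b" "b \<noteq> a" "a \<noteq> c" "c \<noteq> a" "b \<noteq> c" "c \<noteq> b"
  using p by (auto simp: perm3_def)

lemma idx_Diff: "idx - {a} = {b, c}" "idx - {b} = {a, c}" "idx - {c} = {a, b}"
  using p by (auto simp: perm3_def)

lemma two_forests_iff:
  "f \<in> two_forests n a \<longleftrightarrow>
    f \<in> forests n \<and> \<not> conn f (u a) (u b) \<and> \<not> conn f (u a) (u c) \<and> conn f (u b) (u c)"
  "f \<in> two_forests n b \<longleftrightarrow>
    f \<in> forests n \<and> \<not> conn f (u a) (u b) \<and> conn f (u a) (u c) \<and> \<not> conn f (u b) (u c)"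
  "f \<in> two_forests n c \<longleftrightarrow>
    f \<in> forests n \<and> conn f (u a) (u b) \<and> \<not> conn f (u a) (u c) \<and> \<not> conn f (u b) (u c)"
  unfolding two_forests_def idx_Diff by (auto simp: corners_comm)

lemma three_forests_iff:
  "f \<in> three_forests n \<longleftrightarrow>
    f \<in> forests n \<and> \<not> conn f (u a) (u b) \<and> \<not> conn f (u a) (u c) \<and> \<not> conn f (u b) (u c)"
  unfolding three_forests_def Ball_idx using idx_ne by (auto simp: corners_comm)

lemma Trees_iff_all: "f \<in> Trees n \<longleftrightarrow> f \<in> forests n \<and> (\<forall>i\<in>idx. \<forall>j\<in>idx. conn f (u i) (u j))"
proof
  assume "f \<in> Trees n"
  moreover have "1 \<in> idx" by (simp add: idx_def)
  ultimately show "f \<in> forests n \<and> (\<forall>i\<in>idx. \<forall>j\<in>idx. conn f (u i) (u j))"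
    unfolding Trees_def forests_def connected_graph_def using u_in_VG by blast
next
  assume f: "f \<in> forests n \<and> (\<forall>i\<in>idx. \<forall>j\<in>idx. conn f (u i) (u j))"
  have "conn f x y" if xy: "x \<in> VG n" "y \<in> VG n" for x y
  proof -
    obtain i j where "i \<in> idx" "conn f x (u i)" "j \<in> idx" "conn f y (u j)"
      using f xy unfolding forests_def by blast
    then show ?thesis using f conn_trans[of f x "u i"] conn_trans[of f "u i" "u j" y] conn_sym by blast
  qed
  then show "f \<in> Trees n" using f unfolding Trees_def forests_def connected_graph_def by blast
qed

lemma Trees_iff:
  "f \<in> Trees n \<longleftrightarrow>
    f \<in> forests n \<and> conn f (u a) (u b) \<and> conn f (u a) (u c) \<and> conn f (u b) (u c)"
  unfolding Trees_iff_all Ball_idx by (auto simp: corners_comm)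

lemma junctions_comm: "psi b (u a) = psi a (u b)" "psi c (u a) = psi a (u c)" "psi c (u b) = psi b (u c)"
  by (simp_all add: psi_u_commute)

lemma corner_conns:
  assumes f: "f \<subseteq> EG (Suc n)"
  shows "conn f (u a) (u b) \<longleftrightarrow>
      pconn f a a b \<and> pconn f b a b \<or> pconn f a a c \<and> pconn f c a b \<and> pconn f b b c"
    "conn f (u a) (u c) \<longleftrightarrow>
      pconn f a a c \<and> pconn f c a c \<or> pconn f a a b \<and> pconn f b a c \<and> pconn f c b c"
    "conn f (u b) (u c) \<longleftrightarrow>
      pconn f b b c \<and> pconn f c b c \<or> pconn f b a b \<and> pconn f a b c \<and> pconn f c a c"
  using conn_from_corner(1)[OF f p] conn_from_corner(1)[OF f perm3_swap(2)[OF p]]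
    conn_from_corner(1)[OF f perm3_swap(2)[OF perm3_swap(1)[OF p]]]
  by (simp_all only: corners_comm)

lemma junction_rooted:
  assumes f: "f \<subseteq> EG (Suc n)"
  shows "(\<exists>i\<in>idx. conn f (psi a (u b)) (u i)) \<longleftrightarrow>
    pconn f a a b \<or> pconn f a a c \<and> pconn f c a b \<and> pconn f b a c \<or>
    pconn f b a b \<or> pconn f b b c \<and> pconn f c a b \<and> pconn f a b c \<or>
    pconn f c a c \<and> pconn f a b c \<or> pconn f c b c \<and> pconn f b a c"
proof -
  have q: "perm3 b a c" "perm3 c a b" using p by (auto simp: perm3_def)
  show ?thesis
    unfolding Bex_idx conn_commute[of f "psi a (u b)"]
    using conn_from_corner(2)[OF f p] conn_from_corner(2)[OF f q(1)] conn_from_corner(3)[OF f q(2)]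
    by (simp only: corners_comm junctions_comm) blast
qed

end

text \<open>A component of the part that misses all corners of its cell could not leave the cell,
  since exits lie at these corners. It would be a component of \<open>f\<close> without a
  corner.\<close>

lemma part_in_forests:
  assumes f: "f \<in> forests (Suc n)" and i: "i \<in> idx"
  shows "part i f \<in> forests n"
proof -
  have sub: "f \<subseteq> EG (Suc n)" using f by (simp add: forests_def)
  have "\<exists>j\<in>idx. conn (part i f) x (u j)" if x: "x \<in> VG n" for x
  proof (rule ccontr)
    assume no: "\<not> (\<exists>j\<in>idx. conn (part i f) x (u j))"
    have "psi i x \<in> VG (Suc n)" using x i by auto
    then obtain k where k: "k \<in> idx" "conn f (psi i x) (u k)" using f unfolding forests_def by blast
    define S where "S = {psi i v | v. v \<in> VG n \<and> conn (part i f) x v}"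
    have "u k \<in> S"
    proof (rule conn_closed[OF k(2)])
      show "psi i x \<in> S" using x unfolding S_def by auto
    next
      fix v w assume v: "v \<in> S" and e: "{v, w} \<in> f"
      obtain v' where v': "v = psi i v'" "v' \<in> VG n" "conn (part i f) x v'" using v unfolding S_def by blast
      obtain m s t where m: "m \<in> idx" "{s, t} \<in> part m f" "v = psi m s" "w = psi m t" "s \<in> VG n" "t \<in> VG n"
        by (rule edge_of_part[OF sub e])
      have "m = i"
      proof (rule ccontr)
        assume "m \<noteq> i"
        then have "v' = u m" using psi_eq_psi(1)[OF i m(1), of v' s] v' m VG_subset_Tri[of n] by auto
        then show False using no v' m by blast
      qed
      then show "w \<in> S" using m v' conn_trans[OF v'(3) conn_edge] unfolding S_def by auto
    qed
    then obtain v where v: "v \<in> VG n" "psi i v = psi k (u k)" "conn (part i f) x v"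
      unfolding S_def by auto
    have "v = u k"
    proof (cases "i = k")
      case True
      then have "psi i v = psi i (u k)" using v(2) by simp
      then show ?thesis by (simp only: psi_eq_iff)
    next
      case False
      then show ?thesis using psi_eq_psi(1)[OF i k(1) _ _ u_in_Tri[OF k(1)] v(2)] v(1) VG_subset_Tri by blast
    qed
    then show False using no v k by blast
  qed
  then show ?thesis
    using part_subset[OF sub i] acyclic_part[of f] f unfolding forests_def by blast
qed

text \<open>Every vertex is joined inside its cell to a corner of that cell, which is a corner of
  the whole triangle or one of the three junctions. Hence only the junctions have to be checked for
  being rooted, and only the ring of three cells for a cycle.\<close>

lemma forests_Suc_iff:
  assumes f: "f \<subseteq> EG (Suc n)" and p: "perm3 a b c"
  shows "f \<in> forests (Suc n) \<longleftrightarrow>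
    part a f \<in> forests n \<and> part b f \<in> forests n \<and> part c f \<in> forests n \<and>
    \<not> (pconn f a b c \<and> pconn f b a c \<and> pconn f c a b) \<and>
    (\<exists>i\<in>idx. conn f (psi a (u b)) (u i)) \<and> (\<exists>i\<in>idx. conn f (psi a (u c)) (u i)) \<and>
    (\<exists>i\<in>idx. conn f (psi b (u c)) (u i))" (is "?L \<longleftrightarrow> ?R")
proof
  have mem: "a \<in> idx" "b \<in> idx" "c \<in> idx" using p by (auto simp: perm3_def)
  assume L: "?L"
  have "psi i (u j) \<in> VG (Suc n)" if "i \<in> idx" "j \<in> idx" for i j
    using that u_in_VG by auto
  then have "\<exists>i\<in>idx. conn f (psi a (u b)) (u i)" "\<exists>i\<in>idx. conn f (psi a (u c)) (u i)"
    "\<exists>i\<in>idx. conn f (psi b (u c)) (u i)"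
    using L mem unfolding forests_def by blast+
  then show ?R using part_in_forests[OF L] mem acyclic_no_cycle[OF f p] L
    unfolding forests_def by blast
next
  assume R: "?R"
  have all: "part i f \<in> forests n" if "i \<in> idx" for i using R that p by (auto simp: perm3_def)
  have "acyclic_graph f"
    by (rule acyclic_glueI[OF f p]) (use all R in \<open>auto simp: forests_def\<close>)
  moreover have "\<exists>k\<in>idx. conn f x (u k)" if x: "x \<in> VG (Suc n)" for x
  proof -
    obtain i y where i: "i \<in> idx" "y \<in> VG n" "x = psi i y"
      using x by (auto simp del: split_paired_All)
    then obtain j where j: "j \<in> idx" "conn (part i f) y (u j)" using all unfolding forests_def by blast
    then have 1: "conn f x (psi i (u j))" using i conn_part by blast
    have com: "psi b (u a) = psi a (u b)" "psi c (u a) = psi a (u c)" "psi c (u b) = psi b (u c)"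
      by (simp_all add: psi_u_commute)
    have "\<exists>k\<in>idx. conn f (u i) (u k)" "\<exists>k\<in>idx. conn f (u j) (u k)" using i j conn_refl by blast+
    moreover have "(i = a \<or> i = b \<or> i = c) \<and> (j = a \<or> j = b \<or> j = c)"
      using i j p by (auto simp: perm3_def)
    ultimately have "\<exists>k\<in>idx. conn f (psi i (u j)) (u k)"
      using R by (elim conjE disjE) (simp_all only: com psi_u_same)
    then show ?thesis using 1 conn_trans by blast
  qed
  ultimately show ?L using f unfolding forests_def by blast
qed

declare EG.simps(2) [simp del]

section \<open>Product structure and recursion for the classes of forests\<close>

definition box :: "nat \<Rightarrow> nat \<times> graph_edges set \<Rightarrow> nat \<times> graph_edges set \<Rightarrow> nat \<times> graph_edges set \<Rightarrow> graph_edges set" where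
  "box n p q r = {f. f \<subseteq> EG (Suc n) \<and> part (fst p) f \<in> snd p \<and> part (fst q) f \<in> snd q \<and> part (fst r) f \<in> snd r}"

lemma finite_box: "finite (box n p q r)"
  by (rule finite_subset[of _ "Pow (EG (Suc n))"]) (auto simp: box_def finite_EG)

text \<open>This is the independence of the three restrictions in counting form: prescribing a class
  in each cell leaves a full product of classes.\<close>

lemma sum_box:
  fixes g1 g2 g3 :: "graph_edges \<Rightarrow> real"
  assumes p: "perm3 a b c" and X: "X \<subseteq> Pow (EG n)" and Y: "Y \<subseteq> Pow (EG n)" and Z: "Z \<subseteq> Pow (EG n)"
  shows "(\<Sum>f\<in>box n (a, X) (b, Y) (c, Z). g1 (part a f) * g2 (part b f) * g3 (part c f)) =
    sum g1 X * sum g2 Y * sum g3 Z"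
proof -
  have ne: "a \<noteq> b" "b \<noteq> a" "a \<noteq> c" "c \<noteq> a" "b \<noteq> c" "c \<noteq> b" and mem: "a \<in> idx" "b \<in> idx" "c \<in> idx"
    and idx: "idx = {a, b, c}" using p by (auto simp: perm3_def)
  define gl where "gl = (\<lambda>(x, y, z). cell a x \<union> cell b y \<union> cell c z)"
  have gl: "part a (gl (x, y, z)) = x \<and> part b (gl (x, y, z)) = y \<and> part c (gl (x, y, z)) = z \<and>
     gl (x, y, z) \<subseteq> EG (Suc n)"
    if xyz: "x \<subseteq> EG n" "y \<subseteq> EG n" "z \<subseteq> EG n" for x y z
  proof -
    define g where "g i = (if i = a then x else if i = b then y else z)" for i
    have "gl (x, y, z) = (\<Union>i\<in>{a, b, c}. cell i (g i))"
      by (simp add: gl_def g_def ne Un_assoc)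
    then have e: "gl (x, y, z) = (\<Union>i\<in>idx. cell i (g i))" by (simp only: idx)
    have sub: "g i \<subseteq> EG n" if "i \<in> idx" for i using xyz by (simp add: g_def)
    have "(\<Union>i\<in>idx. cell i (g i)) \<subseteq> EG (Suc n)"
      unfolding EG_Suc_cell cell_def using sub by blast
    then show ?thesis unfolding e
      using part_cell_Un[OF sub mem(1)] part_cell_Un[OF sub mem(2)] part_cell_Un[OF sub mem(3)]
      by (simp add: g_def ne)
  qed
  have "(\<Sum>f\<in>box n (a, X) (b, Y) (c, Z). g1 (part a f) * g2 (part b f) * g3 (part c f)) =
    (\<Sum>w\<in>X \<times> Y \<times> Z. g1 (fst w) * g2 (fst (snd w)) * g3 (snd (snd w)))"
  proof (rule sum.reindex_bij_witness[where i = gl and j = "\<lambda>f. (part a f, part b f, part c f)"])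
    fix f assume "f \<in> box n (a, X) (b, Y) (c, Z)"
    then have f: "f \<subseteq> EG (Suc n)" "part a f \<in> X" "part b f \<in> Y" "part c f \<in> Z"
      by (auto simp: box_def)
    have "f = (\<Union>i\<in>{a, b, c}. cell i (part i f))" using cell_part_Un[OF f(1)] by (simp only: idx)
    then show "gl (part a f, part b f, part c f) = f" by (simp add: gl_def Un_assoc)
    show "(part a f, part b f, part c f) \<in> X \<times> Y \<times> Z" using f by simp
  next
    fix w assume w: "w \<in> X \<times> Y \<times> Z"
    obtain x y z where xyz: "w = (x, y, z)" by (cases w)
    have "x \<subseteq> EG n" "y \<subseteq> EG n" "z \<subseteq> EG n" using w X Y Z unfolding xyz by blast+
    note gl[OF this]
    then show "(part a (gl w), part b (gl w), part c (gl w)) = w" "gl w \<in> box n (a, X) (b, Y) (c, Z)"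
      using w unfolding xyz box_def by simp_all
  qed simp
  also have "\<dots> = sum g1 X * sum g2 Y * sum g3 Z"
    by (simp add: sum.cartesian_product' mult.assoc)
      (simp only: sum_distrib_left[symmetric] sum_distrib_right[symmetric])
  finally show ?thesis .
qed

lemma forests_subset: "Trees n \<subseteq> Pow (EG n)" "two_forests n c \<subseteq> Pow (EG n)" "three_forests n \<subseteq> Pow (EG n)"
  by (auto simp: Trees_def two_forests_def three_forests_def forests_def)

lemma finite_Trees: "finite (Trees n)"
  by (rule finite_subset[OF forests_subset(1)]) (simp add: finite_EG)

lemma box_disjoint:
  assumes "X \<inter> X' = {} \<or> Y \<inter> Y' = {} \<or> Z \<inter> Z' = {}"
  shows "box n (a, X) (b, Y) (c, Z) \<inter> box n (a, X') (b, Y') (c, Z') = {}"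
  using assms by (auto simp: box_def)

context
  fixes a b c :: nat
  assumes p: "perm3 a b c"
begin

lemma classes_disjoint:
  "Trees n \<inter> two_forests n a = {}" "Trees n \<inter> two_forests n b = {}" "Trees n \<inter> two_forests n c = {}"
  "Trees n \<inter> three_forests n = {}"
  "two_forests n a \<inter> two_forests n b = {}" "two_forests n a \<inter> two_forests n c = {}"
  "two_forests n b \<inter> two_forests n c = {}"
  using Trees_iff[OF p] two_forests_iff[OF p] three_forests_iff[OF p] by blast+

lemma rooted_iffs:
  assumes f: "f \<subseteq> EG (Suc n)"
  shows "(\<exists>i\<in>idx. conn f (psi a (u b)) (u i)) \<longleftrightarrow>
    pconn f a a b \<or> pconn f a a c \<and> pconn f c a b \<and> pconn f b a c \<or>
    pconn f b a b \<or> pconn f b b c \<and> pconn f c a b \<and> pconn f a b c \<or>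
    pconn f c a c \<and> pconn f a b c \<or> pconn f c b c \<and> pconn f b a c" (is ?A)
    and "(\<exists>i\<in>idx. conn f (psi a (u c)) (u i)) \<longleftrightarrow>
    pconn f a a c \<or> pconn f a a b \<and> pconn f b a c \<and> pconn f c a b \<or>
    pconn f c a c \<or> pconn f c b c \<and> pconn f b a c \<and> pconn f a b c \<or>
    pconn f b a b \<and> pconn f a b c \<or> pconn f b b c \<and> pconn f c a b" (is ?B)
    and "(\<exists>i\<in>idx. conn f (psi b (u c)) (u i)) \<longleftrightarrow>
    pconn f b b c \<or> pconn f b a b \<and> pconn f a b c \<and> pconn f c a b \<or>
    pconn f c b c \<or> pconn f c a c \<and> pconn f a b c \<and> pconn f b a c \<or>
    pconn f a a b \<and> pconn f b a c \<or> pconn f a a c \<and> pconn f c a b" (is ?C)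
proof -
  have q: "perm3 a c b" "perm3 b c a" using p by (auto simp: perm3_def)
  show "?A" "?B" "?C"
    by (simp_all only: junction_rooted[OF p f] junction_rooted[OF q(1) f] junction_rooted[OF q(2) f]
        corners_comm[OF p])
qed

text \<open>The unique cell that is not a tree breaks the cycle by isolating one of its two
  junctions; isolating its outer corner would leave the ring closed. Three cells with two junctions
  each give six boxes, all of the same size. The case list is propositional in the nine
  \<open>pconn\<close> values.\<close>

lemma Trees_Suc:
  "Trees (Suc n) =
     box n (a, Trees n) (b, Trees n) (c, two_forests n a) \<union>
     (box n (a, Trees n) (b, Trees n) (c, two_forests n b) \<union>
     (box n (a, two_forests n c) (b, Trees n) (c, Trees n) \<union>
     (box n (a, Trees n) (b, two_forests n c) (c, Trees n) \<union>
     (box n (a, two_forests n b) (b, Trees n) (c, Trees n) \<union>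
      box n (a, Trees n) (b, two_forests n a) (c, Trees n)))))" (is "_ = ?B")
proof -
  have "f \<in> Trees (Suc n) \<longleftrightarrow> f \<in> ?B" if f: "f \<subseteq> EG (Suc n)" for f
    unfolding Trees_iff[OF p] forests_Suc_iff[OF f p] corner_conns[OF p f] rooted_iffs[OF f]
      Un_iff box_def mem_Collect_eq fst_conv snd_conv two_forests_iff[OF p]
    using f pconn_laws[where i = a and f = f and a = a and b = b and c = c] pconn_laws[where i = b and f = f and a = a and b = b and c = c] pconn_laws[where i = c and f = f and a = a and b = b and c = c] by argo
  moreover have "Trees (Suc n) \<subseteq> Pow (EG (Suc n))" by (rule forests_subset)
  moreover have "?B \<subseteq> Pow (EG (Suc n))" by (auto simp: box_def)
  ultimately show ?thesis by blast
qed

text \<open>Either cell \<open>c\<close> carries three components between two trees, or two of the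
  cells carry two components: one box of the first kind and seven of the second.\<close>

lemma two_forests_Suc:
  "two_forests (Suc n) c =
     box n (a, Trees n) (b, Trees n) (c, three_forests n) \<union>
     (box n (a, two_forests n c) (b, two_forests n c) (c, Trees n) \<union>
     (box n (a, Trees n) (b, two_forests n c) (c, two_forests n c) \<union>
     (box n (a, two_forests n c) (b, Trees n) (c, two_forests n c) \<union>
     (box n (a, Trees n) (b, two_forests n c) (c, two_forests n a) \<union>
     (box n (a, two_forests n c) (b, Trees n) (c, two_forests n b) \<union>
     (box n (a, Trees n) (b, two_forests n a) (c, two_forests n c) \<union>
      box n (a, two_forests n b) (b, Trees n) (c, two_forests n c)))))))" (is "_ = ?B")
proof -
  have "f \<in> two_forests (Suc n) c \<longleftrightarrow> f \<in> ?B" if f: "f \<subseteq> EG (Suc n)" for f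
    unfolding Trees_iff[OF p] forests_Suc_iff[OF f p] corner_conns[OF p f] rooted_iffs[OF f]
      Un_iff box_def mem_Collect_eq fst_conv snd_conv two_forests_iff[OF p] three_forests_iff[OF p]
    using f pconn_laws[where i = a and f = f and a = a and b = b and c = c] pconn_laws[where i = b and f = f and a = a and b = b and c = c] pconn_laws[where i = c and f = f and a = a and b = b and c = c] by argo
  moreover have "two_forests (Suc n) c \<subseteq> Pow (EG (Suc n))" by (rule forests_subset)
  moreover have "?B \<subseteq> Pow (EG (Suc n))" by (auto simp: box_def)
  ultimately show ?thesis by blast
qed

lemma sum_Trees_Suc:
  fixes G :: "graph_edges \<Rightarrow> real"
  shows "sum G (Trees (Suc n)) =
     sum G (box n (a, Trees n) (b, Trees n) (c, two_forests n a)) +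
     (sum G (box n (a, Trees n) (b, Trees n) (c, two_forests n b)) +
     (sum G (box n (a, two_forests n c) (b, Trees n) (c, Trees n)) +
     (sum G (box n (a, Trees n) (b, two_forests n c) (c, Trees n)) +
     (sum G (box n (a, two_forests n b) (b, Trees n) (c, Trees n)) +
      sum G (box n (a, Trees n) (b, two_forests n a) (c, Trees n))))))"
proof -
  have d: "X \<inter> Y = {} \<Longrightarrow> Y \<inter> X = {}" for X Y :: "graph_edges set" by blast
  note cd = classes_disjoint classes_disjoint[THEN d]
  show ?thesis
    unfolding Trees_Suc
    by (simp add: sum.union_disjoint finite_box Int_Un_distrib box_disjoint cd)
qed

lemma sum_two_forests_Suc:
  fixes G :: "graph_edges \<Rightarrow> real"
  shows "sum G (two_forests (Suc n) c) =
     sum G (box n (a, Trees n) (b, Trees n) (c, three_forests n)) +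
     (sum G (box n (a, two_forests n c) (b, two_forests n c) (c, Trees n)) +
     (sum G (box n (a, Trees n) (b, two_forests n c) (c, two_forests n c)) +
     (sum G (box n (a, two_forests n c) (b, Trees n) (c, two_forests n c)) +
     (sum G (box n (a, Trees n) (b, two_forests n c) (c, two_forests n a)) +
     (sum G (box n (a, two_forests n c) (b, Trees n) (c, two_forests n b)) +
     (sum G (box n (a, Trees n) (b, two_forests n a) (c, two_forests n c)) +
      sum G (box n (a, two_forests n b) (b, Trees n) (c, two_forests n c))))))))"
proof -
  have d: "X \<inter> Y = {} \<Longrightarrow> Y \<inter> X = {}" for X Y :: "graph_edges set" by blast
  note cd = classes_disjoint classes_disjoint[THEN d]
  show ?thesis
    unfolding two_forests_Suc
    by (simp add: sum.union_disjoint finite_box Int_Un_distrib box_disjoint cd)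
qed

lemma card_box:
  assumes "X \<subseteq> Pow (EG n)" "Y \<subseteq> Pow (EG n)" "Z \<subseteq> Pow (EG n)"
  shows "real (card (box n (a, X) (b, Y) (c, Z))) = real (card X) * real (card Y) * real (card Z)"
  using sum_box[OF p assms, of "\<lambda>_. 1" "\<lambda>_. 1" "\<lambda>_. 1"] by simp

end

section \<open>Types of forests and the count of three-component forests\<close>

text \<open>The type of a rooted forest: \<open>0\<close> for a tree, \<open>c \<in> {1, 2, 3}\<close> for a two-component forest
  isolating \<open>u c\<close>, and \<open>4\<close> for three components.\<close>
definition ftype :: "nat \<Rightarrow> nat \<Rightarrow> graph_edges set" where
  "ftype n k = (if k = 0 then Trees n else if k = 4 then three_forests n else two_forests n k)"

definition ftypes :: "nat set" where
  "ftypes = {0, 1, 2, 3, 4}"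

text \<open>For \<open>i\<close> different from \<open>j\<close>, whether forests of type
  \<open>k\<close> join the corners \<open>u i\<close> and \<open>u j\<close>. This turns the gluing
  conditions into a finite computation with types.\<close>

definition tconn :: "nat \<Rightarrow> nat \<Rightarrow> nat \<Rightarrow> bool" where
  "tconn k i j \<longleftrightarrow> k = 0 \<or> k \<noteq> 4 \<and> k \<noteq> i \<and> k \<noteq> j"

lemma perm123: "perm3 1 2 3"
  by (auto simp: perm3_def idx_def)

lemma ftype_conn:
  assumes "f \<in> ftype n k" "k \<in> ftypes"
  shows "f \<in> forests n" "conn f (u 1) (u 2) \<longleftrightarrow> tconn k 1 2" "conn f (u 1) (u 3) \<longleftrightarrow> tconn k 1 3"
    "conn f (u 2) (u 3) \<longleftrightarrow> tconn k 2 3"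
proof -
  have k: "k = 0 \<or> k = 1 \<or> k = 2 \<or> k = 3 \<or> k = 4" using assms(2) by (simp add: ftypes_def)
  show "f \<in> forests n" "conn f (u 1) (u 2) \<longleftrightarrow> tconn k 1 2" "conn f (u 1) (u 3) \<longleftrightarrow> tconn k 1 3"
    "conn f (u 2) (u 3) \<longleftrightarrow> tconn k 2 3"
    using k assms(1)
    by (elim disjE; simp add: ftype_def tconn_def Trees_iff[OF perm123] two_forests_iff[OF perm123]
        three_forests_iff[OF perm123] del: One_nat_def)+
qed

lemma ftype_cover:
  assumes "f \<in> forests n"
  shows "\<exists>k\<in>ftypes. f \<in> ftype n k"
proof -
  have "conn f (u 1) (u 2) \<and> conn f (u 2) (u 3) \<longrightarrow> conn f (u 1) (u 3)"
    "conn f (u 1) (u 2) \<and> conn f (u 1) (u 3) \<longrightarrow> conn f (u 2) (u 3)"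
    "conn f (u 1) (u 3) \<and> conn f (u 2) (u 3) \<longrightarrow> conn f (u 1) (u 2)"
    using conn_trans conn_sym by blast+
  then have "f \<in> Trees n \<or> f \<in> two_forests n 1 \<or> f \<in> two_forests n 2 \<or> f \<in> two_forests n 3 \<or> f \<in> three_forests n"
    unfolding Trees_iff[OF perm123] two_forests_iff[OF perm123] three_forests_iff[OF perm123]
    using assms by argo
  then show ?thesis by (auto simp: ftype_def ftypes_def)
qed

lemma ftype_subset: "ftype n k \<subseteq> Pow (EG n)"
  by (simp add: ftype_def forests_subset)

lemma ftype_disjoint:
  assumes "k \<in> ftypes" "l \<in> ftypes" "k \<noteq> l"
  shows "ftype n k \<inter> ftype n l = {}"
proof (rule ccontr)
  assume "ftype n k \<inter> ftype n l \<noteq> {}"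
  then obtain f where "f \<in> ftype n k" "f \<in> ftype n l" by blast
  from ftype_conn(2-4)[OF this(1) assms(1)] ftype_conn(2-4)[OF this(2) assms(2)]
  have "tconn k 1 2 = tconn l 1 2" "tconn k 1 3 = tconn l 1 3" "tconn k 2 3 = tconn l 2 3" by simp_all
  moreover have "\<forall>k\<in>{0, 1, 2, 3, 4}. \<forall>l\<in>{0, 1, 2, 3, 4}. k \<noteq> l \<longrightarrow> \<not> (tconn k 1 2 = tconn l 1 2 \<and>
      tconn k 1 3 = tconn l 1 3 \<and> tconn k 2 3 = tconn l 2 3)"
    by (simp add: tconn_def)
  ultimately show False using assms unfolding ftypes_def by blast
qed

text \<open>The right-hand sides of \<open>forests_Suc_iff\<close>, \<open>rooted_iffs\<close> and
  (negated) \<open>corner_conns\<close>, with the \<open>pconn\<close> values of the cells 1, 2, 3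
  replaced by \<open>tconn\<close> of their types \<open>k\<close>, \<open>l\<close>,
  \<open>m\<close>.\<close>

definition three_types :: "(nat \<times> nat \<times> nat) \<Rightarrow> bool" where
  "three_types = (\<lambda>(k, l, m).
    \<not> (tconn k 2 3 \<and> tconn l 1 3 \<and> tconn m 1 2) \<and>
    (tconn k 1 2 \<or> tconn k 1 3 \<and> tconn m 1 2 \<and> tconn l 1 3 \<or>
     tconn l 1 2 \<or> tconn l 2 3 \<and> tconn m 1 2 \<and> tconn k 2 3 \<or>
     tconn m 1 3 \<and> tconn k 2 3 \<or> tconn m 2 3 \<and> tconn l 1 3) \<and>
    (tconn k 1 3 \<or> tconn k 1 2 \<and> tconn l 1 3 \<and> tconn m 1 2 \<or>
     tconn m 1 3 \<or> tconn m 2 3 \<and> tconn l 1 3 \<and> tconn k 2 3 \<or>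
     tconn l 1 2 \<and> tconn k 2 3 \<or> tconn l 2 3 \<and> tconn m 1 2) \<and>
    (tconn l 2 3 \<or> tconn l 1 2 \<and> tconn k 2 3 \<and> tconn m 1 2 \<or>
     tconn m 2 3 \<or> tconn m 1 3 \<and> tconn k 2 3 \<and> tconn l 1 3 \<or>
     tconn k 1 2 \<and> tconn l 1 3 \<or> tconn k 1 3 \<and> tconn m 1 2) \<and>
    \<not> (tconn k 1 2 \<and> tconn l 1 2 \<or> tconn k 1 3 \<and> tconn m 1 2 \<and> tconn l 2 3) \<and>
    \<not> (tconn k 1 3 \<and> tconn m 1 3 \<or> tconn k 1 2 \<and> tconn l 1 3 \<and> tconn m 2 3) \<and>
    \<not> (tconn l 2 3 \<and> tconn m 2 3 \<or> tconn l 1 2 \<and> tconn k 2 3 \<and> tconn m 1 3))"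

lemma three_forests_Suc:
  "three_forests (Suc n) = (\<Union>(k, l, m) \<in> {w \<in> ftypes \<times> ftypes \<times> ftypes. three_types w}.
     box n (1, ftype n k) (2, ftype n l) (3, ftype n m))" (is "_ = ?B")
proof -
  have key: "f \<in> three_forests (Suc n) \<longleftrightarrow> three_types (k, l, m)"
    if f: "f \<subseteq> EG (Suc n)" and t: "k \<in> ftypes" "l \<in> ftypes" "m \<in> ftypes"
      "part 1 f \<in> ftype n k" "part 2 f \<in> ftype n l" "part 3 f \<in> ftype n m" for f k l m
    unfolding three_forests_iff[OF perm123] forests_Suc_iff[OF f perm123]
      corner_conns[OF perm123 f] rooted_iffs[OF perm123 f]
      ftype_conn(2-4)[OF t(4,1)] ftype_conn(2-4)[OF t(5,2)] ftype_conn(2-4)[OF t(6,3)]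
      three_types_def prod.case
    using ftype_conn(1)[OF t(4,1)] ftype_conn(1)[OF t(5,2)] ftype_conn(1)[OF t(6,3)] by argo
  show ?thesis
  proof (intro equalityI subsetI)
    fix f assume L: "f \<in> three_forests (Suc n)"
    then have f: "f \<in> forests (Suc n)" "f \<subseteq> EG (Suc n)" by (auto simp: three_forests_def forests_def)
    have "part i f \<in> forests n" if "i \<in> idx" for i using part_in_forests[OF f(1) that] .
    then have "part 1 f \<in> forests n" "part 2 f \<in> forests n" "part 3 f \<in> forests n" by (simp_all add: idx_def)
    then obtain k l m where t: "k \<in> ftypes" "l \<in> ftypes" "m \<in> ftypes"
      "part 1 f \<in> ftype n k" "part 2 f \<in> ftype n l" "part 3 f \<in> ftype n m"
      using ftype_cover by meson
    have "three_types (k, l, m)" using key[OF f(2) t] L by simp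
    then have "(k, l, m) \<in> {w \<in> ftypes \<times> ftypes \<times> ftypes. three_types w}"
      using t(1-3) by (simp only: mem_Collect_eq mem_Times_iff fst_conv snd_conv)
    moreover have "f \<in> box n (1, ftype n k) (2, ftype n l) (3, ftype n m)"
      using f t unfolding box_def by simp
    ultimately show "f \<in> ?B" by blast
  next
    fix f assume "f \<in> ?B"
    then obtain k l m where klm: "(k, l, m) \<in> {w \<in> ftypes \<times> ftypes \<times> ftypes. three_types w}"
      and b: "f \<in> box n (1, ftype n k) (2, ftype n l) (3, ftype n m)" by blast
    have t: "k \<in> ftypes" "l \<in> ftypes" "m \<in> ftypes" and tt: "three_types (k, l, m)"
      using klm by simp_all
    have f: "f \<subseteq> EG (Suc n)" "part 1 f \<in> ftype n k" "part 2 f \<in> ftype n l" "part 3 f \<in> ftype n m"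
      using b unfolding box_def by simp_all
    show "f \<in> three_forests (Suc n)" using key[OF f(1) t f(2-4)] tt by simp
  qed
qed

text \<open>Twenty-six triples of types are admissible: twelve consist of a tree, a two-component
  and a three-component forest, fourteen of three two-component forests.\<close>

lemma card_three_forests_Suc:
  assumes s: "\<And>c. c \<in> idx \<Longrightarrow> real (card (two_forests n c)) = s"
  shows "real (card (three_forests (Suc n))) =
    12 * s * card (Trees n) * card (three_forests n) + 14 * s ^ 3"
proof -
  define t r where "t = real (card (Trees n))" and "r = real (card (three_forests n))"
  define w where "w k = (if k = 0 then t else if k = 4 then r else s)" for k :: nat
  have w: "real (card (ftype n k)) = w k" if "k \<in> ftypes" for k
    using that s by (auto simp: w_def ftype_def t_def r_def ftypes_def idx_def)
  define L where "L = {w \<in> ftypes \<times> ftypes \<times> ftypes. three_types w}"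
  have fin: "finite L" unfolding L_def ftypes_def by simp
  have "card (three_forests (Suc n)) =
     (\<Sum>(k, l, m)\<in>L. card (box n (1, ftype n k) (2, ftype n l) (3, ftype n m)))"
    unfolding three_forests_Suc L_def
  proof (subst card_UN_disjoint)
    show "finite {w \<in> ftypes \<times> ftypes \<times> ftypes. three_types w}" using fin by (simp add: L_def)
    show "\<forall>i\<in>{w \<in> ftypes \<times> ftypes \<times> ftypes. three_types w}.
       finite (case i of (k, l, m) \<Rightarrow> box n (1, ftype n k) (2, ftype n l) (3, ftype n m))"
      by (auto simp: finite_box)
    show "\<forall>i\<in>{w \<in> ftypes \<times> ftypes \<times> ftypes. three_types w}. \<forall>j\<in>{w \<in> ftypes \<times> ftypes \<times> ftypes. three_types w}. i \<noteq> j \<longrightarrow>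
       (case i of (k, l, m) \<Rightarrow> box n (1, ftype n k) (2, ftype n l) (3, ftype n m)) \<inter>
       (case j of (k, l, m) \<Rightarrow> box n (1, ftype n k) (2, ftype n l) (3, ftype n m)) = {}"
    proof (intro ballI impI)
      fix i j assume ij: "i \<in> {w \<in> ftypes \<times> ftypes \<times> ftypes. three_types w}" "j \<in> {w \<in> ftypes \<times> ftypes \<times> ftypes. three_types w}" "i \<noteq> j"
      obtain k l m k' l' m' where e: "i = (k, l, m)" "j = (k', l', m')" by (cases i, cases j)
      have "ftype n k \<inter> ftype n k' = {} \<or> ftype n l \<inter> ftype n l' = {} \<or> ftype n m \<inter> ftype n m' = {}"
        using ij ftype_disjoint[of k k' n] ftype_disjoint[of l l' n] ftype_disjoint[of m m' n]
        unfolding e by blast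
      then show "(case i of (k, l, m) \<Rightarrow> box n (1, ftype n k) (2, ftype n l) (3, ftype n m)) \<inter>
       (case j of (k, l, m) \<Rightarrow> box n (1, ftype n k) (2, ftype n l) (3, ftype n m)) = {}"
        unfolding e prod.case by (rule box_disjoint)
    qed
  qed (simp add: case_prod_unfold)
  then have "real (card (three_forests (Suc n))) =
     (\<Sum>(k, l, m)\<in>L. real (card (box n (1, ftype n k) (2, ftype n l) (3, ftype n m))))"
    by (simp add: case_prod_unfold)
  also have "\<dots> = (\<Sum>(k, l, m)\<in>L. w k * w l * w m)"
  proof (rule sum.cong[OF refl])
    fix x assume "x \<in> L"
    then obtain k l m where "x = (k, l, m)" "k \<in> ftypes" "l \<in> ftypes" "m \<in> ftypes" unfolding L_def by blast
    then show "(case x of (k, l, m) \<Rightarrow> real (card (box n (1, ftype n k) (2, ftype n l) (3, ftype n m)))) =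
       (case x of (k, l, m) \<Rightarrow> w k * w l * w m)"
      using card_box[OF perm123 ftype_subset ftype_subset ftype_subset, of n k l m] w by simp
  qed
  also have "\<dots> = (\<Sum>x\<in>ftypes \<times> ftypes \<times> ftypes. if three_types x then (case x of (k, l, m) \<Rightarrow> w k * w l * w m) else 0)"
    unfolding L_def by (rule sum.inter_filter) (simp add: ftypes_def)
  also have "\<dots> = (\<Sum>k\<in>ftypes. \<Sum>l\<in>ftypes. \<Sum>m\<in>ftypes. if three_types (k, l, m) then w k * w l * w m else 0)"
    by (simp add: sum.cartesian_product' cong: if_cong)
  also have "\<dots> = 12 * s * t * r + 14 * s ^ 3"
    \<comment> \<open>The simplifier decides admissibility for all 125 triples of types; the
      surviving monomials are then collected.\<close>
    unfolding ftypes_def three_types_def prod.case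
    by (simp add: tconn_def w_def) (simp add: algebra_simps power3_eq_cube)
  finally show ?thesis by (simp add: t_def r_def)
qed

section \<open>The classes at level zero and the counts at all levels\<close>

lemma perm3_u_ne:
  assumes p: "perm3 a b c"
  shows "u a \<noteq> u b" "u a \<noteq> u c" "u b \<noteq> u c"
proof -
  have "a \<noteq> b" "a \<noteq> c" "b \<noteq> c" using p by (auto simp: perm3_def)
  then show "u a \<noteq> u b" "u a \<noteq> u c" "u b \<noteq> u c" using perm3_mem[OF p] u_eq_iff by blast+
qed

lemma EG_0_perm:
  assumes "perm3 a b c"
  shows "EG 0 = {{u a, u b}, {u a, u c}, {u b, u c}}"
proof -
  have "a \<in> {1, 2, 3}" "b \<in> {1, 2, 3}" "c \<in> {1, 2, 3}" "a \<noteq> b" "a \<noteq> c" "b \<noteq> c"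
    using assms by (auto simp: perm3_def idx_def)
  then show ?thesis by (elim insertE; simp add: insert_commute del: One_nat_def)
qed

lemma conn_EG_0:
  assumes p: "perm3 a b c" and f: "f \<subseteq> EG 0"
  shows "conn f (u a) (u b) \<longleftrightarrow> {u a, u b} \<in> f \<or> {u a, u c} \<in> f \<and> {u b, u c} \<in> f"
proof
  have ne: "u a \<noteq> u b" "u a \<noteq> u c" "u b \<noteq> u c"
    using perm3_u_ne[OF p] by simp_all
  show "{u a, u b} \<in> f \<or> {u a, u c} \<in> f \<and> {u b, u c} \<in> f" if c: "conn f (u a) (u b)"
  proof (rule ccontr)
    assume no: "\<not> ?thesis"
    define S where "S = {v. v = u a \<or> v = u c \<and> {u a, u c} \<in> f}"
    have "u b \<in> S"
    proof (rule conn_closed[OF c])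
      fix v w assume v: "v \<in> S" "{v, w} \<in> f"
      then have "{v, w} \<in> EG 0" using f by blast
      then have "{v, w} = {u a, u b} \<or> {v, w} = {u a, u c} \<or> {v, w} = {u b, u c}"
        by (simp only: EG_0_perm[OF p] insert_iff empty_iff simp_thms)
      moreover have "{u c, u b} \<notin> f" if "{u a, u c} \<in> f"
        using no that by (simp add: insert_commute)
      moreover have "v = u a \<or> v = u c \<and> {u a, u c} \<in> f" using v unfolding S_def by simp
      ultimately have "w = u a \<or> w = u c \<and> {u a, u c} \<in> f"
        using v(2) no ne unfolding doubleton_eq_iff by metis
      then show "w \<in> S" unfolding S_def by simp
    qed (simp add: S_def)
    then show False using ne by (simp add: S_def)
  qed
  show "conn f (u a) (u b)" if "{u a, u b} \<in> f \<or> {u a, u c} \<in> f \<and> {u b, u c} \<in> f"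
    using that conn_edge[of "u a" "u b" f] conn_edge[of "u a" "u c" f] conn_edge[of "u b" "u c" f]
      conn_sym[of f "u b" "u c"] conn_trans[of f "u a" "u c" "u b"] by blast
qed

lemma acyclic_EG_0:
  assumes p: "perm3 a b c" and f: "f \<subseteq> EG 0"
  shows "acyclic_graph f \<longleftrightarrow> \<not> ({u a, u b} \<in> f \<and> {u a, u c} \<in> f \<and> {u b, u c} \<in> f)"
proof
  have ne: "u a \<noteq> u b" "u a \<noteq> u c" "u b \<noteq> u c"
    using perm3_u_ne[OF p] by simp_all
  have sub: "f - X \<subseteq> EG 0" for X using f by blast
  show "\<not> ({u a, u b} \<in> f \<and> {u a, u c} \<in> f \<and> {u b, u c} \<in> f)" if ac: "acyclic_graph f"
    using acyclic_graph_bridge[OF ac _ ne(1)] conn_EG_0[OF p sub] ne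
    by (auto simp: doubleton_eq_iff)
  assume no: "\<not> ({u a, u b} \<in> f \<and> {u a, u c} \<in> f \<and> {u b, u c} \<in> f)"
  show "acyclic_graph f"
  proof (rule acyclic_graphI)
    fix x y assume e: "{x, y} \<in> f" "x \<noteq> y"
    have br: "\<not> conn (f - {{x, y}}) (u i) (u j)"
      if q: "perm3 i j k" "{x, y} = {u i, u j}" "\<not> ({u i, u k} \<in> f \<and> {u j, u k} \<in> f)" for i j k
      using conn_EG_0[OF q(1) sub] that by auto
    have q: "perm3 a b c" "perm3 a c b" "perm3 b c a" using p by (auto simp: perm3_def)
    have "{x, y} \<in> EG 0" using e f by blast
    then have "{x, y} = {u a, u b} \<or> {x, y} = {u a, u c} \<or> {x, y} = {u b, u c}"
      by (simp only: EG_0_perm[OF p] insert_iff empty_iff simp_thms)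
    then show "\<not> conn (f - {{x, y}}) x y"
    proof (elim disjE)
      assume xy: "{x, y} = {u a, u b}"
      have "\<not> conn (f - {{x, y}}) (u a) (u b)" by (rule br[OF q(1) xy]) (use no e(1) xy in simp)
      then show ?thesis using xy conn_sym unfolding doubleton_eq_iff by blast
    next
      assume xy: "{x, y} = {u a, u c}"
      have "\<not> conn (f - {{x, y}}) (u a) (u c)"
        by (rule br[OF q(2) xy]) (use no e(1) xy in \<open>auto simp: insert_commute\<close>)
      then show ?thesis using xy conn_sym unfolding doubleton_eq_iff by blast
    next
      assume xy: "{x, y} = {u b, u c}"
      have "\<not> conn (f - {{x, y}}) (u b) (u c)"
        by (rule br[OF q(3) xy]) (use no e(1) xy in \<open>auto simp: insert_commute\<close>)
      then show ?thesis using xy conn_sym unfolding doubleton_eq_iff by blast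
    qed
  qed
qed

lemma forests_0_iff:
  assumes p: "perm3 a b c"
  shows "f \<in> forests 0 \<longleftrightarrow> f \<subseteq> EG 0 \<and> \<not> ({u a, u b} \<in> f \<and> {u a, u c} \<in> f \<and> {u b, u c} \<in> f)"
proof -
  have "\<forall>x\<in>VG 0. \<exists>i\<in>idx. conn f x (u i)"
    using conn_refl by (auto simp: idx_def simp del: One_nat_def)
  then show ?thesis unfolding forests_def using acyclic_EG_0[OF p] by blast
qed

lemma classes_0:
  assumes p: "perm3 a b c"
  shows "Trees 0 = {{{u a, u b}, {u a, u c}}, {{u a, u b}, {u b, u c}}, {{u a, u c}, {u b, u c}}}"
    and "two_forests 0 c = {{{u a, u b}}}"
    and "three_forests 0 = {{}}"
    and "card (Trees 0) = 3"
proof -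
  have ne: "u a \<noteq> u b" "u a \<noteq> u c" "u b \<noteq> u c"
    using perm3_u_ne[OF p] by simp_all
  define x y z where "x = {u a, u b}" and "y = {u a, u c}" and "z = {u b, u c}"
  have d: "x \<noteq> y" "x \<noteq> z" "y \<noteq> z" unfolding x_def y_def z_def using ne by (auto simp: doubleton_eq_iff)
  have E: "EG 0 = {x, y, z}" unfolding x_def y_def z_def by (rule EG_0_perm[OF p])
  have q: "perm3 a c b" "perm3 b c a" using p by (auto simp: perm3_def)
  have C: "conn f (u a) (u b) \<longleftrightarrow> x \<in> f \<or> y \<in> f \<and> z \<in> f"
      "conn f (u a) (u c) \<longleftrightarrow> y \<in> f \<or> x \<in> f \<and> z \<in> f"
      "conn f (u b) (u c) \<longleftrightarrow> z \<in> f \<or> x \<in> f \<and> y \<in> f" if "f \<subseteq> {x, y, z}" for f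
    using conn_EG_0[OF p, of f] conn_EG_0[OF q(1), of f] conn_EG_0[OF q(2), of f] that
    unfolding E x_def y_def z_def by (simp_all add: insert_commute)
  have F: "f \<in> forests 0 \<longleftrightarrow> f \<subseteq> {x, y, z} \<and> \<not> (x \<in> f \<and> y \<in> f \<and> z \<in> f)" for f
    using forests_0_iff[OF p, of f] unfolding E x_def y_def z_def .
  have T: "f \<in> Trees 0 \<longleftrightarrow> f \<subseteq> {x, y, z} \<and> (x \<in> f \<and> y \<in> f \<and> z \<notin> f \<or> x \<in> f \<and> z \<in> f \<and> y \<notin> f \<or> y \<in> f \<and> z \<in> f \<and> x \<notin> f)" for f
    unfolding Trees_iff[OF p] F using C[of f] by argo
  have S: "f \<in> two_forests 0 c \<longleftrightarrow> f \<subseteq> {x, y, z} \<and> x \<in> f \<and> y \<notin> f \<and> z \<notin> f" for f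
    unfolding two_forests_iff[OF p] F using C[of f] by argo
  have R: "f \<in> three_forests 0 \<longleftrightarrow> f \<subseteq> {x, y, z} \<and> x \<notin> f \<and> y \<notin> f \<and> z \<notin> f" for f
    unfolding three_forests_iff[OF p] F using C[of f] by argo
  have sets: "f \<subseteq> {x, y, z} \<and> x \<in> f \<and> y \<in> f \<and> z \<notin> f \<longleftrightarrow> f = {x, y}"
     "f \<subseteq> {x, y, z} \<and> x \<in> f \<and> z \<in> f \<and> y \<notin> f \<longleftrightarrow> f = {x, z}"
     "f \<subseteq> {x, y, z} \<and> y \<in> f \<and> z \<in> f \<and> x \<notin> f \<longleftrightarrow> f = {y, z}"
     "f \<subseteq> {x, y, z} \<and> x \<in> f \<and> y \<notin> f \<and> z \<notin> f \<longleftrightarrow> f = {x}"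
     "f \<subseteq> {x, y, z} \<and> x \<notin> f \<and> y \<notin> f \<and> z \<notin> f \<longleftrightarrow> f = {}" for f
    using d by blast+
  have TT: "Trees 0 = {{x, y}, {x, z}, {y, z}}"
  proof (rule set_eqI)
    fix f
    show "f \<in> Trees 0 \<longleftrightarrow> f \<in> {{x, y}, {x, z}, {y, z}}"
      unfolding T insert_iff empty_iff using sets(1-3)[of f] by argo
  qed
  then show "Trees 0 = {{{u a, u b}, {u a, u c}}, {{u a, u b}, {u b, u c}}, {{u a, u c}, {u b, u c}}}"
    unfolding x_def y_def z_def .
  show "card (Trees 0) = 3" unfolding TT using d by (simp add: doubleton_eq_iff)
  have "two_forests 0 c = {{x}}" using S sets(4) by blast
  then show "two_forests 0 c = {{{u a, u b}}}" unfolding x_def .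
  show "three_forests 0 = {{}}" using R sets(5) by blast
qed

lemma
  fixes s :: real
  assumes p: "perm3 a b c" and s: "\<And>c. c \<in> idx \<Longrightarrow> real (card (two_forests n c)) = s"
  shows card_Trees_Suc: "real (card (Trees (Suc n))) = 6 * (real (card (Trees n)))\<^sup>2 * s"
    and card_two_forests_Suc: "real (card (two_forests (Suc n) c)) =
      7 * card (Trees n) * s\<^sup>2 + (card (Trees n))\<^sup>2 * card (three_forests n)"
proof -
  note simps = card_box[OF p] forests_subset s perm3_mem[OF p] power2_eq_square
  have "real (card (Trees (Suc n))) = (\<Sum>f\<in>Trees (Suc n). 1)" by simp
  also have "\<dots> = 6 * (real (card (Trees n)))\<^sup>2 * s"
    unfolding sum_Trees_Suc[OF p] by (simp add: simps)
  finally show "real (card (Trees (Suc n))) = 6 * (real (card (Trees n)))\<^sup>2 * s" .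
  have "real (card (two_forests (Suc n) c)) = (\<Sum>f\<in>two_forests (Suc n) c. 1)" by simp
  also have "\<dots> = 7 * card (Trees n) * s\<^sup>2 + (card (Trees n))\<^sup>2 * card (three_forests n)"
    unfolding sum_two_forests_Suc[OF p] by (simp add: simps)
  finally show "real (card (two_forests (Suc n) c)) =
      7 * card (Trees n) * s\<^sup>2 + (card (Trees n))\<^sup>2 * card (three_forests n)" .
qed

lemma ex_perm3:
  assumes "c \<in> idx"
  shows "\<exists>a b. perm3 a b c"
proof -
  have "perm3 2 3 1" "perm3 1 3 2" "perm3 1 2 3" by (auto simp: perm3_def idx_def)
  then show ?thesis using assms unfolding idx_def by blast
qed

text \<open>The relation \<open>t * r = 3 * s\<^sup>2\<close> is what makes the offspring law independent of the level.\<close>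
lemma class_cards:
  "\<exists>t s r. t > 0 \<and> s > 0 \<and> real (card (Trees n)) = t \<and>
     (\<forall>c\<in>idx. real (card (two_forests n c)) = s) \<and> real (card (three_forests n)) = r \<and> t * r = 3 * s\<^sup>2"
proof (induction n)
  case 0
  have "real (card (two_forests 0 c)) = 1" if "c \<in> idx" for c
  proof -
    obtain a b where "perm3 a b c" using ex_perm3[OF \<open>c \<in> idx\<close>] by blast
    then show ?thesis by (simp add: classes_0(2))
  qed
  then show ?case using classes_0(3,4)[OF perm123]
    by (intro exI[of _ 3] exI[of _ 1] exI[of _ 1]) simp
next
  case (Suc n)
  then obtain t s r where h: "t > 0" "s > 0" "real (card (Trees n)) = t"
    "\<And>c. c \<in> idx \<Longrightarrow> real (card (two_forests n c)) = s" "real (card (three_forests n)) = r" "t * r = 3 * s\<^sup>2"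
    by blast
  have T: "real (card (Trees (Suc n))) = 6 * t\<^sup>2 * s"
    using card_Trees_Suc[OF perm123 h(4)] h by simp
  have S: "real (card (two_forests (Suc n) c)) = 7 * t * s\<^sup>2 + t\<^sup>2 * r" if c: "c \<in> idx" for c
  proof -
    obtain a b where p: "perm3 a b c" using ex_perm3[OF c] by blast
    show ?thesis using card_two_forests_Suc[OF p h(4)] h by simp
  qed
  have R: "real (card (three_forests (Suc n))) = 12 * s * t * r + 14 * s ^ 3"
    using card_three_forests_Suc[OF h(4)] h by simp
  \<comment> \<open>With \<open>t * r = 3 * s\<^sup>2\<close> the coefficients become
    \<open>7 + 3 = 10\<close> and \<open>12 * 3 + 14 = 50\<close>. The relation is reproduced at the
    next level because \<open>6 * 50 = 3 * 10\<^sup>2\<close>.\<close>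
  have S': "7 * t * s\<^sup>2 + t\<^sup>2 * r = 10 * t * s\<^sup>2"
    using arg_cong[OF h(6), of "\<lambda>x. t * x"] by (simp add: power2_eq_square algebra_simps)
  have R': "12 * s * t * r + 14 * s ^ 3 = 50 * s ^ 3"
    using arg_cong[OF h(6), of "\<lambda>x. s * x"] by (simp add: power2_eq_square power3_eq_cube algebra_simps)
  show ?case
    using T S R h(1,2) unfolding S' R'
    by (intro exI[of _ "6 * t\<^sup>2 * s"] exI[of _ "10 * t * s\<^sup>2"] exI[of _ "50 * s ^ 3"])
      (simp add: power2_eq_square power3_eq_cube)
qed

subsection \<open>The branching structure\<close>

text \<open>An entry \<open>(i, x, y)\<close> means that cell \<open>i\<close> is crossed from its
  corner \<open>u x\<close> to its corner \<open>u y\<close>. The second branch is the route through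
  the third cell, whose index is \<open>6 - a - b\<close> because \<open>1 + 2 + 3 = 6\<close>; it
  is the actual route if \<open>f\<close> joins \<open>u a\<close> to \<open>u b\<close> but not
  directly.\<close>

definition steps :: "graph_edges \<Rightarrow> nat \<Rightarrow> nat \<Rightarrow> (nat \<times> nat \<times> nat) list" where
  "steps f a b = (if pconn f a a b \<and> pconn f b a b then [(a, a, b), (b, a, b)]
     else let c = 6 - a - b in [(a, a, c), (c, a, b), (b, c, b)])"

lemma perm3_third: "perm3 a b c \<Longrightarrow> 6 - a - b = c"
proof -
  assume p: "perm3 a b c"
  have "a \<noteq> b" "a \<noteq> c" "b \<noteq> c" using p unfolding perm3_def by blast+
  then have "(\<Sum>i\<in>{a, b, c}. i) = a + b + c" by simp
  moreover have "(\<Sum>i\<in>idx. i) = 6" by (simp add: idx_def)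
  moreover have "idx = {a, b, c}" using p by (simp add: perm3_def)
  ultimately show "6 - a - b = c" by simp
qed

lemma steps_eq:
  assumes "perm3 a b c"
  shows "steps f a b = (if pconn f a a b \<and> pconn f b a b then [(a, a, b), (b, a, b)]
     else [(a, a, c), (c, a, b), (b, c, b)])"
  using perm3_third[OF assms] by (simp add: steps_def)

lemma prod3_mono:
  fixes x y z :: real
  assumes "0 \<le> x" "x \<le> x'" "0 \<le> y" "y \<le> y'" "0 \<le> z" "z \<le> z'"
  shows "x * y * z \<le> x' * y' * z'"
  using assms by (intro mult_mono) auto

text \<open>Averaging this product over the forests of one type gives the offspring generating
  function; averaging the sum \<open>step_sum\<close> gives the mean matrix.\<close>

definition step_prod :: "(graph_edges \<Rightarrow> nat \<Rightarrow> nat \<Rightarrow> real) \<Rightarrow> nat \<Rightarrow> nat \<Rightarrow> graph_edges \<Rightarrow> real" where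
  "step_prod h a b f = prod_list (map (\<lambda>(i, x, y). h (part i f) x y) (steps f a b))"

definition step_sum :: "(graph_edges \<Rightarrow> nat \<Rightarrow> nat \<Rightarrow> real) \<Rightarrow> nat \<Rightarrow> nat \<Rightarrow> graph_edges \<Rightarrow> real" where
  "step_sum h a b f = sum_list (map (\<lambda>(i, x, y). h (part i f) x y) (steps f a b))"

context
  fixes a b c n :: nat and h :: "graph_edges \<Rightarrow> nat \<Rightarrow> nat \<Rightarrow> real" and X Y Z :: "graph_edges set"
  assumes p: "perm3 a b c" and h: "\<And>f x y. 0 \<le> h f x y"
    and sub: "X \<subseteq> Pow (EG n)" "Y \<subseteq> Pow (EG n)" "Z \<subseteq> Pow (EG n)"
begin

text \<open>\<open>steps\<close> is constant on such a box, so the sums factorize by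
  \<open>sum_box\<close>; the cell that is not crossed contributes its number of forests.\<close>

lemma direct_box:
  fixes x y :: real
  assumes d: "\<And>f. f \<in> X \<Longrightarrow> conn f (u a) (u b)" "\<And>f. f \<in> Y \<Longrightarrow> conn f (u a) (u b)"
    and "(\<Sum>f\<in>X. h f a b) \<le> x" "(\<Sum>f\<in>Y. h f a b) \<le> y"
  shows "sum (step_prod h a b) (box n (a, X) (b, Y) (c, Z)) \<le> x * y * card Z"
    and "sum (step_sum h a b) (box n (a, X) (b, Y) (c, Z)) \<le> x * card Y * card Z + card X * y * card Z"
proof -
  have st: "steps f a b = [(a, a, b), (b, a, b)]" if "f \<in> box n (a, X) (b, Y) (c, Z)" for f
    using that d by (simp add: steps_eq[OF p] box_def)
  have "sum (step_prod h a b) (box n (a, X) (b, Y) (c, Z)) =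
      (\<Sum>f\<in>box n (a, X) (b, Y) (c, Z). h (part a f) a b * h (part b f) a b * 1)"
    by (rule sum.cong) (simp_all add: step_prod_def st)
  also have "\<dots> = (\<Sum>f\<in>X. h f a b) * (\<Sum>f\<in>Y. h f a b) * card Z"
    using sum_box[OF p sub, of "\<lambda>f. h f a b" "\<lambda>f. h f a b" "\<lambda>_. 1"] by simp
  also have "\<dots> \<le> x * y * card Z"
    by (rule prod3_mono) (use assms h in \<open>auto intro: sum_nonneg\<close>)
  finally show "sum (step_prod h a b) (box n (a, X) (b, Y) (c, Z)) \<le> x * y * card Z" .
  have "sum (step_sum h a b) (box n (a, X) (b, Y) (c, Z)) =
      (\<Sum>f\<in>box n (a, X) (b, Y) (c, Z). h (part a f) a b * 1 * 1 + 1 * h (part b f) a b * 1)"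
    by (rule sum.cong) (simp_all add: step_sum_def st)
  also have "\<dots> = (\<Sum>f\<in>X. h f a b) * card Y * card Z + card X * (\<Sum>f\<in>Y. h f a b) * card Z"
    unfolding sum.distrib
    using sum_box[OF p sub, of "\<lambda>f. h f a b" "\<lambda>_. 1" "\<lambda>_. 1"]
      sum_box[OF p sub, of "\<lambda>_. 1" "\<lambda>f. h f a b" "\<lambda>_. 1"] by simp
  also have "\<dots> \<le> x * card Y * card Z + card X * y * card Z"
    by (intro add_mono prod3_mono) (use assms h in \<open>auto intro: sum_nonneg\<close>)
  finally show "sum (step_sum h a b) (box n (a, X) (b, Y) (c, Z)) \<le> x * card Y * card Z + card X * y * card Z" .
qed

lemma via_box:
  fixes x y z :: real
  assumes d: "(\<forall>f\<in>X. \<not> conn f (u a) (u b)) \<or> (\<forall>f\<in>Y. \<not> conn f (u a) (u b))"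
    and "(\<Sum>f\<in>X. h f a c) \<le> x" "(\<Sum>f\<in>Y. h f c b) \<le> y" "(\<Sum>f\<in>Z. h f a b) \<le> z"
  shows "sum (step_prod h a b) (box n (a, X) (b, Y) (c, Z)) \<le> x * y * z"
    and "sum (step_sum h a b) (box n (a, X) (b, Y) (c, Z)) \<le>
      x * card Y * card Z + card X * y * card Z + real (card X) * real (card Y) * z"
proof -
  have st: "steps f a b = [(a, a, c), (c, a, b), (b, c, b)]" if "f \<in> box n (a, X) (b, Y) (c, Z)" for f
    using that d by (auto simp: steps_eq[OF p] box_def)
  have "sum (step_prod h a b) (box n (a, X) (b, Y) (c, Z)) =
      (\<Sum>f\<in>box n (a, X) (b, Y) (c, Z). h (part a f) a c * h (part b f) c b * h (part c f) a b)"
    by (rule sum.cong) (simp_all add: step_prod_def st)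
  also have "\<dots> = (\<Sum>f\<in>X. h f a c) * (\<Sum>f\<in>Y. h f c b) * (\<Sum>f\<in>Z. h f a b)"
    by (rule sum_box[OF p sub])
  also have "\<dots> \<le> x * y * z"
    by (rule prod3_mono) (use assms h in \<open>auto intro: sum_nonneg\<close>)
  finally show "sum (step_prod h a b) (box n (a, X) (b, Y) (c, Z)) \<le> x * y * z" .
  have "sum (step_sum h a b) (box n (a, X) (b, Y) (c, Z)) =
      (\<Sum>f\<in>box n (a, X) (b, Y) (c, Z). h (part a f) a c * 1 * 1 + 1 * h (part b f) c b * 1 + 1 * 1 * h (part c f) a b)"
    by (rule sum.cong) (simp_all add: step_sum_def st)
  also have "\<dots> = (\<Sum>f\<in>X. h f a c) * card Y * card Z + card X * (\<Sum>f\<in>Y. h f c b) * card Z + real (card X) * real (card Y) * (\<Sum>f\<in>Z. h f a b)"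
    unfolding sum.distrib
    using sum_box[OF p sub, of "\<lambda>f. h f a c" "\<lambda>_. 1" "\<lambda>_. 1"]
      sum_box[OF p sub, of "\<lambda>_. 1" "\<lambda>f. h f c b" "\<lambda>_. 1"]
      sum_box[OF p sub, of "\<lambda>_. 1" "\<lambda>_. 1" "\<lambda>f. h f a b"] by simp
  also have "\<dots> \<le> x * card Y * card Z + card X * y * card Z + real (card X) * real (card Y) * z"
    by (intro add_mono prod3_mono) (use assms(2-) h in \<open>simp_all add: sum_nonneg\<close>)
  finally show "sum (step_sum h a b) (box n (a, X) (b, Y) (c, Z)) \<le>
    x * card Y * card Z + card X * y * card Z + real (card X) * real (card Y) * z" .
qed

end

text \<open>\<open>t\<close> bounds the average over trees, \<open>s\<close> the average over
  two-component forests that join the two corners in question. Ranging over all labellings builds in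
  the symmetry, so a two-type recursion suffices.\<close>

definition avg_le :: "nat \<Rightarrow> (graph_edges \<Rightarrow> nat \<Rightarrow> nat \<Rightarrow> real) \<Rightarrow> real \<Rightarrow> real \<Rightarrow> bool" where
  "avg_le n h t s \<longleftrightarrow> (\<forall>a b c. perm3 a b c \<longrightarrow>
     (\<Sum>f\<in>Trees n. h f a b) \<le> t * card (Trees n) \<and>
     (\<Sum>f\<in>two_forests n c. h f a b) \<le> s * card (two_forests n c))"

text \<open>The polynomials are the offspring generating functions of the two types and the linear
  forms are their gradients at \<open>(1, 1)\<close>. Each box of \<open>Trees_Suc\<close> has
  weight \<open>1/6\<close>. In \<open>two_forests_Suc\<close> the box with a three-component forest
  has weight \<open>3/10\<close>, by \<open>t * r = 3 * s\<^sup>2\<close> for the class sizes, and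
  each of the other seven has weight \<open>1/10\<close>.\<close>

lemma avg_le_Suc:
  assumes h: "\<And>f x y. 0 \<le> h f x y" and avg: "avg_le n h t s"
  shows "avg_le (Suc n) (\<lambda>f a b. step_prod h a b f) ((t\<^sup>2 + s * t + s * t\<^sup>2) / 3)
      ((3 * t\<^sup>2 + s\<^sup>2 + 4 * t * s + 2 * t * s\<^sup>2) / 10)"
    and "avg_le (Suc n) (\<lambda>f a b. step_sum h a b f) ((5 * t + 2 * s) / 3) ((6 * t + 5 * s) / 5)"
proof -
  obtain \<tau> \<sigma> \<rho> where c: "\<tau> > 0" "\<sigma> > 0" "real (card (Trees n)) = \<tau>"
    "\<And>c. c \<in> idx \<Longrightarrow> real (card (two_forests n c)) = \<sigma>" "real (card (three_forests n)) = \<rho>" "\<tau> * \<rho> = 3 * \<sigma>\<^sup>2"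
    using class_cards[of n] by blast
  have main: "(\<Sum>f\<in>Trees (Suc n). step_prod h a b f) \<le> ((t\<^sup>2 + s * t + s * t\<^sup>2) / 3) * card (Trees (Suc n)) \<and>
     (\<Sum>f\<in>two_forests (Suc n) c. step_prod h a b f) \<le>
        ((3 * t\<^sup>2 + s\<^sup>2 + 4 * t * s + 2 * t * s\<^sup>2) / 10) * card (two_forests (Suc n) c) \<and>
     (\<Sum>f\<in>Trees (Suc n). step_sum h a b f) \<le> ((5 * t + 2 * s) / 3) * card (Trees (Suc n)) \<and>
     (\<Sum>f\<in>two_forests (Suc n) c. step_sum h a b f) \<le> ((6 * t + 5 * s) / 5) * card (two_forests (Suc n) c)"
    if p: "perm3 a b c" for a b c
  proof -
    have mem: "a \<in> idx" "b \<in> idx" "c \<in> idx" using p by (auto simp: perm3_def)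
    note cards = c(3,5) c(4)[OF mem(1)] c(4)[OF mem(2)] c(4)[OF mem(3)]
    have q: "perm3 a c b" "perm3 c b a" using p by (auto simp: perm3_def)
    have T: "(\<Sum>f\<in>Trees n. h f a b) \<le> t * \<tau>" "(\<Sum>f\<in>Trees n. h f a c) \<le> t * \<tau>" "(\<Sum>f\<in>Trees n. h f c b) \<le> t * \<tau>"
      using avg p q unfolding avg_le_def c(3) by blast+
    have "(\<Sum>f\<in>two_forests n c. h f a b) \<le> s * card (two_forests n c)"
       "(\<Sum>f\<in>two_forests n b. h f a c) \<le> s * card (two_forests n b)"
       "(\<Sum>f\<in>two_forests n a. h f c b) \<le> s * card (two_forests n a)"
      using avg p q unfolding avg_le_def by blast+
    then have S: "(\<Sum>f\<in>two_forests n c. h f a b) \<le> s * \<sigma>" "(\<Sum>f\<in>two_forests n b. h f a c) \<le> s * \<sigma>"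
      "(\<Sum>f\<in>two_forests n a. h f c b) \<le> s * \<sigma>" by (simp_all add: cards)
    have cn: "f \<in> Trees n \<Longrightarrow> conn f (u a) (u b)" "f \<in> two_forests n c \<Longrightarrow> conn f (u a) (u b)"
      "f \<in> two_forests n a \<Longrightarrow> \<not> conn f (u a) (u b)" "f \<in> two_forests n b \<Longrightarrow> \<not> conn f (u a) (u b)" for f
      using Trees_iff[OF p] two_forests_iff[OF p] by blast+
    note D = direct_box[where h = h, OF p h forests_subset(1) forests_subset(1) forests_subset(2) cn(1) cn(1) T(1) T(1)]
      direct_box[where h = h, OF p h forests_subset(1) forests_subset(1) forests_subset(3) cn(1) cn(1) T(1) T(1)]
      direct_box[where h = h, OF p h forests_subset(2) forests_subset(1) forests_subset(1) cn(2) cn(1) S(1) T(1)]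
      direct_box[where h = h, OF p h forests_subset(1) forests_subset(2) forests_subset(1) cn(1) cn(2) T(1) S(1)]
      direct_box[where h = h, OF p h forests_subset(2) forests_subset(2) forests_subset(1) cn(2) cn(2) S(1) S(1)]
      direct_box[where h = h, OF p h forests_subset(1) forests_subset(2) forests_subset(2) cn(1) cn(2) T(1) S(1)]
      direct_box[where h = h, OF p h forests_subset(2) forests_subset(1) forests_subset(2) cn(2) cn(1) S(1) T(1)]
    have va: "(\<forall>f\<in>X. \<not> conn f (u a) (u b)) \<or> (\<forall>f\<in>two_forests n a. \<not> conn f (u a) (u b))"
      and vb: "(\<forall>f\<in>two_forests n b. \<not> conn f (u a) (u b)) \<or> (\<forall>f\<in>X. \<not> conn f (u a) (u b))" for X
      using cn by blast+
    note V = via_box[where h = h, OF p h forests_subset(2) forests_subset(1) forests_subset(1) vb S(2) T(3) T(1)]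
      via_box[where h = h, OF p h forests_subset(1) forests_subset(2) forests_subset(1) va T(2) S(3) T(1)]
      via_box[where h = h, OF p h forests_subset(1) forests_subset(2) forests_subset(2) va T(2) S(3) S(1)]
      via_box[where h = h, OF p h forests_subset(2) forests_subset(1) forests_subset(2) vb S(2) T(3) S(1)]
    have e: "\<tau> * \<tau> * \<rho> = 3 * \<tau> * \<sigma>\<^sup>2" using c(6) by (simp add: mult.assoc)
    have cT: "real (card (Trees (Suc n))) = 6 * \<tau>\<^sup>2 * \<sigma>"
      using card_Trees_Suc[OF p c(4)] cards by simp
    have cS: "real (card (two_forests (Suc n) c)) = 10 * \<tau> * \<sigma>\<^sup>2"
      using card_two_forests_Suc[OF p c(4)] cards e by (simp add: power2_eq_square)
    \<comment> \<open>The box with a three-component forest is brought to the scale of the others by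
      replacing \<open>\<tau> * \<rho>\<close> with \<open>3 * \<sigma>\<^sup>2\<close>.\<close>
    have R: "t * \<tau> * (t * \<tau>) * \<rho> = 3 * t\<^sup>2 * \<tau> * \<sigma>\<^sup>2" "t * \<tau> * \<tau> * \<rho> = 3 * t * \<tau> * \<sigma>\<^sup>2" "\<tau> * (t * \<tau>) * \<rho> = 3 * t * \<tau> * \<sigma>\<^sup>2"
      using arg_cong[OF e, of "\<lambda>x. t\<^sup>2 * x"] arg_cong[OF e, of "\<lambda>x. t * x"]
      by (simp_all add: power2_eq_square algebra_simps)
    show ?thesis
    proof (intro conjI)
      show "(\<Sum>f\<in>Trees (Suc n). step_prod h a b f) \<le> ((t\<^sup>2 + s * t + s * t\<^sup>2) / 3) * card (Trees (Suc n))"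
        unfolding sum_Trees_Suc[OF p] cT
        using D(1)[of a] D(1)[of b] D(5) D(7) V(1) V(3)
        unfolding cards by (simp add: power2_eq_square algebra_simps)
      show "(\<Sum>f\<in>Trees (Suc n). step_sum h a b f) \<le> ((5 * t + 2 * s) / 3) * card (Trees (Suc n))"
        unfolding sum_Trees_Suc[OF p] cT
        using D(2)[of a] D(2)[of b] D(6) D(8) V(2) V(4)
        unfolding cards by (simp add: power2_eq_square algebra_simps)
      show "(\<Sum>f\<in>two_forests (Suc n) c. step_prod h a b f) \<le>
        ((3 * t\<^sup>2 + s\<^sup>2 + 4 * t * s + 2 * t * s\<^sup>2) / 10) * card (two_forests (Suc n) c)"
        unfolding sum_two_forests_Suc[OF p] cS
        using D(3) D(9) D(11)[of a] D(11)[of c] D(13)[of b] D(13)[of c] V(5) V(7)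
        unfolding cards R by (simp add: power2_eq_square algebra_simps)
      show "(\<Sum>f\<in>two_forests (Suc n) c. step_sum h a b f) \<le> ((6 * t + 5 * s) / 5) * card (two_forests (Suc n) c)"
        unfolding sum_two_forests_Suc[OF p] cS
        using D(4) D(10) D(12)[of a] D(12)[of c] D(14)[of b] D(14)[of c] V(6) V(8)
        unfolding cards R by (simp add: power2_eq_square algebra_simps)
    qed
  qed
  from main show "avg_le (Suc n) (\<lambda>f a b. step_prod h a b f) ((t\<^sup>2 + s * t + s * t\<^sup>2) / 3)
      ((3 * t\<^sup>2 + s\<^sup>2 + 4 * t * s + 2 * t * s\<^sup>2) / 10)"
    "avg_le (Suc n) (\<lambda>f a b. step_sum h a b f) ((5 * t + 2 * s) / 3) ((6 * t + 5 * s) / 5)"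
    unfolding avg_le_def by blast+
qed

section \<open>Mean number of visited cells and survival of percolation\<close>

text \<open>\<open>theta l n f a b\<close> is the probability that independent percolation with parameter \<open>l\<close> on the
  tree of cells visited between the corners \<open>a\<close> and \<open>b\<close> survives up to level \<open>n\<close>.\<close>
primrec theta :: "real \<Rightarrow> nat \<Rightarrow> graph_edges \<Rightarrow> nat \<Rightarrow> nat \<Rightarrow> real" where
  "theta l 0 = (\<lambda>f a b. 1)"
| "theta l (Suc n) = (\<lambda>f a b. 1 - step_prod (\<lambda>g x y. 1 - l * theta l n g x y) a b f)"

primrec ncells :: "nat \<Rightarrow> graph_edges \<Rightarrow> nat \<Rightarrow> nat \<Rightarrow> real" where
  "ncells 0 = (\<lambda>f a b. 1)"
| "ncells (Suc k) = (\<lambda>f a b. step_sum (ncells k) a b f)"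

lemma prod_list_unit_interval:
  fixes xs :: "real list"
  assumes "\<And>x. x \<in> set xs \<Longrightarrow> 0 \<le> x \<and> x \<le> 1"
  shows "0 \<le> prod_list xs \<and> prod_list xs \<le> 1"
  using assms by (induction xs) (auto intro: mult_le_one)

lemma prod_list_le_member:
  fixes xs :: "real list"
  assumes "\<And>x. x \<in> set xs \<Longrightarrow> 0 \<le> x \<and> x \<le> 1" "y \<in> set xs"
  shows "prod_list xs \<le> y"
  using assms
proof (induction xs)
  case (Cons x xs)
  have P: "0 \<le> prod_list xs" "prod_list xs \<le> 1" using prod_list_unit_interval[of xs] Cons.prems by auto
  have x: "0 \<le> x" "x \<le> 1" using Cons.prems by auto
  show ?case
  proof (cases "y = x")
    case True
    then show ?thesis using mult_left_mono[OF P(2) x(1)] by simp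
  next
    case False
    then have "prod_list xs \<le> y" using Cons by auto
    moreover have "x * prod_list xs \<le> prod_list xs" using mult_right_mono[OF x(2) P(1)] by simp
    ultimately show ?thesis by simp
  qed
qed simp

lemma step_prod_unit_interval:
  assumes "\<And>g x y. 0 \<le> h g x y \<and> h g x y \<le> 1"
  shows "0 \<le> step_prod h a b f \<and> step_prod h a b f \<le> 1"
  unfolding step_prod_def by (rule prod_list_unit_interval) (use assms in auto)

lemma step_prod_le_member:
  assumes "\<And>g x y. 0 \<le> h g x y \<and> h g x y \<le> 1" "(i, x, y) \<in> set (steps f a b)"
  shows "step_prod h a b f \<le> h (part i f) x y"
  unfolding step_prod_def by (rule prod_list_le_member) (use assms in \<open>auto simp: image_iff Bex_def\<close>)

lemma step_prod_of_bool:
  "step_prod (\<lambda>g x y. of_bool (P g x y)) a b f = of_bool (\<forall>(i, x, y) \<in> set (steps f a b). P (part i f) x y)"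
proof -
  have "prod_list (map (\<lambda>(i, x, y). of_bool (P (part i f) x y)) xs) =
    (of_bool (\<forall>(i, x, y) \<in> set xs. P (part i f) x y) :: real)" for xs
    by (induction xs) auto
  then show ?thesis unfolding step_prod_def .
qed

lemma theta_unit_interval:
  assumes "0 \<le> l" "l \<le> 1"
  shows "0 \<le> theta l n f a b \<and> theta l n f a b \<le> 1"
proof (induction n arbitrary: f a b)
  case (Suc n)
  have "0 \<le> 1 - l * theta l n g x y \<and> 1 - l * theta l n g x y \<le> 1" for g x y
    using Suc[of g x y] assms mult_le_one[of l "theta l n g x y"] by simp
  from step_prod_unit_interval[where h = "\<lambda>g x y. 1 - l * theta l n g x y", OF this]
  show ?case by simp
qed simp

text \<open>Survival through one given child is already survival, and the edge to that child is kept
  with probability \<open>l\<close>.\<close>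

lemma theta_Suc_ge:
  assumes l: "0 \<le> l" "l \<le> 1" and s: "(i, x, y) \<in> set (steps f a b)"
  shows "l * theta l n (part i f) x y \<le> theta l (Suc n) f a b"
proof -
  have "0 \<le> 1 - l * theta l n g x y \<and> 1 - l * theta l n g x y \<le> 1" for g x y
    using theta_unit_interval[OF l, of n g x y] l mult_le_one[of l "theta l n g x y"] by simp
  from step_prod_le_member[where h = "\<lambda>g x y. 1 - l * theta l n g x y", OF this s] show ?thesis by simp
qed

lemma avg_le_mono:
  assumes "avg_le n h t s" "\<And>f a b. h' f a b \<le> h f a b" "t \<le> t'" "s \<le> s'"
  shows "avg_le n h' t' s'"
  unfolding avg_le_def
proof (intro allI impI conjI)
  fix a b c assume p: "perm3 a b c"
  have "(\<Sum>f\<in>Trees n. h' f a b) \<le> (\<Sum>f\<in>Trees n. h f a b)" by (rule sum_mono) (rule assms)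
  also have "\<dots> \<le> t * card (Trees n)" using assms(1) p by (simp add: avg_le_def)
  also have "\<dots> \<le> t' * card (Trees n)" by (rule mult_right_mono) (use assms in auto)
  finally show "(\<Sum>f\<in>Trees n. h' f a b) \<le> t' * card (Trees n)" .
  have "(\<Sum>f\<in>two_forests n c. h' f a b) \<le> (\<Sum>f\<in>two_forests n c. h f a b)" by (rule sum_mono) (rule assms)
  also have "\<dots> \<le> s * card (two_forests n c)" using assms(1) p by (simp add: avg_le_def)
  also have "\<dots> \<le> s' * card (two_forests n c)" by (rule mult_right_mono) (use assms in auto)
  finally show "(\<Sum>f\<in>two_forests n c. h' f a b) \<le> s' * card (two_forests n c)" .
qed

lemma avg_le_affine:
  assumes "avg_le n h t s" "0 \<le> l"
  shows "avg_le n (\<lambda>f a b. k + l * h f a b) (k + l * t) (k + l * s)"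
  using assms
  by (auto simp: avg_le_def sum.distrib sum_distrib_left[symmetric] algebra_simps mult_left_mono
      intro!: mult_left_mono)

text \<open>Crude rational bounds, chosen so that \<open>2 < alpha_bar\<close> and the eigenvector
  entry \<open>3 * alpha_bar - 5\<close> lies between \<open>9/5\<close> and
  \<open>2\<close>.\<close>

lemma alpha_bar_bounds: "57 / 25 < alpha_bar" "alpha_bar < 23 / 10"
proof -
  have "143 / 10 < sqrt 205" by (rule real_less_rsqrt) (simp add: power2_eq_square)
  moreover have "sqrt 205 < 72 / 5" by (rule real_less_lsqrt) (simp_all add: power2_eq_square)
  ultimately show "57 / 25 < alpha_bar" "alpha_bar < 23 / 10" by (simp_all add: alpha_bar_def)
qed

text \<open>\<open>alpha_bar\<close> is an eigenvalue of \<open>((5/3, 2/3), (6/5, 1))\<close> with eigenvector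
  \<open>(2, 3 * alpha_bar - 5)\<close>.\<close>
lemma alpha_bar_eq: "alpha_bar\<^sup>2 = 8 / 3 * alpha_bar - 13 / 15"
proof -
  have "(sqrt 205)\<^sup>2 = 205" by simp
  then show ?thesis unfolding alpha_bar_def by (simp add: power2_eq_square algebra_simps)
qed

lemma ncells_nonneg: "0 \<le> ncells k f a b"
proof (induction k arbitrary: f a b)
  case (Suc k)
  then show ?case by (auto simp: step_sum_def intro!: sum_list_nonneg)
qed simp

text \<open>The eigenvector \<open>(2, 3 * alpha_bar - 5)\<close> dominates the initial value
  \<open>(1, 1)\<close>, and each application of the mean matrix multiplies it by
  \<open>alpha_bar\<close>.\<close>

lemma avg_ncells:
  "avg_le (k + n) (ncells k) (2 * alpha_bar ^ k) ((3 * alpha_bar - 5) * alpha_bar ^ k)"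
proof (induction k)
  case 0
  have "1 \<le> 3 * alpha_bar - 5" using alpha_bar_bounds by simp
  then have "(1::real) * x \<le> (3 * alpha_bar - 5) * x" if "0 \<le> x" for x
    using that by (rule mult_right_mono)
  then show ?case by (simp add: avg_le_def)
next
  case (Suc k)
  have "avg_le (Suc (k + n)) (ncells (Suc k))
     ((5 * (2 * alpha_bar ^ k) + 2 * ((3 * alpha_bar - 5) * alpha_bar ^ k)) / 3)
     ((6 * (2 * alpha_bar ^ k) + 5 * ((3 * alpha_bar - 5) * alpha_bar ^ k)) / 5)"
    unfolding ncells.simps by (rule avg_le_Suc(2)[OF ncells_nonneg Suc])
  \<comment> \<open>The first eigenvector equation holds by the choice of the second entry; the
    second equation is where \<open>alpha_bar_eq\<close> enters.\<close>
  moreover have "(5 * (2 * alpha_bar ^ k) + 2 * ((3 * alpha_bar - 5) * alpha_bar ^ k)) / 3 = 2 * alpha_bar ^ Suc k"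
    by (simp add: algebra_simps)
  moreover have "(6 * (2 * alpha_bar ^ k) + 5 * ((3 * alpha_bar - 5) * alpha_bar ^ k)) / 5 =
      (3 * alpha_bar - 5) * alpha_bar ^ Suc k"
  proof -
    have "(3 * alpha_bar - 5) * alpha_bar = 3 * alpha_bar - 13 / 5"
      using alpha_bar_eq by (simp add: power2_eq_square algebra_simps)
    then have e: "(3 * alpha_bar - 5) * alpha_bar ^ Suc k = (3 * alpha_bar - 13 / 5) * alpha_bar ^ k"
      by (metis mult.assoc power_Suc)
    have "(6 * (2 * X) + 5 * ((3 * alpha_bar - 5) * X)) / 5 = (3 * alpha_bar - 13 / 5) * X" for X
      by (simp add: field_simps)
    then show ?thesis unfolding e .
  qed
  ultimately show ?case by simp
qed

text \<open>The bound on extinction is kept at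
  \<open>(1, 1) - \<epsilon> * (2, 3 * alpha_bar - 5)\<close>. To first order one step multiplies
  the deviation from \<open>(1, 1)\<close> by \<open>l * alpha_bar = 1 + 10 * \<epsilon>\<close>;
  this gain of order \<open>\<epsilon>\<^sup>2\<close> absorbs the quadratic terms of the generating
  functions.\<close>

lemma avg_theta:
  assumes l: "0 < l" "l \<le> 1" "1 < l * alpha_bar"
  defines "\<epsilon> \<equiv> (l * alpha_bar - 1) / 10"
  shows "avg_le n (\<lambda>f a b. 1 - theta l n f a b) (1 - 2 * \<epsilon>) (1 - (3 * alpha_bar - 5) * \<epsilon>)"
proof (induction n)
  case 0
  \<comment> \<open>Since \<open>l * alpha_bar <= alpha_bar < 23 / 10\<close>, the surplus over 1 is
    below \<open>13 / 10\<close>. The smallness of \<open>\<epsilon>\<close> makes both bounds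
    nonnegative, as required at level zero, where extinction has probability 0.\<close>
  obtain m where m: "l * alpha_bar = m" by simp
  have "m \<le> alpha_bar" unfolding m[symmetric] using l alpha_bar_bounds by simp
  then have "\<epsilon> \<le> 13 / 100" using l(3) alpha_bar_bounds(2) unfolding \<epsilon>_def m by simp
  moreover have "0 < \<epsilon>" using l(3) unfolding \<epsilon>_def m by simp
  ultimately have e: "\<epsilon> \<le> 13 / 100" "0 < \<epsilon>" by auto
  then have "(3 * alpha_bar - 5) * \<epsilon> \<le> 2 * \<epsilon>" using alpha_bar_bounds by (intro mult_right_mono) auto
  also have "\<dots> \<le> 1" using e by simp
  finally have "0 \<le> 1 - (3 * alpha_bar - 5) * \<epsilon>" by simp
  moreover have "0 \<le> 1 - 2 * \<epsilon>" using e by simp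
  ultimately show ?case by (simp add: avg_le_def)
next
  case (Suc n)
  define v where "v = 3 * alpha_bar - 5"
  have v: "9 / 5 \<le> v" "v \<le> 2" using alpha_bar_bounds by (auto simp: v_def)
  have \<epsilon>: "0 < \<epsilon>" using l by (simp add: \<epsilon>_def)
  define p q where "p = l * (2 * \<epsilon>)" and "q = l * (v * \<epsilon>)"
  have lh: "0 \<le> 1 - l * theta l n g x y" for g x y
    using theta_unit_interval[of l n g x y] l mult_le_one[of l "theta l n g x y"] by simp
  have "avg_le n (\<lambda>f a b. (1 - l) + l * (1 - theta l n f a b)) ((1 - l) + l * (1 - 2 * \<epsilon>)) ((1 - l) + l * (1 - v * \<epsilon>))"
    using avg_le_affine[OF Suc, of l "1 - l"] l by (simp add: v_def)
  moreover have "(\<lambda>f a b. (1 - l) + l * (1 - theta l n f a b)) = (\<lambda>f a b. 1 - l * theta l n f a b)"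
    by (simp add: algebra_simps fun_eq_iff)
  moreover have "(1 - l) + l * (1 - 2 * \<epsilon>) = 1 - p" "(1 - l) + l * (1 - v * \<epsilon>) = 1 - q"
    by (simp_all add: p_def q_def algebra_simps)
  ultimately have "avg_le n (\<lambda>f a b. 1 - l * theta l n f a b) (1 - p) (1 - q)" by simp
  from avg_le_Suc(1)[OF lh this]
  have A: "avg_le (Suc n) (\<lambda>f a b. 1 - theta l (Suc n) f a b)
    (((1 - p)\<^sup>2 + (1 - q) * (1 - p) + (1 - q) * (1 - p)\<^sup>2) / 3)
    ((3 * (1 - p)\<^sup>2 + (1 - q)\<^sup>2 + 4 * (1 - p) * (1 - q) + 2 * (1 - p) * (1 - q)\<^sup>2) / 10)"
    by simp
  have pq: "0 \<le> p" "0 \<le> q" "p \<le> 2 * \<epsilon>" "q \<le> 2 * \<epsilon>"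
  proof -
    show "0 \<le> p" "0 \<le> q" using l \<epsilon> v by (auto simp: p_def q_def)
    show "p \<le> 2 * \<epsilon>" using l \<epsilon> by (simp add: p_def)
    have "l * (v * \<epsilon>) \<le> 1 * (2 * \<epsilon>)" using l \<epsilon> v by (intro mult_mono) auto
    then show "q \<le> 2 * \<epsilon>" by (simp add: q_def)
  qed
  have sq: "p\<^sup>2 \<le> 4 * \<epsilon>\<^sup>2" "p * q \<le> 4 * \<epsilon>\<^sup>2" "q\<^sup>2 \<le> 4 * \<epsilon>\<^sup>2"
    using mult_mono[OF pq(3,3)] mult_mono[OF pq(3,4)] mult_mono[OF pq(4,4)] pq \<epsilon>
    by (auto simp: power2_eq_square)
  have tri: "0 \<le> p\<^sup>2 * q" "0 \<le> p * q\<^sup>2" using pq by auto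
  have "x = 1 + 10 * ((x - 1) / 10)" for x :: real by (simp add: field_simps)
  then have le: "l * alpha_bar = 1 + 10 * \<epsilon>" unfolding \<epsilon>_def by blast
  have L1: "(5 * p + 2 * q) / 3 = 2 * \<epsilon> + 20 * \<epsilon>\<^sup>2"
  proof -
    have "(5 * p + 2 * q) / 3 = 2 * \<epsilon> * (l * alpha_bar)" by (simp add: p_def q_def v_def algebra_simps)
    then show ?thesis unfolding le by (simp add: power2_eq_square algebra_simps)
  qed
  have L2: "(12 * p + 10 * q) / 10 = v * \<epsilon> + 10 * (v * \<epsilon>\<^sup>2)"
  proof -
    have "24 + 10 * v = 10 * (alpha_bar * v)"
      using alpha_bar_eq by (simp add: v_def power2_eq_square algebra_simps)
    then have "(l * \<epsilon>) * (24 + 10 * v) = (l * \<epsilon>) * (10 * (alpha_bar * v))" by simp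
    then have "(12 * p + 10 * q) / 10 = v * \<epsilon> * (l * alpha_bar)" by (simp add: p_def q_def algebra_simps)
    then show ?thesis unfolding le by (simp add: power2_eq_square algebra_simps)
  qed
  have v2: "9 / 5 * \<epsilon>\<^sup>2 \<le> v * \<epsilon>\<^sup>2" using v by (intro mult_right_mono) auto
  have e0: "0 \<le> \<epsilon>\<^sup>2" by simp
  \<comment> \<open>The generating functions expanded at \<open>(1, 1)\<close>. With
    \<open>p\<close> and \<open>q\<close> at most \<open>2 * \<epsilon>\<close>, the quadratic terms
    are at most \<open>20/3 * \<epsilon>\<^sup>2\<close> and
    \<open>28/5 * \<epsilon>\<^sup>2\<close>, against gains of at least
    \<open>20 * \<epsilon>\<^sup>2\<close> and \<open>18 * \<epsilon>\<^sup>2\<close>.\<close>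
  have X1: "((1 - p)\<^sup>2 + (1 - q) * (1 - p) + (1 - q) * (1 - p)\<^sup>2) / 3 =
      1 - (5 * p + 2 * q) / 3 + (2 * p\<^sup>2 + 3 * (p * q) - p\<^sup>2 * q) / 3"
    by (simp add: power2_eq_square field_simps)
  have X2: "(3 * (1 - p)\<^sup>2 + (1 - q)\<^sup>2 + 4 * (1 - p) * (1 - q) + 2 * (1 - p) * (1 - q)\<^sup>2) / 10 =
      1 - (12 * p + 10 * q) / 10 + (3 * p\<^sup>2 + 3 * q\<^sup>2 + 8 * (p * q) - 2 * (p * q\<^sup>2)) / 10"
    by (simp add: power2_eq_square field_simps)
  have B1: "((1 - p)\<^sup>2 + (1 - q) * (1 - p) + (1 - q) * (1 - p)\<^sup>2) / 3 \<le> 1 - 2 * \<epsilon>"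
    unfolding X1 L1 using sq tri e0 by argo
  have B2: "(3 * (1 - p)\<^sup>2 + (1 - q)\<^sup>2 + 4 * (1 - p) * (1 - q) + 2 * (1 - p) * (1 - q)\<^sup>2) / 10 \<le> 1 - v * \<epsilon>"
    unfolding X2 L2 using sq tri e0 v2 by argo
  show ?case
    using avg_le_mono[OF A order_refl B1 B2] by (simp add: v_def)
qed

text \<open>Markov's inequality turns the bound on the mean into a fraction \<open>r < 1\<close> of
  trees with small \<open>theta\<close>. Each further level squares this fraction, because all of
  the at least two children must then be small too.\<close>

lemma avg_theta_small:
  assumes l: "0 < l" "l \<le> 1" "1 < l * alpha_bar"
  obtains r \<delta> where "0 \<le> r" "r < 1" "0 < \<delta>"
    "\<And>k n. avg_le (k + n) (\<lambda>f a b. of_bool (theta l (k + n) f a b < l ^ k * \<delta>)) (r ^ (2 ^ k)) (r ^ (2 ^ k))"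
proof -
  define \<epsilon> where "\<epsilon> = (l * alpha_bar - 1) / 10"
  obtain m where m: "l * alpha_bar = m" by simp
  have "m \<le> alpha_bar" unfolding m[symmetric] using l alpha_bar_bounds by simp
  then have e1: "\<epsilon> \<le> 13 / 100" using l(3) alpha_bar_bounds(2) unfolding \<epsilon>_def m by simp
  have e0: "0 < \<epsilon>" using l(3) unfolding \<epsilon>_def m by simp
  note \<epsilon> = e0 e1
  have v: "1 * \<epsilon> \<le> (3 * alpha_bar - 5) * \<epsilon>" using \<epsilon> alpha_bar_bounds by (intro mult_right_mono) auto
  \<comment> \<open>Markov's inequality for \<open>1 - theta\<close>: its mean is at most
    \<open>1 - \<epsilon>\<close> for both types, and the event is
    \<open>1 - theta > 1 - \<epsilon> / 2\<close>.\<close>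
  define r where "r = (1 - \<epsilon>) / (1 - \<epsilon> / 2)"
  have r: "0 \<le> r" "r < 1" using \<epsilon> by (auto simp: r_def field_simps)
  have base: "avg_le n (\<lambda>f a b. of_bool (theta l n f a b < \<epsilon> / 2)) r r" for n
  proof -
    have "avg_le n (\<lambda>f a b. 0 + (1 / (1 - \<epsilon> / 2)) * (1 - theta l n f a b))
       (0 + (1 / (1 - \<epsilon> / 2)) * (1 - 2 * \<epsilon>)) (0 + (1 / (1 - \<epsilon> / 2)) * (1 - (3 * alpha_bar - 5) * \<epsilon>))"
      using avg_theta[OF l, of n] \<epsilon> unfolding \<epsilon>_def[symmetric] by (intro avg_le_affine) auto
    then show ?thesis
    proof (rule avg_le_mono)
      fix f a b
      have "theta l n f a b \<le> 1" using theta_unit_interval[of l n f a b] l by simp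
      then show "of_bool (theta l n f a b < \<epsilon> / 2) \<le> 0 + (1 / (1 - \<epsilon> / 2)) * (1 - theta l n f a b)"
        using \<epsilon> by (auto simp: field_simps)
    qed (use \<epsilon> v in \<open>auto simp: r_def divide_simps\<close>)
  qed
  have amp: "avg_le (k + n) (\<lambda>f a b. of_bool (theta l (k + n) f a b < l ^ k * (\<epsilon> / 2))) (r ^ (2 ^ k)) (r ^ (2 ^ k))" for k n
  proof (induction k)
    case 0
    then show ?case using base[of n] by simp
  next
    case (Suc k)
    define R where "R = r ^ (2 ^ k)"
    have R: "0 \<le> R" "R \<le> 1" using r by (auto simp: R_def power_le_one)
    have "R * R\<^sup>2 \<le> 1 * R\<^sup>2" using R by (intro mult_right_mono) auto
    then have R3: "R * R\<^sup>2 \<le> R\<^sup>2" by simp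
    have RR: "r ^ (2 ^ Suc k) = R\<^sup>2" by (simp add: R_def power_mult[symmetric] mult.commute)
    let ?h = "\<lambda>g x y. of_bool (theta l (k + n) g x y < l ^ k * (\<epsilon> / 2)) :: real"
    have "avg_le (Suc (k + n)) (\<lambda>f a b. step_prod ?h a b f) ((R\<^sup>2 + R * R + R * R\<^sup>2) / 3)
      ((3 * R\<^sup>2 + R\<^sup>2 + 4 * R * R + 2 * R * R\<^sup>2) / 10)"
      by (rule avg_le_Suc(1)) (use Suc in \<open>simp_all add: R_def\<close>)
    then have "avg_le (Suc (k + n)) (\<lambda>f a b. of_bool (theta l (Suc (k + n)) f a b < l ^ Suc k * (\<epsilon> / 2))) (R\<^sup>2) (R\<^sup>2)"
    proof (rule avg_le_mono)
      fix f a b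
      have "theta l (k + n) (part i f) x y < l ^ k * (\<epsilon> / 2)"
        if "theta l (Suc (k + n)) f a b < l ^ Suc k * (\<epsilon> / 2)" "(i, x, y) \<in> set (steps f a b)" for i x y
      proof -
        have "l * theta l (k + n) (part i f) x y \<le> theta l (Suc (k + n)) f a b"
          by (rule theta_Suc_ge) (use l that in auto)
        also have "\<dots> < l * (l ^ k * (\<epsilon> / 2))" using that by simp
        finally show ?thesis using l by simp
      qed
      then show "of_bool (theta l (Suc (k + n)) f a b < l ^ Suc k * (\<epsilon> / 2)) \<le> step_prod ?h a b f"
        unfolding step_prod_of_bool by auto
      \<comment> \<open>Every monomial of the generating functions has degree at least two, and
        their coefficients sum to one; hence their value at \<open>(R, R)\<close> is at most
        \<open>R\<^sup>2\<close>.\<close>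
      show "(R\<^sup>2 + R * R + R * R\<^sup>2) / 3 \<le> R\<^sup>2" using R3 by (simp add: power2_eq_square)
      show "(3 * R\<^sup>2 + R\<^sup>2 + 4 * R * R + 2 * R * R\<^sup>2) / 10 \<le> R\<^sup>2" using R3 by (simp add: power2_eq_square)
    qed
    then show ?case by (simp add: RR del: power_Suc)
  qed
  show thesis by (rule that[OF r _ amp]) (use \<epsilon> in simp)
qed

subsection \<open>The cells visited by a path\<close>

primrec visited :: "nat \<Rightarrow> graph_edges \<Rightarrow> nat \<Rightarrow> nat \<Rightarrow> nat list set" where
  "visited 0 = (\<lambda>f a b. {[]})"
| "visited (Suc k) = (\<lambda>f a b. \<Union>(i, x, y)\<in>set (steps f a b). (#) i ` visited k (part i f) x y)"

lemma steps_perm3: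
  assumes "perm3 a b c" "(i, x, y) \<in> set (steps f a b)"
  shows "i \<in> idx \<and> (\<exists>z. perm3 x y z)"
proof -
  have "perm3 a b c" "perm3 a c b" "perm3 c b a" using assms(1) by (auto simp: perm3_def)
  then show ?thesis using assms(2) perm3_mem[OF assms(1)]
    by (auto simp: steps_eq[OF assms(1)] split: if_splits)
qed

lemma distinct_steps:
  assumes "perm3 a b c"
  shows "distinct (map fst (steps f a b))"
  using assms by (auto simp: steps_eq[OF assms] perm3_def)

lemma visited_words:
  assumes "perm3 a b c" "w \<in> visited k f a b"
  shows "w \<in> words k"
  using assms
proof (induction k arbitrary: f a b c w)
  case 0
  then show ?case by (simp add: words_def)
next
  case (Suc k)
  then obtain i x y v where v: "(i, x, y) \<in> set (steps f a b)" "w = i # v" "v \<in> visited k (part i f) x y"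
    by auto
  then have "i \<in> idx" "v \<in> words k" using steps_perm3[OF Suc.prems(1) v(1)] Suc.IH by blast+
  then show ?case using v by (simp add: words_def)
qed

lemma finite_visited: "finite (visited k f a b)"
  by (induction k arbitrary: f a b) auto

lemma card_visited: "real (card (visited k f a b)) \<le> ncells k f a b"
proof (induction k arbitrary: f a b)
  case (Suc k)
  have "real (card (\<Union>(i, x, y)\<in>set xs. (#) i ` visited k (part i f) x y)) \<le>
    sum_list (map (\<lambda>(i, x, y). ncells k (part i f) x y) xs)" for xs
  proof (induction xs)
    case (Cons s xs)
    obtain i x y where s: "s = (i, x, y)" by (cases s)
    have "card (\<Union>(i, x, y)\<in>set (s # xs). (#) i ` visited k (part i f) x y) \<le>
      card ((#) i ` visited k (part i f) x y) + card (\<Union>(i, x, y)\<in>set xs. (#) i ` visited k (part i f) x y)"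
      unfolding s by (simp add: card_Un_le)
    moreover have "card ((#) i ` visited k (part i f) x y) = card (visited k (part i f) x y)"
      by (rule card_image) (simp add: inj_on_def)
    ultimately show ?case using Cons Suc[of "part i f" x y] unfolding s by simp
  qed simp
  then show ?case by (simp add: step_sum_def)
qed simp

text \<open>The union bound for independent events.\<close>

lemma one_minus_prod_list_le:
  fixes g :: "'a \<Rightarrow> real"
  assumes "\<And>x. x \<in> set xs \<Longrightarrow> 0 \<le> g x \<and> g x \<le> 1"
  shows "1 - prod_list (map (\<lambda>x. 1 - g x) xs) \<le> sum_list (map g xs)"
  using assms
proof (induction xs)
  case (Cons x xs)
  have P: "0 \<le> prod_list (map (\<lambda>x. 1 - g x) xs) \<and> prod_list (map (\<lambda>x. 1 - g x) xs) \<le> 1"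
    by (rule prod_list_unit_interval) (use Cons.prems in auto)
  have x: "0 \<le> g x" using Cons.prems by simp
  have "g x * prod_list (map (\<lambda>x. 1 - g x) xs) \<le> g x" using P x by (simp add: mult_left_le)
  moreover have "1 - prod_list (map (\<lambda>x. 1 - g x) xs) \<le> sum_list (map g xs)" using Cons by simp
  ultimately show ?case by (simp add: left_diff_distrib)
qed simp

text \<open>Percolation that survives to level \<open>n\<close> has kept the whole path to some
  member \<open>v\<close> of the cutset, which has probability \<open>l ^ length v\<close>. The
  induction removes the first letter from the members of \<open>C\<close>; if \<open>C\<close>
  contains the root, its sum is already at least 1.\<close>

lemma theta_le_cutset:
  assumes l: "0 \<le> l" "l \<le> 1" and p: "perm3 a b c" and C: "finite C"
    and cut: "\<And>w. w \<in> visited n f a b \<Longrightarrow> \<exists>j. take j w \<in> C"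
  shows "theta l n f a b \<le> (\<Sum>v\<in>C. l ^ length v)"
  using p C cut
proof (induction n arbitrary: f a b c C)
  case 0
  then have "[] \<in> C" by simp
  then have "(\<Sum>v\<in>{[] :: nat list}. l ^ length v) \<le> (\<Sum>v\<in>C. l ^ length v)"
    by (intro sum_mono2) (use 0 l in auto)
  then show ?case by simp
next
  case (Suc n)
  show ?case
  proof (cases "[] \<in> C")
    case True
    then have "(\<Sum>v\<in>{[] :: nat list}. l ^ length v) \<le> (\<Sum>v\<in>C. l ^ length v)"
      by (intro sum_mono2) (use Suc.prems l in auto)
    then show ?thesis using theta_unit_interval[OF l, of "Suc n" f a b] by (simp del: theta.simps)
  next
    case False
    let ?C = "\<lambda>i. {v. i # v \<in> C}"
    let ?s = "steps f a b"
    have fin: "finite (?C i)" for i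
    proof -
      have "?C i = (#) i -` C" by auto
      then show ?thesis using Suc.prems(2) by (simp add: finite_vimageI)
    qed
    have th: "theta l n (part i f) x y \<le> (\<Sum>v\<in>?C i. l ^ length v)" if s: "(i, x, y) \<in> set ?s" for i x y
    proof -
      obtain z where z: "perm3 x y z" using steps_perm3[OF Suc.prems(1) s] by blast
      show ?thesis
      proof (rule Suc.IH[OF z fin])
        fix w assume "w \<in> visited n (part i f) x y"
        then have "i # w \<in> visited (Suc n) f a b" using s by force
        then obtain j where j: "take j (i # w) \<in> C" using Suc.prems(3) by blast
        then have "take (j - 1) w \<in> ?C i" using False by (cases j) auto
        then show "\<exists>j. take j w \<in> ?C i" by blast
      qed
    qed
    have "theta l (Suc n) f a b = 1 - prod_list (map (\<lambda>s. 1 - (case s of (i, x, y) \<Rightarrow> l * theta l n (part i f) x y)) ?s)"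
      by (simp add: step_prod_def case_prod_unfold)
    also have "\<dots> \<le> sum_list (map (\<lambda>s. case s of (i, x, y) \<Rightarrow> l * theta l n (part i f) x y) ?s)"
    proof (rule one_minus_prod_list_le)
      fix s assume "s \<in> set ?s"
      obtain i x y where s: "s = (i, x, y)" by (cases s)
      show "0 \<le> (case s of (i, x, y) \<Rightarrow> l * theta l n (part i f) x y) \<and>
         (case s of (i, x, y) \<Rightarrow> l * theta l n (part i f) x y) \<le> 1"
        using theta_unit_interval[OF l, of n "part i f" x y] l
          mult_le_one[of l "theta l n (part i f) x y"] unfolding s by simp
    qed
    also have "\<dots> \<le> sum_list (map (\<lambda>s. \<Sum>v\<in>?C (fst s). l ^ length (fst s # v)) ?s)"
    proof (rule sum_list_mono)
      fix s assume m: "s \<in> set ?s"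
      obtain i x y where s: "s = (i, x, y)" by (cases s)
      show "(case s of (i, x, y) \<Rightarrow> l * theta l n (part i f) x y) \<le> (\<Sum>v\<in>?C (fst s). l ^ length (fst s # v))"
        using mult_left_mono[OF th[of i x y] l(1)] m unfolding s by (simp add: sum_distrib_left)
    qed
    also have "\<dots> = (\<Sum>i\<in>fst ` set ?s. \<Sum>v\<in>?C i. l ^ length (i # v))"
    proof -
      have "sum_list (map (\<lambda>i. \<Sum>v\<in>?C i. l ^ length (i # v)) (map fst ?s)) =
          (\<Sum>i\<in>set (map fst ?s). \<Sum>v\<in>?C i. l ^ length (i # v))"
        by (rule sum_list_distinct_conv_sum_set[OF distinct_steps[OF Suc.prems(1)]])
      then show ?thesis by (simp add: o_def del: length_Cons)
    qed
    also have "\<dots> = (\<Sum>i\<in>fst ` set ?s. \<Sum>v\<in>(#) i ` ?C i. l ^ length v)"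
      by (rule sum.cong[OF refl]) (simp add: sum.reindex)
    also have "\<dots> = (\<Sum>v\<in>(\<Union>i\<in>fst ` set ?s. (#) i ` ?C i). l ^ length v)"
      by (rule sum.UNION_disjoint[symmetric]) (auto intro: fin)
    also have "\<dots> \<le> (\<Sum>v\<in>C. l ^ length v)"
      by (rule sum_mono2) (use Suc.prems l in auto)
    finally show ?thesis .
  qed
qed

section \<open>Cutting the tree path at the junctions\<close>

lemma walk_map_psi:
  assumes "walk (part i f) xs" shows "walk f (map (psi i) xs)"
  using assms unfolding walk_def part_def by auto

lemma distinct_append_tl:
  assumes "distinct xs" "distinct ys" "ys \<noteq> []" "\<And>z. z \<in> set xs \<Longrightarrow> z \<in> set ys \<Longrightarrow> z = hd ys"
  shows "distinct (xs @ tl ys)"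
proof (cases ys)
  case (Cons y zs)
  then show ?thesis using assms by auto
qed (use assms in simp)

text \<open>The crossing of one subcell, at the scale of \<open>f\<close>. Consecutive pieces share
  a junction, which \<open>tl\<close> drops when they are concatenated.\<close>

definition pieces :: "graph_edges \<Rightarrow> nat \<times> nat \<times> nat \<Rightarrow> pt list" where
  "pieces f = (\<lambda>(i, x, y). map (psi i) (tpath (u x) (part i f) (u y)))"

lemma set_append_tl: "xs \<noteq> [] \<Longrightarrow> ys \<noteq> [] \<Longrightarrow> last xs = hd ys \<Longrightarrow> set (xs @ tl ys) = set xs \<union> set ys"
  by (cases ys) auto

lemma last_append_tl: "ys \<noteq> [] \<Longrightarrow> last xs = hd ys \<Longrightarrow> last (xs @ tl ys) = last ys"
  by (cases ys) (auto simp: last_append)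

text \<open>The concatenated pieces form a self-avoiding walk with the right ends, so uniqueness
  identifies it with the tree path. Pieces from different cells can only meet in the junction of
  these cells.\<close>

lemma
  assumes f: "f \<in> forests (Suc n)" and p: "perm3 a b c" and con: "conn f (u a) (u b)"
  shows steps_conn: "\<And>i x y. (i, x, y) \<in> set (steps f a b) \<Longrightarrow> conn (part i f) (u x) (u y)"
    and tpath_direct: "pconn f a a b \<and> pconn f b a b \<Longrightarrow>
      tpath (u a) f (u b) = pieces f (a, a, b) @ tl (pieces f (b, a, b))"
    and tpath_via: "\<not> (pconn f a a b \<and> pconn f b a b) \<Longrightarrow>
      tpath (u a) f (u b) = pieces f (a, a, c) @ tl (pieces f (c, a, b) @ tl (pieces f (b, c, b)))"
proof -
  have sub: "f \<subseteq> EG (Suc n)" and ac: "acyclic_graph f" using f by (auto simp: forests_def)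
  have mem: "a \<in> idx" "b \<in> idx" "c \<in> idx" and ne: "a \<noteq> b" "a \<noteq> c" "b \<noteq> c" "b \<noteq> a" "c \<noteq> a" "c \<noteq> b"
    using p by (auto simp: perm3_def)
  have dec: "pconn f a a b \<and> pconn f b a b \<or> pconn f a a c \<and> pconn f c a b \<and> pconn f b b c"
    using conn_from_corner(1)[OF sub p] con by simp
  then have via: "pconn f a a c \<and> pconn f c a b \<and> pconn f b c b" if "\<not> (pconn f a a b \<and> pconn f b a b)"
    using that conn_sym by blast
  show "\<And>i x y. (i, x, y) \<in> set (steps f a b) \<Longrightarrow> conn (part i f) (u x) (u y)"
    using via by (auto simp: steps_eq[OF p] split: if_splits)
  have piece: "walk f (pieces f (i, x, y))" "distinct (pieces f (i, x, y))" "pieces f (i, x, y) \<noteq> []"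
      "hd (pieces f (i, x, y)) = psi i (u x)" "last (pieces f (i, x, y)) = psi i (u y)"
      "\<And>v. v \<in> set (pieces f (i, x, y)) \<Longrightarrow> \<exists>z\<in>Tri. v = psi i z \<and> conn (part i f) (u x) z"
    if i: "i \<in> idx" and x: "x \<in> idx" and y: "y \<in> idx" and c: "conn (part i f) (u x) (u y)" for i x y
  proof -
    note tp = tpath_props[OF acyclic_part[OF ac] c]
    have n: "tpath (u x) (part i f) (u y) \<noteq> []" using tp(1) by (simp add: walk_def)
    show "walk f (pieces f (i, x, y))" "pieces f (i, x, y) \<noteq> []"
      using tp(1) n by (auto simp: pieces_def intro: walk_map_psi)
    show "distinct (pieces f (i, x, y))"
      using tp(2) inj_psi[of i] by (simp add: pieces_def distinct_map inj_on_subset[OF _ subset_UNIV])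
    show "hd (pieces f (i, x, y)) = psi i (u x)" "last (pieces f (i, x, y)) = psi i (u y)"
      using tp n by (simp_all add: pieces_def hd_map last_map)
    fix v assume "v \<in> set (pieces f (i, x, y))"
    then obtain z where z: "z \<in> set (tpath (u x) (part i f) (u y))" "v = psi i z"
      by (auto simp: pieces_def)
    have E: "\<Union>(part i f) \<subseteq> VG n" using part_subset[OF sub i] Union_EG by blast
    have "z \<in> VG n" using walk_set_subset[OF tp(1) _ E] tp(3) u_in_VG[OF x] z by auto
    then show "\<exists>z\<in>Tri. v = psi i z \<and> conn (part i f) (u x) z"
      using walk_conn[OF tp(1) z(1)] tp(3) z(2) VG_subset_Tri by auto
  qed
  have meet: "v = psi i (u j) \<and> conn (part i f) (u x) (u j) \<and> conn (part j f) (u x') (u i)"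
    if "i \<in> idx" "x \<in> idx" "y \<in> idx" "conn (part i f) (u x) (u y)" "j \<in> idx" "x' \<in> idx" "y' \<in> idx"
      "conn (part j f) (u x') (u y')" "i \<noteq> j" "v \<in> set (pieces f (i, x, y))" "v \<in> set (pieces f (j, x', y'))"
    for i j x y x' y' v
  proof -
    note h = that
    obtain z where z: "z \<in> Tri" "v = psi i z" "conn (part i f) (u x) z" using piece(6)[OF h(1-4,10)] by blast
    obtain z' where z': "z' \<in> Tri" "v = psi j z'" "conn (part j f) (u x') z'" using piece(6)[OF h(5-8,11)] by blast
    have "z = u j" "z' = u i" using psi_eq_psi[OF h(1,5,9) z(1) z'(1)] z(2) z'(2) by simp_all
    then show ?thesis using z z' by simp
  qed
  show "tpath (u a) f (u b) = pieces f (a, a, b) @ tl (pieces f (b, a, b))"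
    if d: "pconn f a a b \<and> pconn f b a b"
  proof (rule tpath_eqI[OF ac])
    note A = piece[OF mem(1,1,2) conjunct1[OF d]]
    note B = piece[OF mem(2,1,2) conjunct2[OF d]]
    have e: "last (pieces f (a, a, b)) = hd (pieces f (b, a, b))" using A(5) B(4) psi_u_commute by simp
    show "walk f (pieces f (a, a, b) @ tl (pieces f (b, a, b)))"
      by (rule walk_append[OF A(1) B(1) e])
    show "distinct (pieces f (a, a, b) @ tl (pieces f (b, a, b)))"
    proof (rule distinct_append_tl[OF A(2) B(2,3)])
      fix v assume "v \<in> set (pieces f (a, a, b))" "v \<in> set (pieces f (b, a, b))"
      from meet[OF mem(1,1,2) conjunct1[OF d] mem(2,1,2) conjunct2[OF d] ne(1) this]
      show "v = hd (pieces f (b, a, b))" using B(4) psi_u_commute by simp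
    qed
    show "hd (pieces f (a, a, b) @ tl (pieces f (b, a, b))) = u a" using A(3,4) by simp
    show "last (pieces f (a, a, b) @ tl (pieces f (b, a, b))) = u b"
      using last_append_tl[OF B(3) e] B(5) by simp
  qed
  show "tpath (u a) f (u b) = pieces f (a, a, c) @ tl (pieces f (c, a, b) @ tl (pieces f (b, c, b)))"
    if nd: "\<not> (pconn f a a b \<and> pconn f b a b)"
  proof (rule tpath_eqI[OF ac])
    have K: "pconn f a a c" "pconn f c a b" "pconn f b c b" using via[OF nd] by blast+
    note A = piece[OF mem(1,1,3) K(1)]
    note C = piece[OF mem(3,1,2) K(2)]
    note B = piece[OF mem(2,3,2) K(3)]
    have e1: "last (pieces f (a, a, c)) = hd (pieces f (c, a, b))" using A(5) C(4) psi_u_commute by simp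
    have e2: "last (pieces f (c, a, b)) = hd (pieces f (b, c, b))" using C(5) B(4) psi_u_commute by simp
    let ?D = "pieces f (c, a, b) @ tl (pieces f (b, c, b))"
    have D: "walk f ?D" by (rule walk_append[OF C(1) B(1) e2])
    have hdD: "hd ?D = hd (pieces f (c, a, b))" "?D \<noteq> []" using C(3) by simp_all
    have lastD: "last ?D = u b" using last_append_tl[OF B(3) e2] B(5) by simp
    show "walk f (pieces f (a, a, c) @ tl ?D)"
      by (rule walk_append[OF A(1) D]) (simp only: e1 hdD)
    have dD: "distinct ?D"
    proof (rule distinct_append_tl[OF C(2) B(2,3)])
      fix v assume "v \<in> set (pieces f (c, a, b))" "v \<in> set (pieces f (b, c, b))"
      from meet[OF mem(3,1,2) K(2) mem(2,3,2) K(3) ne(6) this]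
      show "v = hd (pieces f (b, c, b))" using B(4) psi_u_commute by simp
    qed
    show "distinct (pieces f (a, a, c) @ tl ?D)"
    proof (rule distinct_append_tl[OF A(2) dD hdD(2)])
      fix v assume v: "v \<in> set (pieces f (a, a, c))" "v \<in> set ?D"
      have "v \<in> set (pieces f (c, a, b)) \<or> v \<in> set (pieces f (b, c, b))"
        using v(2) set_append_tl[OF C(3) B(3) e2] by blast
      then show "v = hd ?D"
      proof
        assume "v \<in> set (pieces f (c, a, b))"
        from meet[OF mem(1,1,3) K(1) mem(3,1,2) K(2) ne(2) v(1) this]
        show ?thesis using C(4) hdD psi_u_commute by simp
      next
        assume "v \<in> set (pieces f (b, c, b))"
        from meet[OF mem(1,1,3) K(1) mem(2,3,2) K(3) ne(1) v(1) this]
        \<comment> \<open>Non-consecutive pieces could only meet in the junction of \<open>a\<close>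
          and \<open>b\<close>; this would give the direct connection that the case
          excludes.\<close>
        have "pconn f a a b" "pconn f b c a" by blast+
        then have "pconn f b a b" using conn_trans[OF conn_sym K(3)] by blast
        then show ?thesis using nd \<open>pconn f a a b\<close> by blast
      qed
    qed
    show "hd (pieces f (a, a, c) @ tl ?D) = u a" using A(3,4) by simp
    show "last (pieces f (a, a, c) @ tl ?D) = u b"
      using last_append_tl[OF hdD(2)] hdD(1) e1 lastD by simp
  qed
qed

text \<open>A walk along these edges never leaves the cells of \<open>W\<close> between two
  consecutive vertices, since cells are convex.\<close>

definition cell_edges :: "nat list set \<Rightarrow> graph_edges" where
  "cell_edges W = {e. \<exists>w\<in>W. e \<subseteq> tri w}"

text \<open>Two uses: that the path stays in the visited cells yields covers for the upper bound,
  and that it meets every visited cell turns covers of the curve into cutsets for the lower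
  bound.\<close>

lemma tpath_visited:
  assumes "perm3 a b c" "f \<in> forests (k + m)" "conn f (u a) (u b)"
  shows "walk (cell_edges (visited k f a b)) (tpath (u a) f (u b)) \<and>
    (\<forall>w\<in>visited k f a b. set (tpath (u a) f (u b)) \<inter> tri w \<noteq> {})"
  using assms
proof (induction k arbitrary: f a b c)
  case 0
  have f: "f \<subseteq> EG m" "acyclic_graph f" using 0 by (auto simp: forests_def)
  note tp = tpath_props[OF f(2) 0(3)]
  have "f \<subseteq> cell_edges {[]}" using f(1) EG_subset_Tri by (fastforce simp: cell_edges_def)
  then have "walk (cell_edges {[]}) (tpath (u a) f (u b))" using tp(1) unfolding walk_def by blast
  moreover have "u a \<in> set (tpath (u a) f (u b)) \<inter> Tri"
    using tp u_in_Tri perm3_mem[OF 0(1)] by (metis IntI hd_in_set walk_def)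
  ultimately show ?case by auto
next
  case (Suc k)
  have p: "perm3 a b c" and f: "f \<in> forests (Suc (k + m))" and con: "conn f (u a) (u b)"
    using Suc.prems by simp_all
  let ?W = "visited (Suc k) f a b"
  have ac: "acyclic_graph f" using f by (simp add: forests_def)
  have st: "walk (cell_edges ?W) (pieces f (i, x, y)) \<and>
      (\<forall>w\<in>visited k (part i f) x y. set (pieces f (i, x, y)) \<inter> tri (i # w) \<noteq> {}) \<and>
      pieces f (i, x, y) \<noteq> [] \<and> hd (pieces f (i, x, y)) = psi i (u x) \<and> last (pieces f (i, x, y)) = psi i (u y)"
    if s: "(i, x, y) \<in> set (steps f a b)" for i x y
  proof -
    obtain z where i: "i \<in> idx" and z: "perm3 x y z" using steps_perm3[OF p s] by blast
    have c: "conn (part i f) (u x) (u y)" using steps_conn[OF f p con s] .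
    note IH = Suc.IH[OF z part_in_forests[OF f i] c]
    note tp = tpath_props[OF acyclic_part[OF ac] c]
    have n: "tpath (u x) (part i f) (u y) \<noteq> []" using tp(1) by (simp add: walk_def)
    have up: "psi i ` e \<in> cell_edges ?W" if "e \<in> cell_edges (visited k (part i f) x y)" for e
    proof -
      have "\<exists>w\<in>visited k (part i f) x y. e \<subseteq> tri w" using that by (simp add: cell_edges_def)
      then obtain w where "w \<in> visited k (part i f) x y" "e \<subseteq> tri w" by blast
      then have "i # w \<in> ?W" "psi i ` e \<subseteq> tri (i # w)" using s by (force, auto)
      then show ?thesis unfolding cell_edges_def by blast
    qed
    have "walk (cell_edges ?W) (pieces f (i, x, y))"
      unfolding walk_def
    proof (intro conjI allI impI)
      show "pieces f (i, x, y) \<noteq> []" using n by (simp add: pieces_def)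
      fix j assume j: "Suc j < length (pieces f (i, x, y))"
      let ?t = "tpath (u x) (part i f) (u y)"
      have j': "Suc j < length ?t" using j by (simp add: pieces_def)
      then have "{?t ! j, ?t ! Suc j} \<in> cell_edges (visited k (part i f) x y)"
        using IH unfolding walk_def by blast
      from up[OF this] show "{pieces f (i, x, y) ! j, pieces f (i, x, y) ! Suc j} \<in> cell_edges ?W"
        using j' by (simp add: pieces_def)
    qed
    moreover have "\<forall>w\<in>visited k (part i f) x y. set (pieces f (i, x, y)) \<inter> tri (i # w) \<noteq> {}"
      using IH unfolding pieces_def by (fastforce simp: image_iff)
    ultimately show ?thesis using tp n by (simp add: pieces_def hd_map last_map)
  qed
  have mem: "w \<in> ?W \<Longrightarrow> \<exists>i x y v. (i, x, y) \<in> set (steps f a b) \<and> v \<in> visited k (part i f) x y \<and> w = i # v" for w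
    by auto
  show ?case
  proof (cases "pconn f a a b \<and> pconn f b a b")
    case True
    then have s: "steps f a b = [(a, a, b), (b, a, b)]" by (simp add: steps_eq[OF p])
    have A: "(a, a, b) \<in> set (steps f a b)" and B: "(b, a, b) \<in> set (steps f a b)" by (simp_all add: s)
    note A' = st[OF A] and B' = st[OF B]
    have e: "last (pieces f (a, a, b)) = hd (pieces f (b, a, b))" using A' B' psi_u_commute by simp
    have t: "tpath (u a) f (u b) = pieces f (a, a, b) @ tl (pieces f (b, a, b))"
      by (rule tpath_direct[OF f p con True])
    have set: "set (tpath (u a) f (u b)) = set (pieces f (a, a, b)) \<union> set (pieces f (b, a, b))"
      unfolding t using A' B' e set_append_tl by blast
    have "walk (cell_edges ?W) (tpath (u a) f (u b))"
      unfolding t using A' B' e walk_append by blast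
    moreover have "set (tpath (u a) f (u b)) \<inter> tri w \<noteq> {}" if w: "w \<in> ?W" for w
    proof -
      obtain i x y v where v: "(i, x, y) \<in> set (steps f a b)" "v \<in> visited k (part i f) x y" "w = i # v"
        using mem[OF w] by blast
      then have "set (pieces f (i, x, y)) \<inter> tri w \<noteq> {}" using st by blast
      moreover have "set (pieces f (i, x, y)) \<subseteq> set (tpath (u a) f (u b))"
        using v(1) unfolding set s by auto
      ultimately show ?thesis by blast
    qed
    ultimately show ?thesis by blast
  next
    case False
    then have s: "steps f a b = [(a, a, c), (c, a, b), (b, c, b)]" using steps_eq[OF p] by simp
    have A: "(a, a, c) \<in> set (steps f a b)" and C: "(c, a, b) \<in> set (steps f a b)"
      and B: "(b, c, b) \<in> set (steps f a b)" by (simp_all add: s)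
    note A' = st[OF A] and B' = st[OF B] and C' = st[OF C]
    have e1: "last (pieces f (a, a, c)) = hd (pieces f (c, a, b))" using A' C' psi_u_commute by simp
    have e2: "last (pieces f (c, a, b)) = hd (pieces f (b, c, b))" using C' B' psi_u_commute by simp
    let ?D = "pieces f (c, a, b) @ tl (pieces f (b, c, b))"
    have t: "tpath (u a) f (u b) = pieces f (a, a, c) @ tl ?D"
      by (rule tpath_via[OF f p con False])
    have D: "walk (cell_edges ?W) ?D" using C' B' e2 walk_append by blast
    have setD: "set ?D = set (pieces f (c, a, b)) \<union> set (pieces f (b, c, b))"
      using C' B' e2 set_append_tl by blast
    have nC: "pieces f (c, a, b) \<noteq> []" using C' by blast
    then have e3: "last (pieces f (a, a, c)) = hd ?D" and nD: "?D \<noteq> []" using e1 by simp_all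
    have set: "set (tpath (u a) f (u b)) = set (pieces f (a, a, c)) \<union> set ?D"
      unfolding t using A' nD e3 set_append_tl by blast
    have "walk (cell_edges ?W) (tpath (u a) f (u b))"
      unfolding t using A' D e3 walk_append by blast
    moreover have "set (tpath (u a) f (u b)) \<inter> tri w \<noteq> {}" if w: "w \<in> ?W" for w
    proof -
      obtain i x y v where v: "(i, x, y) \<in> set (steps f a b)" "v \<in> visited k (part i f) x y" "w = i # v"
        using mem[OF w] by blast
      then have "set (pieces f (i, x, y)) \<inter> tri w \<noteq> {}" using st by blast
      moreover have "set (pieces f (i, x, y)) \<subseteq> set (tpath (u a) f (u b))"
        using v(1) unfolding set setD s by auto
      ultimately show ?thesis by blast
    qed
    ultimately show ?thesis by blast
  qed
qed

subsection \<open>Cells and linear interpolation\<close>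

lemma bary_affine: "bary i (s *\<^sub>R x + t *\<^sub>R y) = s * bary i x + t * bary i y" if "s + t = 1"
proof -
  have t: "t = 1 - s" using that by simp
  show ?thesis unfolding t by (simp add: bary_def algebra_simps add_divide_distrib diff_divide_distrib)
qed

lemma convex_Tri: "convex Tri"
  unfolding convex_def Tri_def
  by (auto simp: bary_affine intro!: add_nonneg_nonneg mult_nonneg_nonneg)

lemma psi_affine: "psi i (s *\<^sub>R x + t *\<^sub>R y) = s *\<^sub>R psi i x + t *\<^sub>R psi i y" if "s + t = 1"
proof -
  have t: "t = 1 - s" using that by simp
  show ?thesis unfolding t psi_def by (simp add: prod_eq_iff field_simps)
qed

lemma psiw_affine: "s + t = 1 \<Longrightarrow> psiw w (s *\<^sub>R x + t *\<^sub>R y) = s *\<^sub>R psiw w x + t *\<^sub>R psiw w y"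
  by (induction w) (auto simp: psi_affine)

lemma convex_psiw_Tri: "convex (tri w)"
  unfolding convex_def
proof (intro ballI allI impI)
  fix x y and s t :: real
  assume "x \<in> tri w" "y \<in> tri w" and st: "0 \<le> s" "0 \<le> t" "s + t = 1"
  then obtain x' y' where "x' \<in> Tri" "x = psiw w x'" "y' \<in> Tri" "y = psiw w y'" by blast
  moreover from this have "s *\<^sub>R x' + t *\<^sub>R y' \<in> Tri" using convex_Tri st by (auto simp: convex_def)
  ultimately show "s *\<^sub>R x + t *\<^sub>R y \<in> tri w"
    using psiw_affine[OF st(3), of w x' y'] by (metis imageI)
qed

lemma psiw_append: "psiw (v @ w) x = psiw v (psiw w x)"
  by (induction v) auto

lemma psiw_Tri_subset: "set w \<subseteq> idx \<Longrightarrow> tri w \<subseteq> Tri"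
proof (induction w)
  case (Cons i w)
  then have "psi i ` tri w \<subseteq> psi i ` Tri" by (intro image_mono) simp
  also have "\<dots> \<subseteq> Tri" using Cons psi_Tri by auto
  finally show ?case by (simp add: image_comp)
qed simp

lemma psiw_take_Tri:
  assumes "set w \<subseteq> idx"
  shows "tri w \<subseteq> tri (take k w)"
proof -
  have "tri w = psiw (take k w) ` psiw (drop k w) ` Tri"
    using psiw_append[of "take k w" "drop k w"] by (simp add: image_comp o_def)
  also have "\<dots> \<subseteq> tri (take k w)"
    using assms set_drop_subset[of k w] by (intro image_mono psiw_Tri_subset) blast
  finally show ?thesis .
qed

lemma dist_psiw: "dist (psiw w x) (psiw w y) = dist x y / 2 ^ length w"
proof (induction w)
  case (Cons i w)
  have h: "dist (psi i v) (psi i z) = dist v z / 2" for v z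
  proof -
    have "psi i v - psi i z = (1/2) *\<^sub>R (v - z)" by (simp add: psi_def algebra_simps)
    then show ?thesis by (simp add: dist_norm)
  qed
  show ?case unfolding psiw.simps o_apply h Cons by simp
qed simp

lemma dist_Tri:
  assumes "x \<in> Tri" "y \<in> Tri"
  shows "dist x y \<le> 2"
proof -
  have r3: "0 < sqrt 3" "sqrt 3 \<le> 2" by (auto intro: real_le_lsqrt)
  have b: "0 \<le> fst z \<and> fst z \<le> 1 \<and> 0 \<le> snd z \<and> snd z \<le> 1" if "z \<in> Tri" for z
  proof -
    have p: "0 \<le> bary 1 z" "0 \<le> bary 2 z" "0 \<le> bary 3 z" using that by (auto simp: Tri_def idx_def)
    define q where "q = snd z / sqrt 3"
    have s: "snd z = q * sqrt 3" using r3 by (simp add: q_def)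
    have q: "0 \<le> 1 - fst z - q" "0 \<le> fst z - q" "0 \<le> 2 * q" using p by (simp_all add: bary_def q_def)
    then have "q * sqrt 3 \<le> (1/2) * 2" using r3 by (intro mult_mono) auto
    then show ?thesis using q r3 s by auto
  qed
  have "dist x y = sqrt ((fst x - fst y)\<^sup>2 + (snd x - snd y)\<^sup>2)"
    by (simp add: dist_prod_def dist_real_def)
  also have "\<dots> \<le> \<bar>fst x - fst y\<bar> + \<bar>snd x - snd y\<bar>" by (rule sqrt_sum_squares_le_sum_abs)
  also have "\<dots> \<le> 2" using b[OF assms(1)] b[OF assms(2)] by linarith
  finally show ?thesis .
qed

lemma LI_in_cells:
  assumes w: "walk (cell_edges W) xs" "2 \<le> length xs" and t: "0 \<le> t"
  shows "LI xs t \<in> (\<Union>w\<in>W. tri w)"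
proof (cases "t \<ge> ereal (real (length xs - 1))")
  case True
  \<comment> \<open>From the final time on, the curve rests at the last vertex, which the last edge
    places in a cell; this edge exists because there are at least two vertices.\<close>
  let ?j = "length xs - 2"
  have "{xs ! ?j, xs ! Suc ?j} \<in> cell_edges W"
    using w unfolding walk_def by auto
  moreover have "xs ! Suc ?j = last xs"
  proof -
    have "Suc ?j = length xs - 1" "xs \<noteq> []" using w(2) by auto
    then show ?thesis by (simp add: last_conv_nth)
  qed
  ultimately show ?thesis using True unfolding LI_def cell_edges_def by auto
next
  case False
  then obtain s where s: "t = ereal s" "0 \<le> s" "s < real (length xs - 1)"
    using t by (cases t) auto
  define k where "k = nat \<lfloor>s\<rfloor>"
  have k: "real k \<le> s" "s < real k + 1" using s by (auto simp: k_def)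
  have kl: "Suc k < length xs" using k s by linarith
  have "{xs ! k, xs ! Suc k} \<in> cell_edges W" using w(1) kl unfolding walk_def by blast
  then obtain v where v: "v \<in> W" "xs ! k \<in> tri v" "xs ! Suc k \<in> tri v"
    unfolding cell_edges_def by blast
  have "LI xs t = (real k + 1 - s) *\<^sub>R (xs ! k) + (s - real k) *\<^sub>R (xs ! Suc k)"
    using False by (simp add: LI_def s k_def Let_def)
  also have "\<dots> \<in> tri v"
    by (rule convexD[OF convex_psiw_Tri v(2,3)]) (use k in auto)
  finally show ?thesis using v by blast
qed

lemma LI_vertex:
  assumes "v \<in> set xs"
  obtains j :: nat where "LI xs (ereal j) = v"
proof -
  obtain j where j: "j < length xs" "xs ! j = v" using assms by (auto simp: in_set_conv_nth)
  have "LI xs (ereal (real j)) = v"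
  proof (cases "j = length xs - 1")
    case True
    have "xs \<noteq> []" using j by auto
    then show ?thesis using j True by (simp add: LI_def last_conv_nth)
  next
    case False
    then have "j < length xs - 1" using j by linarith
    then have "\<not> ereal (real j) \<ge> ereal (real (length xs - 1))" by simp
    then show ?thesis unfolding LI_def using j by (simp only: if_False) (simp add: Let_def)
  qed
  then show thesis by (rule that)
qed

text \<open>The interpolation as a sum of clamped increments. It avoids the floor function and cuts
  time off at the last vertex, which makes continuity visible at infinity as well.\<close>

lemma LI_eq_sum:
  assumes "xs \<noteq> []" "0 \<le> t"
  defines "s \<equiv> real_of_ereal (min t (ereal (real (length xs - 1))))"
  shows "LI xs t = xs ! 0 + (\<Sum>k<length xs - 1. min 1 (max 0 (s - real k)) *\<^sub>R (xs ! Suc k - xs ! k))"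
proof (cases "t \<ge> ereal (real (length xs - 1))")
  case True
  then have s: "s = real (length xs - 1)" by (simp add: s_def min_def)
  have "(\<Sum>k<length xs - 1. min 1 (max 0 (s - real k)) *\<^sub>R (xs ! Suc k - xs ! k)) =
      (\<Sum>k<length xs - 1. xs ! Suc k - xs ! k)"
    by (rule sum.cong) (auto simp: s min_def max_def)
  also have "\<dots> = xs ! (length xs - 1) - xs ! 0" by (rule sum_lessThan_telescope)
  finally show ?thesis using True assms(1) by (simp add: LI_def last_conv_nth)
next
  case False
  then obtain r where r: "t = ereal r" "0 \<le> r" "r < real (length xs - 1)"
    using assms(2) by (cases t) auto
  have s: "s = r" using r by (simp add: s_def min_def)
  define k where "k = nat \<lfloor>r\<rfloor>"
  have k: "real k \<le> r" "r < real k + 1" using r by (auto simp: k_def)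
  have kl: "k < length xs - 1" using k r by linarith
  let ?f = "\<lambda>j. min 1 (max 0 (s - real j)) *\<^sub>R (xs ! Suc j - xs ! j)"
  have "sum ?f {..<length xs - 1} = sum ?f {..<Suc k}"
    by (rule sum.mono_neutral_right) (use kl k s in \<open>auto simp: max_def\<close>)
  also have "\<dots> = sum ?f {..<k} + ?f k" by simp
  also have "sum ?f {..<k} = (\<Sum>j<k. xs ! Suc j - xs ! j)"
    by (rule sum.cong) (use k s in \<open>auto simp: max_def min_def\<close>)
  also have "\<dots> = xs ! k - xs ! 0" by (rule sum_lessThan_telescope)
  also have "?f k = (r - real k) *\<^sub>R (xs ! Suc k - xs ! k)" using k s by (simp add: max_def min_def)
  finally have "xs ! 0 + sum ?f {..<length xs - 1} = xs ! k + (r - real k) *\<^sub>R (xs ! Suc k - xs ! k)" by simp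
  also have "\<dots> = (real k + 1 - r) *\<^sub>R (xs ! k) + (r - real k) *\<^sub>R (xs ! Suc k)"
    by (simp add: prod_eq_iff algebra_simps)
  also have "\<dots> = LI xs t" using False by (simp add: LI_def r k_def Let_def)
  finally show ?thesis by simp
qed

lemma continuous_on_LI:
  assumes "xs \<noteq> []"
  shows "continuous_on {0..} (LI xs)"
proof -
  let ?r = "ereal (real (length xs - 1))"
  have "continuous_on {0..} (\<lambda>t. real_of_ereal (min t ?r))"
  proof (rule continuous_on_compose2[OF continuous_on_real])
    show "continuous_on {0..} (\<lambda>t. min t ?r)" by (intro continuous_intros)
    show "(\<lambda>t. min t ?r) ` {0..} \<subseteq> UNIV - {\<infinity>, - \<infinity>}" by (auto simp: min_def split: if_splits)
  qed
  then have "continuous_on {0..} (\<lambda>t. xs ! 0 + (\<Sum>k<length xs - 1.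
      min 1 (max 0 (real_of_ereal (min t ?r) - real k)) *\<^sub>R (xs ! Suc k - xs ! k)))"
    by (intro continuous_intros)
  then show ?thesis
    by (rule continuous_on_eq) (use LI_eq_sum[OF assms] in simp)
qed

lemma alpha_bar_pos: "0 < alpha_bar"
  using alpha_bar_bounds by simp

lemma continuous_on_Xn:
  assumes "tpath (u 1) t (u 2) \<noteq> []"
  shows "continuous_on {0..\<infinity>} (Xn n t)"
  unfolding Xn_def
proof (rule continuous_on_compose2[OF continuous_on_LI[OF assms]])
  show "continuous_on {0..\<infinity>} (\<lambda>s. ereal (alpha_bar ^ n) * s)"
    by (intro continuous_on_cmult_ereal continuous_on_id) simp
  show "(\<lambda>s. ereal (alpha_bar ^ n) * s) ` {0..\<infinity>} \<subseteq> {0..}"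
    using alpha_bar_pos by auto
qed

text \<open>The extended time interval is compact because it includes infinity, and uniform limits
  preserve continuity.\<close>

lemma compact_limit_curve:
  fixes X :: "ereal \<Rightarrow> pt"
  assumes "uniform_limit {0..\<infinity>} f X sequentially" "\<And>n. continuous_on {0..\<infinity>} (f n)"
  shows "compact (X ` {0..\<infinity>})"
proof -
  have "compact {0..\<infinity>::ereal}" by (simp add: compact_eq_closed)
  moreover have "continuous_on {0..\<infinity>} X"
    by (rule uniform_limit_theorem[OF _ assms(1)]) (use assms(2) in auto)
  ultimately show ?thesis by (rule compact_continuous_image[rotated])
qed


section \<open>Few cells of one level near a point\<close>

text \<open>Integer positions of the cells of level \<open>length w\<close> in the triangular lattice.\<close>
primrec cpos :: "nat \<Rightarrow> nat list \<Rightarrow> nat" where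
  "cpos j [] = 0"
| "cpos j (i # w) = cpos j w + (if i = j then 2 ^ length w else 0)"

lemma bary_psiw:
  assumes "set w \<subseteq> idx" "j \<in> idx"
  shows "2 ^ length w * bary j (psiw w z) = bary j z + real (cpos j w)"
  using assms
proof (induction w)
  case (Cons i w)
  then have "2 ^ length (i # w) * bary j (psiw (i # w) z) =
      2 ^ length w * bary j (psiw w z) + 2 ^ length w * (if j = i then 1 else 0)"
    by (simp add: bary_psi algebra_simps)
  also have "2 ^ length w * bary j (psiw w z) = bary j z + real (cpos j w)"
    using Cons by simp
  finally show ?case by simp
qed simp

lemma cpos_less: "cpos j w < 2 ^ length w"
  by (induction w) auto

text \<open>The binary digits of \<open>cpos j w\<close> mark the positions at which
  \<open>w\<close> has the letter \<open>j\<close>, the first letter giving the top digit. Knowing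
  where 2 and 3 stand determines a word over three letters.\<close>

lemma cpos_inj:
  assumes "v \<in> words k" "w \<in> words k" "cpos 2 v = cpos 2 w" "cpos 3 v = cpos 3 w"
  shows "v = w"
  using assms
proof (induction k arbitrary: v w)
  case (Suc k)
  obtain i v' where v: "v = i # v'" "v' \<in> words k" "i \<in> idx"
    using Suc.prems(1) by (cases v) (auto simp: words_def)
  obtain j w' where w: "w = j # w'" "w' \<in> words k" "j \<in> idx"
    using Suc.prems(2) by (cases w) (auto simp: words_def)
  have len: "length v' = k" "length w' = k" using v w by (auto simp: words_def)
  have iff: "i = l \<longleftrightarrow> 2 ^ k \<le> cpos l v" "j = l \<longleftrightarrow> 2 ^ k \<le> cpos l w" for l
    using cpos_less[of l v'] cpos_less[of l w'] len by (auto simp: v w)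
  have "i = 2 \<longleftrightarrow> j = 2" "i = 3 \<longleftrightarrow> j = 3" using Suc.prems iff by simp_all
  then have "i = j" using v(3) w(3) by (auto simp: idx_def)
  moreover from this have "cpos 2 v' = cpos 2 w'" "cpos 3 v' = cpos 3 w'"
    using Suc.prems len by (auto simp: v w split: if_splits)
  ultimately show ?case using Suc.IH[OF v(2) w(2)] v w by simp
qed (simp add: words_def)

lemma bary_Lipschitz:
  assumes "j = 2 \<or> j = 3"
  shows "\<bar>bary j x - bary j y\<bar> \<le> 2 * dist x y"
proof -
  have r3: "1 \<le> sqrt 3" by simp
  have f: "\<bar>fst x - fst y\<bar> \<le> dist x y" using dist_fst_le[of x y] by (simp add: dist_real_def)
  have s: "\<bar>snd x - snd y\<bar> \<le> dist x y" using dist_snd_le[of x y] by (simp add: dist_real_def)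
  have "\<bar>snd x - snd y\<bar> / sqrt 3 \<le> dist x y / 1" using s r3 by (intro frac_le) auto
  then have q: "\<bar>(snd x - snd y) / sqrt 3\<bar> \<le> dist x y" by simp
  have "bary 2 x - bary 2 y = (fst x - fst y) - (snd x - snd y) / sqrt 3"
    by (simp add: bary_def diff_divide_distrib)
  then have "\<bar>bary 2 x - bary 2 y\<bar> \<le> 2 * dist x y" using f q by linarith
  moreover have "bary 3 x - bary 3 y = 2 * ((snd x - snd y) / sqrt 3)"
    by (simp add: bary_def diff_divide_distrib)
  then have "\<bar>bary 3 x - bary 3 y\<bar> \<le> 2 * dist x y" using q by linarith
  ultimately show ?thesis using assms by blast
qed

lemma finite_words: "finite (words k)"
  by (rule finite_subset[of _ "{w. set w \<subseteq> idx \<and> length w = k}"])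
    (auto simp: words_def intro: finite_lists_length_eq)

lemma card_near_cells:
  "card {w \<in> words k. tri w \<inter> ball x (2 / 2 ^ k) \<noteq> {}} \<le> 100" (is "card ?N \<le> 100")
proof -
  \<comment> \<open>Rescaled by \<open>2 ^ k\<close>, the coordinates of \<open>x\<close> and of a
    nearby point of the cell differ by at most \<open>2 * 2 = 4\<close>. The coordinate within the
    cell lies between 0 and 1 and costs one more below, so at most ten integers remain for each
    coordinate.\<close>
  define I where "I j = {\<lceil>2 ^ k * bary j x - 5\<rceil> .. \<lfloor>2 ^ k * bary j x + 4\<rfloor>}" for j
  have cI: "card (I j) \<le> 10" for j unfolding I_def by (simp, linarith)
  have "int (cpos j w) \<in> I j" if w: "w \<in> ?N" and j: "j = 2 \<or> j = 3" for w j
  proof -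
    have wk: "length w = k" "set w \<subseteq> idx" using w by (auto simp: words_def)
    have ji: "j \<in> idx" using j by (auto simp: idx_def)
    obtain z where z: "z \<in> Tri" "dist x (psiw w z) < 2 / 2 ^ k" using w by auto
    have "0 \<le> bary i z" if "i \<in> idx" for i using z that by (auto simp: Tri_def)
    from this[of 1] this[of 2] this[of 3] have b: "0 \<le> bary j z" "bary j z \<le> 1"
      using bary_sum[of z] j by (auto simp: idx_def)
    have "\<bar>2 ^ k * (bary j x - bary j (psiw w z))\<bar> = 2 ^ k * \<bar>bary j x - bary j (psiw w z)\<bar>"
      by (simp add: abs_mult)
    also have "\<dots> \<le> 2 ^ k * (2 * (2 / 2 ^ k))"
      using bary_Lipschitz[OF j, of x "psiw w z"] z(2) by (intro mult_left_mono) auto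
    also have "\<dots> = 4" by simp
    finally have "\<bar>2 ^ k * bary j x - (bary j z + real (cpos j w))\<bar> \<le> 4"
      using bary_psiw[OF wk(2) ji, of z] wk(1) by (simp add: algebra_simps)
    then have "2 ^ k * bary j x - 5 \<le> real_of_int (int (cpos j w))"
      "real_of_int (int (cpos j w)) \<le> 2 ^ k * bary j x + 4"
      using b by (simp_all add: abs_le_iff)
    then show ?thesis unfolding I_def atLeastAtMost_iff ceiling_le_iff le_floor_iff by blast
  qed
  then have "(\<lambda>w. (int (cpos 2 w), int (cpos 3 w))) ` ?N \<subseteq> I 2 \<times> I 3" by blast
  moreover have "inj_on (\<lambda>w. (int (cpos 2 w), int (cpos 3 w))) ?N"
    by (rule inj_onI) (auto intro: cpos_inj)
  ultimately have "card ?N \<le> card (I 2 \<times> I 3)"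
    by (intro card_inj_on_le) (auto simp: I_def)
  also have "\<dots> \<le> 10 * 10" unfolding card_cartesian_product by (intro mult_le_mono cI)
  finally show ?thesis by simp
qed

subsection \<open>Hausdorff measure\<close>

text \<open>For \<open>d > 0\<close> the level with \<open>d <= 1 / 2 ^ k < 2 * d\<close> works. A
  set of diameter 0 has no finest level, and the slack \<open>e\<close> pays for a sufficiently deep
  one.\<close>

lemma exists_level:
  fixes d s e :: real
  assumes d: "0 \<le> d" "d \<le> 1" and s: "0 < s" and e: "0 < e"
  shows "\<exists>k. d < 2 / 2 ^ k \<and> (2 powr - s) ^ k \<le> 2 powr s * d powr s + e"
proof (cases "d = 0")
  case True
  have "2 powr - s < (1 :: real)" using powr_less_mono[of "-s" 0 2] s by simp
  then obtain k where "(2 powr - s) ^ k < e" using real_arch_pow_inv[OF e] by blast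
  then show ?thesis using True by (intro exI[of _ k]) auto
next
  case False
  then have dp: "0 < d" using d by simp
  define k where "k = nat \<lfloor>log 2 (1 / d)\<rfloor>"
  have l0: "0 \<le> log 2 (1 / d)" using d dp by simp
  have k: "real k \<le> log 2 (1 / d)" "log 2 (1 / d) < real k + 1" using l0 by (auto simp: k_def)
  have "2 powr real k \<le> 1 / d" using k(1) dp by (simp add: le_log_iff)
  then have p: "d \<le> 1 / 2 ^ k" using dp by (simp add: powr_realpow field_simps)
  have "1 / d < 2 powr (real k + 1)" using k(2) dp by (simp add: log_less_iff)
  then have q: "1 / 2 ^ k < 2 * d" using dp by (simp add: powr_add powr_realpow field_simps)
  have "(2 powr - s) ^ k = (1 / 2 ^ k) powr s"
    by (simp add: powr_realpow[symmetric] powr_powr powr_minus_divide[symmetric] powr_divide mult.commute)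
  also have "\<dots> \<le> (2 * d) powr s" using q s by (intro powr_mono2) auto
  also have "\<dots> = 2 powr s * d powr s" using dp by (simp add: powr_mult)
  finally have "(2 powr - s) ^ k \<le> 2 powr s * d powr s + e" using e by simp
  moreover have "d < 2 / 2 ^ k" using p by (rule order.strict_trans1) (simp add: divide_strict_right_mono)
  ultimately show ?thesis by blast
qed

text \<open>Each covering set lies in an open ball of dyadic radius about any of its points, and
  compactness leaves finitely many balls. This reduces positivity to finite covers by such
  balls.\<close>

lemma hausdorff_delta_pos:
  fixes A :: "'a::metric_space set"
  assumes A: "compact A" and s: "0 < s" and \<kappa>: "0 < \<kappa>"
    and cov: "\<And>(I :: nat set) c k. finite I \<Longrightarrow> A \<subseteq> (\<Union>i\<in>I. ball (c i) (2 / 2 ^ k i)) \<Longrightarrow>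
      \<kappa> \<le> (\<Sum>i\<in>I. (2 powr - s) ^ k i)"
  shows "0 < hausdorff_delta s 1 A"
proof -
  define b where "b = \<kappa> / 2 / 2 powr s"
  have b: "0 < b" using \<kappa> by (simp add: b_def)
  have "ennreal b \<le> (\<Sum>i. ennreal (diameter (U i) powr s))"
    if U: "A \<subseteq> (\<Union>i. U i)" "\<And>i. bounded (U i) \<and> diameter (U i) \<le> 1" for U :: "nat \<Rightarrow> 'a set"
  proof -
    have d0: "0 \<le> diameter (U i)" for i using diameter_ge_0 U(2) by blast
    \<comment> \<open>The slacks sum to at most \<open>\<kappa> / 2\<close>, so half of
      \<open>\<kappa>\<close> remains for the diameters.\<close>
    have "\<exists>k. diameter (U i) < 2 / 2 ^ k \<and>
        (2 powr - s) ^ k \<le> 2 powr s * diameter (U i) powr s + \<kappa> / 2 * (1 / 2) ^ Suc i" for i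
      by (rule exists_level) (use d0 U(2) s \<kappa> in auto)
    then obtain k where k: "\<And>i. diameter (U i) < 2 / 2 ^ k i"
      "\<And>i. (2 powr - s) ^ k i \<le> 2 powr s * diameter (U i) powr s + \<kappa> / 2 * (1 / 2) ^ Suc i"
      by metis
    define c where "c i = (SOME x. x \<in> U i)" for i
    have sub: "U i \<subseteq> ball (c i) (2 / 2 ^ k i)" for i
    proof
      fix x assume x: "x \<in> U i"
      then have "c i \<in> U i" unfolding c_def by (rule someI)
      then have "dist (c i) x \<le> diameter (U i)" using U(2) x by (intro diameter_bounded_bound) auto
      then show "x \<in> ball (c i) (2 / 2 ^ k i)" using k(1)[of i] by simp
    qed
    have "(\<Union>i. U i) \<subseteq> (\<Union>i\<in>UNIV. ball (c i) (2 / 2 ^ k i))"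
      by (rule UN_mono) (use sub in simp_all)
    with U(1) have AU: "A \<subseteq> (\<Union>i\<in>UNIV. ball (c i) (2 / 2 ^ k i))" by (rule subset_trans)
    obtain I where I: "finite I" "A \<subseteq> (\<Union>i\<in>I. ball (c i) (2 / 2 ^ k i))"
      by (rule compactE_image[OF A open_ball AU])
    have "\<kappa> \<le> (\<Sum>i\<in>I. (2 powr - s) ^ k i)" by (rule cov[OF I])
    also have "\<dots> \<le> (\<Sum>i\<in>I. 2 powr s * diameter (U i) powr s + \<kappa> / 2 * (1 / 2) ^ Suc i)"
      by (rule sum_mono) (rule k(2))
    also have "\<dots> = 2 powr s * (\<Sum>i\<in>I. diameter (U i) powr s) + \<kappa> / 2 * (\<Sum>i\<in>I. (1 / 2) ^ Suc i)"
      by (simp add: sum.distrib sum_distrib_left)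
    also have "(\<Sum>i\<in>I. (1 / 2 :: real) ^ Suc i) \<le> (\<Sum>i. (1 / 2) ^ Suc i)"
      by (rule sum_le_suminf[OF _ I(1)]) (use power_half_series in \<open>auto simp: sums_iff\<close>)
    also have "(\<Sum>i. (1 / 2 :: real) ^ Suc i) = 1" using power_half_series by (simp add: sums_iff)
    finally have "\<kappa> / 2 \<le> 2 powr s * (\<Sum>i\<in>I. diameter (U i) powr s)" using \<kappa> by simp
    then have "b \<le> (\<Sum>i\<in>I. diameter (U i) powr s)" by (simp add: b_def field_simps)
    then have "ennreal b \<le> ennreal (\<Sum>i\<in>I. diameter (U i) powr s)" by (rule ennreal_leI)
    also have "\<dots> = (\<Sum>i\<in>I. ennreal (diameter (U i) powr s))" by (simp add: sum_ennreal)
    also have "\<dots> \<le> (\<Sum>i. ennreal (diameter (U i) powr s))"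
      by (rule sum_le_suminf[OF _ I(1)]) auto
    finally show ?thesis .
  qed
  then have "ennreal b \<le> hausdorff_delta s 1 A"
    unfolding hausdorff_delta_def by (intro INF_greatest) blast
  then show ?thesis using b by (meson ennreal_less_zero_iff less_le_trans)
qed

text \<open>At scale 1 all diameters are at most 1, so their powers decrease in the exponent;
  diameter 0 contributes 0 for every exponent.\<close>

lemma hausdorff_delta_antimono:
  assumes "s \<le> t"
  shows "hausdorff_delta t 1 A \<le> hausdorff_delta s 1 A"
  unfolding hausdorff_delta_def
proof (rule INF_mono)
  fix U :: "nat \<Rightarrow> 'a set" assume U: "U \<in> {U. A \<subseteq> (\<Union>i. U i) \<and> (\<forall>i. bounded (U i) \<and> diameter (U i) \<le> 1)}"
  have "diameter (U i) powr t \<le> diameter (U i) powr s" for i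
  proof (cases "diameter (U i) = 0")
    case False
    moreover have "0 \<le> diameter (U i)" using U diameter_ge_0 by blast
    ultimately show ?thesis using U assms by (intro powr_mono') auto
  qed simp
  then have "(\<Sum>i. ennreal (diameter (U i) powr t)) \<le> (\<Sum>i. ennreal (diameter (U i) powr s))"
    by (intro suminf_le) (auto intro: ennreal_leI)
  then show "\<exists>V\<in>{U. A \<subseteq> (\<Union>i. U i) \<and> (\<forall>i. bounded (U i) \<and> diameter (U i) \<le> 1)}.
      (\<Sum>i. ennreal (diameter (V i) powr t)) \<le> (\<Sum>i. ennreal (diameter (U i) powr s))"
    using U by blast
qed

lemma hausdorff_delta_le_finite_cover:
  fixes A :: "'a::metric_space set"
  assumes W: "finite W" and cov: "A \<subseteq> (\<Union>w\<in>W. D w)" and D: "\<And>w. w \<in> W \<Longrightarrow> bounded (D w)"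
    "\<And>w. w \<in> W \<Longrightarrow> diameter (D w) \<le> r" and r: "0 \<le> r" "r \<le> \<delta>" and s: "0 \<le> s"
  shows "hausdorff_delta s \<delta> A \<le> ennreal (real (card W) * r powr s)"
proof -
  obtain g :: "nat \<Rightarrow> 'b" where g: "bij_betw g {..<card W} W"
    using ex_bij_betw_nat_finite[OF W] by (auto simp: atLeast0LessThan)
  \<comment> \<open>The finite cover is padded with empty sets, which cost nothing because
    \<open>0 powr s = 0\<close>, also for \<open>s = 0\<close>.\<close>
  define U where "U i = (if i < card W then D (g i) else {})" for i
  have gW: "i < card W \<Longrightarrow> g i \<in> W" for i using g by (auto simp: bij_betw_def)
  have "W = g ` {..<card W}" using g by (simp add: bij_betw_def)
  then have "A \<subseteq> (\<Union>i\<in>{..<card W}. D (g i))" using cov by (metis SUP_image o_apply image_image)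
  then have "A \<subseteq> (\<Union>i. U i)" unfolding U_def by fastforce
  moreover have "bounded (U i) \<and> diameter (U i) \<le> \<delta>" for i
    using D gW r by (auto simp: U_def intro: order_trans)
  ultimately have "hausdorff_delta s \<delta> A \<le> (\<Sum>i. ennreal (diameter (U i) powr s))"
    unfolding hausdorff_delta_def by (intro INF_lower) auto
  also have "\<dots> = (\<Sum>i<card W. ennreal (diameter (U i) powr s))"
    by (rule suminf_finite) (auto simp: U_def)
  also have "\<dots> \<le> (\<Sum>i<card W. ennreal (r powr s))"
  proof (rule sum_mono)
    fix i assume "i \<in> {..<card W}"
    then have "diameter (U i) \<le> r" "0 \<le> diameter (U i)"
      using D gW diameter_ge_0 by (auto simp: U_def)
    then show "ennreal (diameter (U i) powr s) \<le> ennreal (r powr s)"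
      using s by (intro ennreal_leI powr_mono2) auto
  qed
  also have "\<dots> = ennreal (real (card W) * r powr s)"
    by (simp add: ennreal_mult ennreal_of_nat_eq_real_of_nat)
  finally show ?thesis .
qed

section \<open>From visited cells to the Hausdorff dimension of the limit curve\<close>

lemma Trees_path:
  assumes "t \<in> Trees n"
  shows "t \<in> forests n" "conn t (u 1) (u 2)" "tpath (u 1) t (u 2) \<noteq> []" "2 \<le> length (tpath (u 1) t (u 2))"
proof -
  show f: "t \<in> forests n" and c: "conn t (u 1) (u 2)" using assms unfolding Trees_iff[OF perm123] by blast+
  have ac: "acyclic_graph t" using f by (simp add: forests_def)
  note tp = tpath_props[OF ac c]
  show ne: "tpath (u 1) t (u 2) \<noteq> []" using tp(1) by (simp add: walk_def)
  have "u 1 \<noteq> u 2" using perm3_u_ne[OF perm123] by blast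
  then have "length (tpath (u 1) t (u 2)) \<noteq> 1"
    using tp(3,4) by (auto simp: length_Suc_conv)
  then show "2 \<le> length (tpath (u 1) t (u 2))" using ne by (cases "tpath (u 1) t (u 2)") (auto simp: Suc_le_eq)
qed

lemma Xn_in_cells:
  assumes "t \<in> Trees n" "k \<le> n" "0 \<le> s"
  shows "Xn n t s \<in> (\<Union>w\<in>visited k t 1 2. tri w)"
proof -
  have "t \<in> forests (k + (n - k))" using Trees_path(1)[OF assms(1)] assms(2) by simp
  note tv = tpath_visited[OF perm123 this Trees_path(2)[OF assms(1)]]
  have "0 \<le> ereal (alpha_bar ^ n) * s" using alpha_bar_pos assms(3) by simp
  then show ?thesis unfolding Xn_def
    by (intro LI_in_cells) (use tv Trees_path(4)[OF assms(1)] in auto)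
qed

lemma Xn_hits_cell:
  assumes "t \<in> Trees n" "k \<le> n" "w \<in> visited k t 1 2"
  shows "\<exists>s\<in>{0..\<infinity>}. Xn n t s \<in> tri w"
proof -
  have "t \<in> forests (k + (n - k))" using Trees_path(1)[OF assms(1)] assms(2) by simp
  note tv = tpath_visited[OF perm123 this Trees_path(2)[OF assms(1)]]
  then obtain v where v: "v \<in> set (tpath (u 1) t (u 2))" "v \<in> tri w" using assms(3) by blast
  obtain j :: nat where j: "LI (tpath (u 1) t (u 2)) (ereal j) = v" using LI_vertex[OF v(1)] .
  have "ereal (alpha_bar ^ n) * ereal (j / alpha_bar ^ n) = ereal j" using alpha_bar_pos by simp
  then have "Xn n t (ereal (j / alpha_bar ^ n)) = v" unfolding Xn_def using j by simp
  moreover have "ereal (j / alpha_bar ^ n) \<in> {0..\<infinity>}" using alpha_bar_pos by simp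
  ultimately show ?thesis using v(2) by blast
qed

lemma sum_UN_le:
  fixes g :: "'b \<Rightarrow> real"
  assumes "finite I" "\<And>i. i \<in> I \<Longrightarrow> finite (N i)" "\<And>x. 0 \<le> g x"
  shows "sum g (\<Union>i\<in>I. N i) \<le> (\<Sum>i\<in>I. sum g (N i))"
  using assms(1,2)
proof (induction I)
  case (insert i I)
  have "sum g (\<Union>i\<in>insert i I. N i) \<le> sum g (N i) + sum g (\<Union>i\<in>I. N i)"
    using sum_Un[of "N i" "\<Union>i\<in>I. N i" g] insert sum_nonneg[of "N i \<inter> (\<Union>i\<in>I. N i)" g] assms(3) by simp
  then show ?case using insert by simp
qed simp

context
  fixes t :: "nat \<Rightarrow> graph_edges" and X :: "ereal \<Rightarrow> pt"
  assumes t: "\<And>n. t n \<in> Trees n"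
    and lim: "uniform_limit {0..\<infinity>} (\<lambda>n. Xn n (t n)) X sequentially"
begin

lemma compact_curve: "compact (X ` {0..\<infinity>})"
  by (rule compact_limit_curve[OF lim]) (rule continuous_on_Xn[OF Trees_path(3)[OF t]])

text \<open>A finite open cover of the compact curve also covers the approximating path for all
  large \<open>n\<close>. Every visited cell of level \<open>n\<close> is met by that path, so the
  cells of level \<open>k i\<close> meeting the \<open>i\<close>-th ball form a cutset, at most 100
  of them for each ball.\<close>

lemma curve_hausdorff_delta_pos:
  assumes s: "0 < s" and \<eta>: "0 < \<eta>"
    and freq: "\<exists>\<^sub>F n in sequentially. \<eta> \<le> theta (2 powr - s) n (t n) 1 2"
  shows "0 < hausdorff_delta s 1 (X ` {0..\<infinity>})"
proof (rule hausdorff_delta_pos[OF compact_curve s])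
  show "0 < \<eta> / 100" using \<eta> by simp
  fix I :: "nat set" and c :: "nat \<Rightarrow> pt" and k
  assume I: "finite I" and cov: "X ` {0..\<infinity>} \<subseteq> (\<Union>i\<in>I. ball (c i) (2 / 2 ^ k i))"
  let ?O = "\<Union>i\<in>I. ball (c i) (2 / 2 ^ k i)"
  define l :: real where "l = 2 powr - s"
  have l: "0 \<le> l" "l \<le> 1" using s powr_mono[of "-s" 0 2] by (auto simp: l_def)
  have "open ?O" by blast
  from compact_subset_open_imp_ball_epsilon_subset[OF compact_curve this cov]
  obtain e where e: "0 < e" "(\<Union>x\<in>X ` {0..\<infinity>}. ball x e) \<subseteq> ?O" by blast
  \<comment> \<open>One \<open>n\<close> has to serve three purposes: the survival bound, closeness
    of the path to the curve, and a level at least that of every ball. The first holds frequently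
    and the others eventually.\<close>
  have "\<forall>\<^sub>F n in sequentially. (\<forall>r\<in>{0..\<infinity>}. dist (Xn n (t n) r) (X r) < e) \<and> (\<forall>i\<in>I. k i \<le> n)"
    using uniform_limitD[OF lim e(1)] I by (auto simp: eventually_conj_iff eventually_ball_finite_distrib intro: eventually_ge_at_top)
  from frequently_ex[OF frequently_eventually_conj[OF freq this]]
  obtain n where n: "\<eta> \<le> theta l n (t n) 1 2" "\<And>r. r \<in> {0..\<infinity>} \<Longrightarrow> dist (Xn n (t n) r) (X r) < e"
    "\<And>i. i \<in> I \<Longrightarrow> k i \<le> n"
    unfolding l_def by blast
  define N where "N i = {w \<in> words (k i). tri w \<inter> ball (c i) (2 / 2 ^ k i) \<noteq> {}}" for i
  have finN: "finite (N i)" for i unfolding N_def using finite_words by simp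
  have "theta l n (t n) 1 2 \<le> (\<Sum>v\<in>(\<Union>i\<in>I. N i). l ^ length v)"
  proof (rule theta_le_cutset[OF l perm123])
    show "finite (\<Union>i\<in>I. N i)" using I finN by blast
    fix w assume w: "w \<in> visited n (t n) 1 2"
    have wn: "w \<in> words n" by (rule visited_words[OF perm123 w])
    obtain r where r: "r \<in> {0..\<infinity>}" "Xn n (t n) r \<in> tri w" using Xn_hits_cell[OF t order_refl w] by blast
    have "Xn n (t n) r \<in> ball (X r) e" using n(2)[OF r(1)] by (simp add: dist_commute)
    then have "Xn n (t n) r \<in> ?O" using e(2) r(1) by blast
    then obtain i where i: "i \<in> I" "Xn n (t n) r \<in> ball (c i) (2 / 2 ^ k i)" by blast
    have "take (k i) w \<in> words (k i)"
      using wn n(3)[OF i(1)] set_take_subset[of "k i" w] by (auto simp: words_def)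
    moreover have "Xn n (t n) r \<in> tri (take (k i) w)"
      using r(2) psiw_take_Tri[of w "k i"] wn by (auto simp: words_def)
    ultimately have "take (k i) w \<in> N i" using i(2) unfolding N_def by blast
    then show "\<exists>j. take j w \<in> (\<Union>i\<in>I. N i)" using i(1) by blast
  qed
  also have "\<dots> \<le> (\<Sum>i\<in>I. \<Sum>v\<in>N i. l ^ length v)"
    by (rule sum_UN_le[OF I finN]) (use l in simp)
  also have "\<dots> = (\<Sum>i\<in>I. card (N i) * l ^ k i)"
    by (rule sum.cong[OF refl]) (simp add: N_def words_def)
  also have "\<dots> \<le> (\<Sum>i\<in>I. 100 * l ^ k i)"
  proof (rule sum_mono)
    fix i
    have "card (N i) \<le> 100" unfolding N_def by (rule card_near_cells)
    then show "card (N i) * l ^ k i \<le> 100 * l ^ k i" using l by (intro mult_right_mono) auto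
  qed
  finally have "\<eta> \<le> 100 * (\<Sum>i\<in>I. l ^ k i)" using n(1) by (simp add: sum_distrib_left)
  then show "\<eta> / 100 \<le> (\<Sum>i\<in>I. (2 powr - s) ^ k i)" by (simp add: l_def)
qed

text \<open>The curve stays within \<open>1 / 2 ^ k\<close> of the visited cells of level
  \<open>k\<close> of a path that is close enough, so the slightly enlarged cells cover it. First
  \<open>k\<close> is fixed and then \<open>n\<close> is chosen depending on it.\<close>

lemma curve_hausdorff_measure_zero:
  assumes s: "0 \<le> s" and c: "(\<lambda>k. c k * (8 / 2 ^ k) powr s) \<longlonglongrightarrow> 0"
    and freq: "\<exists>\<^sub>F k in sequentially. \<exists>\<^sub>F n in sequentially. ncells k (t n) 1 2 < c k"
  shows "hausdorff_measure s (X ` {0..\<infinity>}) = 0"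
proof -
  have "hausdorff_delta s \<delta> (X ` {0..\<infinity>}) \<le> ennreal e" if \<delta>: "0 < \<delta>" and e: "0 < e" for \<delta> e :: real
  proof -
    have "(\<lambda>k. 8 / 2 ^ k :: real) \<longlonglongrightarrow> 0" by real_asymp
    then have "\<forall>\<^sub>F k in sequentially. 8 / 2 ^ k < \<delta>" by (rule order_tendstoD(2)[OF _ \<delta>])
    moreover have "\<forall>\<^sub>F k in sequentially. c k * (8 / 2 ^ k) powr s < e" by (rule order_tendstoD(2)[OF c e])
    ultimately have "\<forall>\<^sub>F k in sequentially. 8 / 2 ^ k < \<delta> \<and> c k * (8 / 2 ^ k) powr s < e"
      by (rule eventually_conj)
    from frequently_ex[OF frequently_eventually_conj[OF freq this]]
    obtain k where k: "\<exists>\<^sub>F n in sequentially. ncells k (t n) 1 2 < c k" "8 / 2 ^ k < \<delta>" "c k * (8 / 2 ^ k) powr s < e"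
      by blast
    have "\<forall>\<^sub>F n in sequentially. (\<forall>r\<in>{0..\<infinity>}. dist (Xn n (t n) r) (X r) < 1 / 2 ^ k) \<and> k \<le> n"
      by (rule eventually_conj[OF uniform_limitD[OF lim] eventually_ge_at_top]) simp
    from frequently_ex[OF frequently_eventually_conj[OF k(1) this]]
    obtain n where n: "ncells k (t n) 1 2 < c k" "\<And>r. r \<in> {0..\<infinity>} \<Longrightarrow> dist (Xn n (t n) r) (X r) < 1 / 2 ^ k" "k \<le> n"
      by blast
    let ?W = "visited k (t n) 1 2"
    \<comment> \<open>Cells enlarged by \<open>1 / 2 ^ k\<close> have diameter at most
      \<open>(2 + 1 + 1) / 2 ^ k\<close>; the constant 8 leaves room.\<close>
    define D where "D w = {x. \<exists>y\<in>tri w. dist y x \<le> 1 / 2 ^ k}" for w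
    have D: "dist x y \<le> 8 / 2 ^ k" if x: "x \<in> D w" and y: "y \<in> D w" and w: "w \<in> ?W" for x y w
    proof -
      obtain x' where x': "x' \<in> Tri" "dist (psiw w x') x \<le> 1 / 2 ^ k" using x unfolding D_def by blast
      obtain y' where y': "y' \<in> Tri" "dist (psiw w y') y \<le> 1 / 2 ^ k" using y unfolding D_def by blast
      have "length w = k" using visited_words[OF perm123 w] by (simp add: words_def)
      then have "dist (psiw w x') (psiw w y') \<le> 2 / 2 ^ k"
        using dist_Tri[OF x'(1) y'(1)] by (simp add: dist_psiw divide_right_mono)
      moreover have "dist x y \<le> dist (psiw w x') x + dist (psiw w x') (psiw w y') + dist (psiw w y') y"
        using dist_triangle[of x y "psiw w x'"] dist_triangle[of "psiw w x'" y "psiw w y'"]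
        by (simp add: dist_commute)
      ultimately have "dist x y \<le> 4 / 2 ^ k" using x' y' by simp
      also have "\<dots> \<le> 8 / 2 ^ k" by (simp add: divide_right_mono)
      finally show ?thesis .
    qed
    have "hausdorff_delta s \<delta> (X ` {0..\<infinity>}) \<le> ennreal (real (card ?W) * (8 / 2 ^ k) powr s)"
    proof (rule hausdorff_delta_le_finite_cover[OF finite_visited, where D = D])
      show "X ` {0..\<infinity>} \<subseteq> (\<Union>w\<in>?W. D w)"
      proof
        fix x assume "x \<in> X ` {0..\<infinity>}"
        then obtain r where r: "r \<in> {0..\<infinity>}" "x = X r" by blast
        have "Xn n (t n) r \<in> (\<Union>w\<in>?W. tri w)"
          by (rule Xn_in_cells[OF t n(3)]) (use r in simp)
        then obtain w where w: "w \<in> ?W" "Xn n (t n) r \<in> tri w" by blast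
        have "x \<in> D w" unfolding D_def r(2) using w(2) less_imp_le[OF n(2)[OF r(1)]] by blast
        then show "x \<in> (\<Union>w\<in>?W. D w)" using w(1) by blast
      qed
      fix w assume w: "w \<in> ?W"
      show "bounded (D w)"
        unfolding bounded_two_points using D w by blast
      show "diameter (D w) \<le> 8 / 2 ^ k"
        by (rule diameter_le) (use D[OF _ _ w] in \<open>simp_all add: dist_norm\<close>)
    qed (use k s in auto)
    also have "\<dots> \<le> ennreal (c k * (8 / 2 ^ k) powr s)"
      using card_visited[of k "t n" 1 2] n(1) by (intro ennreal_leI mult_right_mono) auto
    also have "\<dots> \<le> ennreal e" using k(3) by (intro ennreal_leI) simp
    finally show ?thesis .
  qed
  note le = this
  have "hausdorff_delta s \<delta> (X ` {0..\<infinity>}) \<le> 0" if "0 < \<delta>" for \<delta>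
  proof (rule ennreal_le_epsilon)
    fix e :: real assume "0 < e"
    with le[OF that] show "hausdorff_delta s \<delta> (X ` {0..\<infinity>}) \<le> 0 + ennreal e" by simp
  qed
  then have "hausdorff_delta s \<delta> (X ` {0..\<infinity>}) = 0" if "0 < \<delta>" for \<delta>
    using that by simp
  then show ?thesis unfolding hausdorff_measure_def by simp
qed

end

text \<open>Only the countably many exponents \<open>d + 1 / Suc m\<close> and
  \<open>d - 1 / Suc m\<close> occur, so the assumptions can hold almost surely for all of them at
  once. For the lower bound, positivity at the single scale 1 suffices, since the measure is a
  supremum over scales.\<close>

lemma hausdorff_dim_eqI:
  assumes d: "0 \<le> d" and up: "\<And>m :: nat. hausdorff_measure (d + 1 / Suc m) A = 0"
    and lo: "\<And>m :: nat. m \<ge> m0 \<Longrightarrow> 0 < hausdorff_delta (d - 1 / Suc m) 1 A"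
  shows "hausdorff_dim A = d"
proof -
  define S where "S = {s. s \<ge> 0 \<and> hausdorff_measure s A = 0}"
  have up': "d + 1 / Suc m \<in> S" for m using up d by (simp add: S_def add_nonneg_nonneg)
  have lo': "d \<le> s" if "s \<in> S" for s
  proof (rule ccontr)
    assume "\<not> d \<le> s"
    then obtain m where "1 / Suc m < d - s" using nat_approx_posE[of "d - s"] by auto
    define m' where "m' = max m m0"
    have "1 / Suc m' \<le> 1 / Suc m" by (intro divide_left_mono) (auto simp: m'_def)
    then have "s \<le> d - 1 / Suc m'" using \<open>1 / Suc m < d - s\<close> by simp
    then have "hausdorff_delta (d - 1 / Suc m') 1 A \<le> hausdorff_delta s 1 A" by (rule hausdorff_delta_antimono)
    also have "\<dots> \<le> hausdorff_measure s A" unfolding hausdorff_measure_def by (rule SUP_upper) simp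
    also have "\<dots> = 0" using that by (simp add: S_def)
    finally show False using lo[of m'] by (simp add: m'_def)
  qed
  have "Inf S = d"
  proof (rule antisym)
    show "d \<le> Inf S" by (rule cInf_greatest) (use up' lo' in auto)
    show "Inf S \<le> d"
    proof (rule field_le_epsilon)
      fix e :: real assume "0 < e"
      then obtain m where "1 / Suc m < e" using nat_approx_posE by blast
      moreover have "Inf S \<le> d + 1 / Suc m"
        by (rule cInf_lower[OF up' bdd_belowI[OF lo']])
      ultimately show "Inf S \<le> d + e" by simp
    qed
  qed
  then show ?thesis by (simp add: hausdorff_dim_def S_def)
qed

subsection \<open>Almost sure statements\<close>

context prob_space
begin

text \<open>Fatou's lemma for the lower limit of events: the intersection from \<open>m\<close> on
  lies in a single late \<open>B n\<close>, and these intersections increase with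
  \<open>m\<close>.\<close>

lemma prob_eventually_le:
  assumes B: "\<And>n :: nat. B n \<in> events" and le: "\<And>n. n \<ge> n0 \<Longrightarrow> prob (B n) \<le> c"
  shows "{\<omega> \<in> space M. \<forall>\<^sub>F n in sequentially. \<omega> \<in> B n} \<in> events \<and>
    prob {\<omega> \<in> space M. \<forall>\<^sub>F n in sequentially. \<omega> \<in> B n} \<le> c"
proof -
  define A where "A m = (\<Inter>n\<in>{m..}. B n)" for m
  have A: "A m \<in> events" for m unfolding A_def using B by (intro sets.countable_INT') auto
  have eq: "{\<omega> \<in> space M. \<forall>\<^sub>F n in sequentially. \<omega> \<in> B n} = (\<Union>m. A m)"
    using B[THEN sets.sets_into_space] by (auto simp: A_def eventually_sequentially)
  have "incseq A" unfolding incseq_def A_def by (auto intro: le_trans)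
  then have "(\<lambda>m. prob (A m)) \<longlonglongrightarrow> prob (\<Union>m. A m)"
    using A by (intro finite_Lim_measure_incseq) auto
  moreover have "prob (A m) \<le> c" for m
  proof -
    have "prob (A m) \<le> prob (B (max m n0))"
      by (rule finite_measure_mono) (auto simp: A_def B)
    also have "\<dots> \<le> c" by (rule le) simp
    finally show ?thesis .
  qed
  ultimately have "prob (\<Union>m. A m) \<le> c" by (intro LIMSEQ_le_const2) auto
  then show ?thesis unfolding eq using A by auto
qed

text \<open>\<open>prob_eventually_le\<close> is applied first in \<open>n\<close>, with bound
  \<open>c k\<close>, and then in \<open>k\<close>, with an arbitrarily small bound. Convergence of
  \<open>c\<close> to 0 suffices, without summability.\<close>

lemma AE_frequently_frequently:
  assumes B: "\<And>k n :: nat. B k n \<in> events" and le: "\<And>k n. n \<ge> k \<Longrightarrow> prob (B k n) \<le> c k"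
    and c: "c \<longlonglongrightarrow> 0"
  shows "AE \<omega> in M. \<exists>\<^sub>F k in sequentially. \<exists>\<^sub>F n in sequentially. \<omega> \<notin> B k n"
proof -
  define E where "E k = {\<omega> \<in> space M. \<forall>\<^sub>F n in sequentially. \<omega> \<in> B k n}" for k
  have E: "E k \<in> events \<and> prob (E k) \<le> c k" for k
    unfolding E_def by (rule prob_eventually_le[OF B le])
  define N where "N = {\<omega> \<in> space M. \<forall>\<^sub>F k in sequentially. \<omega> \<in> E k}"
  have N: "N \<in> events \<and> prob N \<le> e" if e: "0 < e" for e
  proof -
    obtain k0 where "\<And>k. k \<ge> k0 \<Longrightarrow> c k < e"
      using order_tendstoD(2)[OF c e] unfolding eventually_sequentially by blast
    then have "prob (E k) \<le> e" if "k \<ge> k0" for k using E[of k] that by fastforce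
    then show ?thesis unfolding N_def using E by (intro prob_eventually_le) auto
  qed
  have "prob N = 0"
    by (rule antisym[OF field_le_epsilon]) (use N in auto)
  moreover have "N \<in> events" using N[of 1] by simp
  ultimately have "N \<in> null_sets M" by (simp add: null_sets_def emeasure_eq_measure)
  moreover have "{\<omega> \<in> space M. \<not> (\<exists>\<^sub>F k in sequentially. \<exists>\<^sub>F n in sequentially. \<omega> \<notin> B k n)} \<subseteq> N"
    by (auto simp: N_def E_def frequently_def elim: eventually_mono)
  ultimately show ?thesis by (rule AE_I')
qed

end

section \<open>Almost sure bounds for uniform spanning trees\<close>

locale uniform_trees = prob_space M for M :: "'a measure" +
  fixes T :: "nat \<Rightarrow> 'a \<Rightarrow> graph_edges"
  assumes T_meas: "\<And>n. T n \<in> measurable M (count_space UNIV)"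
    and T_unif: "\<And>n t. t \<in> Trees n \<Longrightarrow> prob {\<omega> \<in> space M. T n \<omega> = t} = 1 / real (card (Trees n))"
begin

lemma T_event: "{\<omega> \<in> space M. P (T n \<omega>)} \<in> events"
proof -
  have "T n -` {t. P t} \<inter> space M \<in> events" by (rule measurable_sets[OF T_meas]) simp
  moreover have "T n -` {t. P t} \<inter> space M = {\<omega> \<in> space M. P (T n \<omega>)}" by auto
  ultimately show ?thesis by simp
qed

lemma card_Trees_pos: "0 < card (Trees n)"
  using class_cards[of n] by auto

lemma prob_T_in:
  assumes "A \<subseteq> Trees n"
  shows "prob {\<omega> \<in> space M. T n \<omega> \<in> A} = card A / card (Trees n)"
proof -
  have fin: "finite A" using finite_subset[OF assms finite_Trees] .
  have "{\<omega> \<in> space M. T n \<omega> \<in> A} = (\<Union>t\<in>A. {\<omega> \<in> space M. T n \<omega> = t})" by auto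
  moreover have "prob (\<Union>t\<in>A. {\<omega> \<in> space M. T n \<omega> = t}) = (\<Sum>t\<in>A. prob {\<omega> \<in> space M. T n \<omega> = t})"
    by (rule finite_measure_finite_Union[OF fin]) (auto simp: disjoint_family_on_def intro: T_event[where P = "\<lambda>x. x = i" for i])
  moreover have "\<dots> = (\<Sum>t\<in>A. 1 / real (card (Trees n)))"
    by (rule sum.cong) (use assms T_unif in auto)
  ultimately show ?thesis by simp
qed

lemma AE_T_Trees: "AE \<omega> in M. \<forall>n. T n \<omega> \<in> Trees n"
proof -
  have "AE \<omega> in M. T n \<omega> \<in> Trees n" for n
  proof -
    have "prob {\<omega> \<in> space M. T n \<omega> \<in> Trees n} = 1"
      using prob_T_in[OF order_refl, of n] card_Trees_pos[of n] by simp
    then show ?thesis using AE_prob_1[of "{\<omega> \<in> space M. T n \<omega> \<in> Trees n}"] by auto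
  qed
  then show ?thesis by (simp add: AE_all_countable)
qed

text \<open>Under the uniform law a probability is an average of an indicator over
  \<open>Trees n\<close>, and \<open>h\<close> dominates the indicator. Markov's inequality enters
  by choosing \<open>h\<close> as a rescaled nonnegative quantity.\<close>

lemma prob_le_avg:
  assumes "avg_le n h q r" "\<And>f a b. of_bool (P f a b) \<le> h f a b"
  shows "prob {\<omega> \<in> space M. P (T n \<omega>) 1 2} \<le> q"
proof -
  let ?A = "{t \<in> Trees n. P t 1 2}"
  have "AE \<omega> in M. \<omega> \<in> {\<omega> \<in> space M. P (T n \<omega>) 1 2} \<longleftrightarrow> \<omega> \<in> {\<omega> \<in> space M. T n \<omega> \<in> ?A}"
    using AE_T_Trees by (rule AE_mp) (rule AE_I2, auto)
  then have "prob {\<omega> \<in> space M. P (T n \<omega>) 1 2} = prob {\<omega> \<in> space M. T n \<omega> \<in> ?A}"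
    by (rule finite_measure_eq_AE) (rule T_event)+
  also have "\<dots> = card ?A / card (Trees n)" by (rule prob_T_in) auto
  also have "real (card ?A) = (\<Sum>f\<in>Trees n. of_bool (P f 1 2))"
    by (simp add: finite_Trees sum_of_bool_eq Int_def)
  also have "\<dots> \<le> (\<Sum>f\<in>Trees n. h f 1 2)" by (rule sum_mono) (rule assms)
  also have "\<dots> \<le> q * card (Trees n)" using assms(1) perm123 unfolding avg_le_def by blast
  finally show ?thesis using card_Trees_pos[of n] by (simp add: divide_right_mono field_simps)
qed

text \<open>For almost every outcome some \<open>k\<close> has \<open>theta\<close> at least
  \<open>l ^ k * \<delta>\<close> for infinitely many \<open>n\<close>. The bound \<eta> therefore
  depends on the outcome, which is harmless because only positivity of the Hausdorff content is
  wanted.\<close>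

lemma AE_theta_frequently:
  assumes l: "0 < l" "l \<le> 1" "1 < l * alpha_bar"
  shows "AE \<omega> in M. \<exists>\<eta>>0. \<exists>\<^sub>F n in sequentially. \<eta> \<le> theta l n (T n \<omega>) 1 2"
proof -
  obtain r \<delta> where r: "0 \<le> r" "r < 1" "0 < \<delta>"
    "\<And>k n. avg_le (k + n) (\<lambda>f a b. of_bool (theta l (k + n) f a b < l ^ k * \<delta>)) (r ^ (2 ^ k)) (r ^ (2 ^ k))"
    using avg_theta_small[OF l] by blast
  define B where "B k n = {\<omega> \<in> space M. theta l n (T n \<omega>) 1 2 < l ^ k * \<delta>}" for k n
  have "prob (B k n) \<le> r ^ k" if "k \<le> n" for k n
  proof -
    have "avg_le n (\<lambda>f a b. of_bool (theta l n f a b < l ^ k * \<delta>)) (r ^ (2 ^ k)) (r ^ (2 ^ k))"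
      using r(4)[of k "n - k"] that by simp
    then have "prob (B k n) \<le> r ^ (2 ^ k)" unfolding B_def by (rule prob_le_avg) simp
    also have "\<dots> \<le> r ^ k" using r by (intro power_decreasing) (auto intro: less_imp_le)
    finally show ?thesis .
  qed
  then have "AE \<omega> in M. \<exists>\<^sub>F k in sequentially. \<exists>\<^sub>F n in sequentially. \<omega> \<notin> B k n"
    by (rule AE_frequently_frequently[rotated])
      (use r in \<open>auto simp: B_def intro: T_event LIMSEQ_realpow_zero\<close>)
  then show ?thesis
  proof (rule AE_mp, intro AE_I2 impI)
    fix \<omega> assume \<omega>: "\<omega> \<in> space M" and "\<exists>\<^sub>F k in sequentially. \<exists>\<^sub>F n in sequentially. \<omega> \<notin> B k n"
    then obtain k where "\<exists>\<^sub>F n in sequentially. \<omega> \<notin> B k n" by (auto dest: frequently_ex)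
    then have "\<exists>\<^sub>F n in sequentially. l ^ k * \<delta> \<le> theta l n (T n \<omega>) 1 2"
      by (rule frequently_elim1) (use \<omega> in \<open>auto simp: B_def\<close>)
    then show "\<exists>\<eta>>0. \<exists>\<^sub>F n in sequentially. \<eta> \<le> theta l n (T n \<omega>) 1 2"
      using l r by (intro exI[of _ "l ^ k * \<delta>"]) auto
  qed
qed

text \<open>Markov's inequality with a threshold \<open>c k\<close> that outgrows the mean, which is
  at most \<open>2 * alpha_bar ^ k\<close>.\<close>

lemma AE_ncells_frequently:
  assumes c: "\<And>k. 0 < c k" "(\<lambda>k. 2 * alpha_bar ^ k / c k) \<longlonglongrightarrow> 0"
  shows "AE \<omega> in M. \<exists>\<^sub>F k in sequentially. \<exists>\<^sub>F n in sequentially. ncells k (T n \<omega>) 1 2 < c k"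
proof -
  define B where "B k n = {\<omega> \<in> space M. c k \<le> ncells k (T n \<omega>) 1 2}" for k n
  have "prob (B k n) \<le> 2 * alpha_bar ^ k / c k" if "k \<le> n" for k n
  proof -
    have "avg_le n (ncells k) (2 * alpha_bar ^ k) ((3 * alpha_bar - 5) * alpha_bar ^ k)"
      using avg_ncells[of k "n - k"] that by simp
    from avg_le_affine[OF this, of "1 / c k" 0]
    have "avg_le n (\<lambda>f a b. ncells k f a b / c k) (2 * alpha_bar ^ k / c k) ((3 * alpha_bar - 5) * alpha_bar ^ k / c k)"
      using c(1)[of k] by simp
    then show ?thesis unfolding B_def
      by (rule prob_le_avg) (use c(1)[of k] ncells_nonneg in \<open>auto simp: divide_simps\<close>)
  qed
  then have "AE \<omega> in M. \<exists>\<^sub>F k in sequentially. \<exists>\<^sub>F n in sequentially. \<omega> \<notin> B k n"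
    by (rule AE_frequently_frequently[rotated]) (use c in \<open>auto simp: B_def intro: T_event\<close>)
  then show ?thesis
  proof (rule AE_mp, intro AE_I2 impI)
    fix \<omega> assume \<omega>: "\<omega> \<in> space M" and "\<exists>\<^sub>F k in sequentially. \<exists>\<^sub>F n in sequentially. \<omega> \<notin> B k n"
    then show "\<exists>\<^sub>F k in sequentially. \<exists>\<^sub>F n in sequentially. ncells k (T n \<omega>) 1 2 < c k"
      by (elim frequently_elim1) (use \<omega> in \<open>auto simp: B_def\<close>)
  qed
qed

end

theorem mainTheorem14:
  fixes M :: "'a measure" and T :: "nat \<Rightarrow> 'a \<Rightarrow> graph_edges" and X :: "'a \<Rightarrow> ereal \<Rightarrow> pt"
  assumes "prob_space M"
    and "\<And>n. T n \<in> measurable M (count_space UNIV)"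
    and "\<And>n t. t \<in> Trees n \<Longrightarrow>
           measure M {\<omega> \<in> space M. T n \<omega> = t} = 1 / real (card (Trees n))"
    and "\<And>n \<omega>. \<omega> \<in> space M \<Longrightarrow> Tr n (T (Suc n) \<omega>) = T n \<omega>"
    and "AE \<omega> in M. uniform_limit {0..\<infinity>} (\<lambda>n. Xn n (T n \<omega>)) (X \<omega>) sequentially"
  shows "AE \<omega> in M. hausdorff_dim (X \<omega> ` {0..\<infinity>}) = ln alpha_bar / ln 2"
proof -
  interpret uniform_trees M T
    using assms(1-3) by (simp add: uniform_trees_def uniform_trees_axioms_def)
  define d where "d = ln alpha_bar / ln 2"
  have d2: "2 powr d = alpha_bar" using alpha_bar_pos by (simp add: d_def powr_def)
  \<comment> \<open>\<open>d > 1\<close> keeps every exponent \<open>d - 1 / Suc m\<close> positive,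
    including \<open>m = 0\<close>.\<close>
  have "ln 2 < ln alpha_bar" using alpha_bar_bounds by simp
  then have d: "1 < d" by (simp add: d_def)
  have lower: "AE \<omega> in M. \<exists>\<eta>>0. \<exists>\<^sub>F n in sequentially. \<eta> \<le> theta (2 powr - (d - 1 / Suc m)) n (T n \<omega>) 1 2"
    for m :: nat
  proof (rule AE_theta_frequently)
    have m: "1 / real (Suc m) \<le> 1" "0 < 1 / real (Suc m)" by simp_all
    show "0 < 2 powr - (d - 1 / Suc m)" by simp
    have "- (d - 1 / Suc m) \<le> 0" using m d by linarith
    then show "2 powr - (d - 1 / Suc m) \<le> 1" using powr_mono[of "- (d - 1 / Suc m)" 0 2] by simp
    \<comment> \<open>With \<open>alpha_bar = 2 powr d\<close> the product is
      \<open>2 powr (1 / Suc m)\<close>, so percolation is supercritical for each exponent below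
      \<open>d\<close>.\<close>
    have "2 powr - (d - 1 / Suc m) * alpha_bar = 2 powr (- (d - 1 / Suc m) + d)"
      unfolding d2[symmetric] by (rule powr_add[symmetric])
    also have "\<dots> > 2 powr 0" using m by (intro powr_less_mono) auto
    finally show "1 < 2 powr - (d - 1 / Suc m) * alpha_bar" by simp
  qed
  \<comment> \<open>The exponent is halfway between \<open>d\<close> and
    \<open>d + 1 / Suc m\<close>: large enough for \<open>c m k\<close> to outgrow
    \<open>alpha_bar ^ k\<close>, small enough for the cost of the cover at exponent
    \<open>d + 1 / Suc m\<close> to tend to 0.\<close>
  define c where "c m k = (2 powr (d + 1 / (2 * Suc m))) ^ k" for m k :: nat
  have upper: "AE \<omega> in M. \<exists>\<^sub>F k in sequentially. \<exists>\<^sub>F n in sequentially. ncells k (T n \<omega>) 1 2 < c m k"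
    for m :: nat
  proof (rule AE_ncells_frequently)
    show "0 < c m k" for k by (simp add: c_def)
    have "2 * alpha_bar ^ k / c m k = 2 * (2 powr (- 1 / (2 * Suc m))) ^ k" for k
    proof -
      have e: "alpha_bar / 2 powr (d + 1 / (2 * Suc m)) = 2 powr (- 1 / (2 * Suc m))"
        unfolding d2[symmetric] by (simp add: powr_diff[symmetric])
      show ?thesis unfolding c_def e[symmetric] by (simp add: power_divide)
    qed
    moreover have "2 powr (- 1 / (2 * Suc m)) < (1 :: real)"
      using powr_less_mono[of "- 1 / (2 * Suc m)" 0 2] by simp
    then have "(\<lambda>k. 2 * (2 powr (- 1 / (2 * real (Suc m)))) ^ k :: real) \<longlonglongrightarrow> 2 * 0"
      by (intro tendsto_mult tendsto_const LIMSEQ_realpow_zero) auto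
    ultimately show "(\<lambda>k. 2 * alpha_bar ^ k / c m k) \<longlonglongrightarrow> 0" by simp
  qed
  have c_lim: "(\<lambda>k. c m k * (8 / 2 ^ k) powr (d + 1 / Suc m)) \<longlonglongrightarrow> 0" for m
  proof -
    let ?s = "d + 1 / Suc m" and ?s' = "d + 1 / (2 * Suc m)"
    have lt: "?s' < ?s" by (simp add: field_simps)
    have "c m k * (8 / 2 ^ k) powr ?s = 8 powr ?s * (2 powr (?s' - ?s)) ^ k" for k
    proof -
      have "(8 / 2 ^ k) powr ?s = 8 powr ?s / (2 powr ?s) ^ k"
        by (simp add: powr_divide powr_realpow[symmetric] powr_powr mult.commute)
      then show ?thesis unfolding c_def powr_diff by (simp add: power_divide)
    qed
    moreover have "2 powr (?s' - ?s) < (1 :: real)" using powr_less_mono[of "?s' - ?s" 0 2] lt by simp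
    then have "(\<lambda>k. 8 powr ?s * (2 powr (?s' - ?s)) ^ k) \<longlonglongrightarrow> 8 powr ?s * 0"
      by (intro tendsto_mult tendsto_const LIMSEQ_realpow_zero) auto
    ultimately show ?thesis by simp
  qed
  have "AE \<omega> in M. \<forall>m. \<exists>\<eta>>0. \<exists>\<^sub>F n in sequentially. \<eta> \<le> theta (2 powr - (d - 1 / Suc m)) n (T n \<omega>) 1 2"
    unfolding AE_all_countable using lower by blast
  moreover have "AE \<omega> in M. \<forall>m. \<exists>\<^sub>F k in sequentially. \<exists>\<^sub>F n in sequentially. ncells k (T n \<omega>) 1 2 < c m k"
    unfolding AE_all_countable using upper by blast
  ultimately show ?thesis
    using AE_T_Trees assms(5)
  proof eventually_elim
    case (elim \<omega>)
    have "hausdorff_dim (X \<omega> ` {0..\<infinity>}) = d"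
    proof (rule hausdorff_dim_eqI)
      show "0 \<le> d" using d by simp
      show "hausdorff_measure (d + 1 / Suc m) (X \<omega> ` {0..\<infinity>}) = 0" for m
        by (rule curve_hausdorff_measure_zero[OF _ elim(4) _ c_lim[of m]]) (use elim d in \<open>auto simp: add_nonneg_nonneg\<close>)
      show "0 < hausdorff_delta (d - 1 / Suc m) 1 (X \<omega> ` {0..\<infinity>})" for m
      proof -
        obtain \<eta> where "0 < \<eta>" "\<exists>\<^sub>F n in sequentially. \<eta> \<le> theta (2 powr - (d - 1 / Suc m)) n (T n \<omega>) 1 2"
          using elim(1) by blast
        moreover have "1 / real (Suc m) \<le> 1" by simp
        then have "0 < d - 1 / Suc m" using d by linarith
        ultimately show ?thesis
          using curve_hausdorff_delta_pos[of "\<lambda>n. T n \<omega>" "X \<omega>" "d - 1 / Suc m" \<eta>] elim(3,4) by blast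
      qed
    qed
    then show ?case by (simp add: d_def)
  qed
qed

end
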